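(* Let $\varphi_2:X(\mathfrak{so}_4,\mathfrak{so}_2\oplus\mathfrak{so}_2)^{tw}\hookrightarrow Y^+(2)\otimes Y^+(2)$ be the algebra embedding $S(u)\mapsto S^\circ(u-1/2)\,K_1\,S^\bullet(u-1/2)\,K_2$, and let $\mathrm{Pr}_1$ and $\mathrm{Pr}_2$ denote the natural projection $Y^+(2)\to SY^+(2)$ applied to the first and to the second tensor factor, respectively. The compositions $\chi_2^{(1)}=\mathrm{Pr}_1\circ\varphi_2$ and $\chi_2^{(2)}=\mathrm{Pr}_2\circ\varphi_2$ define algebra isomorphisms $$X(\mathfrak{so}_4,\mathfrak{so}_2\oplus\mathfrak{so}_2)^{tw}\cong SY^+(2)\otimes Y^+(2)\qquad\text{and}\qquad X(\mathfrak{so}_4,\mathfrak{so}_2\oplus\mathfrak{so}_2)^{tw}\cong Y^+(2)\otimes SY^+(2),$$ respectively.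
   Context: All algebras are unital associative over $\mathbb C$; $P=\sum E_{ij}\otimes E_{ji}$. $2\times2$ notation: indices in $\{-1,1\}$, $K=E_{11}-E_{-1,-1}$, $(E_{ij})^{t_+}=E_{-j,-i}$, $R^\circ(u)=I-\frac Pu$. $Y(2)$ is generated by the coefficients of $T^\circ(u)=I+O(u^{-1})$ with relation $R^\circ(u-v)T^\circ_1(u)T^\circ_2(v)=T^\circ_2(v)T^\circ_1(u)R^\circ(u-v)$. The series $\mathrm{qdet}\,T^\circ(u)=t^\circ_{-1,-1}(u-1)t^\circ_{11}(u)-t^\circ_{-1,1}(u-1)t^\circ_{1,-1}(u)$ has central coefficients; $SY(2)=Y(2)/(\mathrm{qdet}\,T^\circ(u)-1)$, and $\mathcal T^\circ(u)$ is the image of $T^\circ(u)$. $Y^+(2)\subset Y(2)$ is the subalgebra generated by the coefficients of its generating matrix $T^\circ(u)T^\circ(-u)^{t_+}$; $SY^+(2)\subset SY(2)$ is generated by the coefficients of $\mathcal T^\circ(u)\mathcal T^\circ(-u)^{t_+}$; the natural projection $Y^+(2)\to SY^+(2)$ is the restriction of $Y(2)\to SY(2)$. $S^\circ(u)$ and $S^\bullet(u)$ denote the generating matrices of the first and second copy of $Y^+(2)$. $\mathfrak{so}_4$: $4\times4$ matrices are indexed by $\{-2,-1,1,2\}$, $(E_{ij})^t=E_{-j,-i}$, $Q=\sum E_{ij}\otimes E_{-i,-j}$, $R(u)=I-\frac Pu+\frac Q{u-1}$. $X(\mathfrak{so}_4)$ is generated by the coefficients of the $4\times4$ matrix $T(u)=I+O(u^{-1})$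 with relation $R(u-v)T_1(u)T_2(v)=T_2(v)T_1(u)R(u-v)$. $X(\mathfrak{so}_4,\mathfrak{so}_2\oplus\mathfrak{so}_2)^{tw}\subset X(\mathfrak{so}_4)$ is the subalgebra generated by the coefficients of $S(u)=T(u-\frac12)\,\mathcal G'\,T(-u+\frac12)^t$ with $\mathcal G'=\mathrm{diag}(1,-1,-1,1)$ (rows and columns ordered $-2,-1,1,2$). Identification: $\mathbb C^4=\mathbb C^2\otimes\mathbb C^2$ via $v_{-2}=e_{-1}\otimes e_{-1}$, $v_{-1}=e_{-1}\otimes e_1$, $v_1=e_1\otimes e_{-1}$, $v_2=-e_1\otimes e_1$. In the formula for $\varphi_2$, $S^\circ$ and $K_1$ act on the first factor, $S^\bullet$ and $K_2$ on the second, and $s_{ij}(u)$ is sent to the $(i,j)$ entry of the right-hand side in the basis $v_{-2},v_{-1},v_1,v_2$. *)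

theory Defs
  imports
    "HOL-Analysis.Cartesian_Space"
    "HOL-Library.Poly_Mapping"
    "HOL-Computational_Algebra.Formal_Laurent_Series"
begin

unbundle no Formal_Power_Series.fps_syntax

section \<open>Unital associative algebras over the complex numbers\<close>

class scaleC =
  fixes scaleC :: "complex \<Rightarrow> 'a \<Rightarrow> 'a" (infixr "*\<^sub>C" 75)

class complex_vector = scaleC + ab_group_add +
  assumes scaleC_add_right: "a *\<^sub>C (x + y) = a *\<^sub>C x + a *\<^sub>C y"
    and scaleC_add_left: "(a + b) *\<^sub>C x = a *\<^sub>C x + b *\<^sub>C x"
    and scaleC_scaleC: "a *\<^sub>C b *\<^sub>C x = (a * b) *\<^sub>C x"
    and scaleC_one: "1 *\<^sub>C x = x"

class complex_algebra_1 = complex_vector + ring_1 +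
  assumes mult_scaleC_left: "(a *\<^sub>C x) * y = a *\<^sub>C (x * y)"
    and mult_scaleC_right: "x * (a *\<^sub>C y) = a *\<^sub>C (x * y)"

global_interpretation complex_vector: vector_space "scaleC :: complex \<Rightarrow> 'a \<Rightarrow> 'a::complex_vector"
  by unfold_locales (rule scaleC_add_right scaleC_add_left scaleC_scaleC scaleC_one)+

abbreviation clinear :: "('a::complex_vector \<Rightarrow> 'b::complex_vector) \<Rightarrow> bool"
  where "clinear \<equiv> Vector_Spaces.linear scaleC scaleC"

lemma clinearI:
  assumes "\<And>x y. f (x + y) = f x + f y" "\<And>c x. f (c *\<^sub>C x) = c *\<^sub>C f x"
  shows "clinear f"
  using assms by unfold_locales auto

lemma clinear_add: "clinear f \<Longrightarrow> f (x + y) = f x + f y"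
  and clinear_scaleC: "clinear f \<Longrightarrow> f (c *\<^sub>C x) = c *\<^sub>C f x"
  by (simp_all add: Vector_Spaces.linear_iff)

lemma clinear_zero: assumes "clinear f" shows "f 0 = 0"
  using clinear_add[OF assms, of 0 0] by simp

lemma clinear_diff: assumes "clinear f" shows "f (x - y) = f x - f y"
  using clinear_add[OF assms, of "x - y" y] by simp

lemma clinear_sum: assumes "clinear f" shows "f (sum g A) = (\<Sum>x\<in>A. f (g x))"
  by (induction A rule: infinite_finite_induct)
     (simp_all add: clinear_add[OF assms] clinear_zero[OF assms])

instantiation complex :: complex_algebra_1
begin
definition scaleC_complex :: "complex \<Rightarrow> complex \<Rightarrow> complex" where "scaleC_complex = (*)"
instance by standard (auto simp: scaleC_complex_def algebra_simps)
end

definition algebra_hom :: "('a::complex_algebra_1 \<Rightarrow> 'b::complex_algebra_1) \<Rightarrow> bool" where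
  "algebra_hom f \<longleftrightarrow> clinear f \<and> f 1 = 1 \<and> (\<forall>x y. f (x * y) = f x * f y)"

definition algebra_iso :: "('a::complex_algebra_1 \<Rightarrow> 'b::complex_algebra_1) \<Rightarrow> bool" where
  "algebra_iso f \<longleftrightarrow> algebra_hom f \<and> bij f"

definition algebra_embedding :: "('a::complex_algebra_1 \<Rightarrow> 'b::complex_algebra_1) \<Rightarrow> bool" where
  "algebra_embedding f \<longleftrightarrow> algebra_hom f \<and> inj f"

lemma algebra_homD:
  assumes "algebra_hom f"
  shows "clinear f" "f 1 = 1" "f (x * y) = f x * f y" "f (x + y) = f x + f y" "f 0 = 0"
    "f (x - y) = f x - f y" "f (c *\<^sub>C x) = c *\<^sub>C f x" "f (sum g A) = (\<Sum>x\<in>A. f (g x))"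
  using assms clinear_add clinear_zero clinear_diff clinear_scaleC clinear_sum
  by (auto simp: algebra_hom_def)

definition subalgebra :: "'a::complex_algebra_1 set \<Rightarrow> bool" where
  "subalgebra A \<longleftrightarrow> 1 \<in> A \<and> (\<forall>x\<in>A. \<forall>y\<in>A. x + y \<in> A \<and> x * y \<in> A) \<and> (\<forall>c. \<forall>x\<in>A. c *\<^sub>C x \<in> A)"

lemma subalgebra_hull: "subalgebra (subalgebra hull G)"
  by (rule hull_in) (auto simp: subalgebra_def)

lemma subalgebraD:
  assumes "subalgebra A"
  shows "1 \<in> A" "0 \<in> A" "x \<in> A \<Longrightarrow> y \<in> A \<Longrightarrow> x + y \<in> A" "x \<in> A \<Longrightarrow> y \<in> A \<Longrightarrow> x * y \<in> A"
    "x \<in> A \<Longrightarrow> c *\<^sub>C x \<in> A" "x \<in> A \<Longrightarrow> - x \<in> A" "x \<in> A \<Longrightarrow> y \<in> A \<Longrightarrow> x - y \<in> A"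
proof -
  show *: "1 \<in> A" "x \<in> A \<Longrightarrow> y \<in> A \<Longrightarrow> x + y \<in> A" "x \<in> A \<Longrightarrow> y \<in> A \<Longrightarrow> x * y \<in> A"
    "x \<in> A \<Longrightarrow> c *\<^sub>C x \<in> A" for x y c
    using assms by (auto simp: subalgebra_def)
  show "0 \<in> A" using *(4)[OF *(1), of 0] by simp
  show m: "x \<in> A \<Longrightarrow> - x \<in> A" for x using *(4)[of x "-1"] by (simp add: complex_vector.scale_minus_left)
  show "x \<in> A \<Longrightarrow> y \<in> A \<Longrightarrow> x - y \<in> A" using *(2)[OF _ m[of y], of x] by simp
qed

lemma algebra_hom_hull_image:
  assumes f: "algebra_hom f" and x: "x \<in> subalgebra hull G"
  shows "f x \<in> subalgebra hull (f ` G)"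
  using x
proof (rule hull_induct)
  show "\<And>x. x \<in> G \<Longrightarrow> f x \<in> subalgebra hull (f ` G)" by (simp add: hull_inc)
  show "subalgebra {x. f x \<in> subalgebra hull (f ` G)}"
    using subalgebraD[OF subalgebra_hull[of "f ` G"]]
    by (auto simp: subalgebra_def algebra_homD[OF f])
qed

text \<open>An ideal of a unital algebra is automatically closed under scalar multiplication.\<close>

definition two_sided_ideal :: "'a::complex_algebra_1 set \<Rightarrow> bool" where
  "two_sided_ideal I \<longleftrightarrow> 0 \<in> I \<and> (\<forall>x\<in>I. \<forall>y\<in>I. x + y \<in> I) \<and> (\<forall>x\<in>I. \<forall>a. a * x \<in> I \<and> x * a \<in> I)"

lemma two_sided_ideal_hull: "two_sided_ideal (two_sided_ideal hull R)"
  by (rule hull_in) (auto simp: two_sided_ideal_def)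

lemma two_sided_idealD:
  assumes "two_sided_ideal I"
  shows "0 \<in> I" "x \<in> I \<Longrightarrow> y \<in> I \<Longrightarrow> x + y \<in> I" "x \<in> I \<Longrightarrow> a * x \<in> I" "x \<in> I \<Longrightarrow> x * a \<in> I"
    "x \<in> I \<Longrightarrow> - x \<in> I" "x \<in> I \<Longrightarrow> c *\<^sub>C x \<in> I"
proof -
  show *: "0 \<in> I" "x \<in> I \<Longrightarrow> y \<in> I \<Longrightarrow> x + y \<in> I" "x \<in> I \<Longrightarrow> a * x \<in> I" "x \<in> I \<Longrightarrow> x * a \<in> I" for x y a
    using assms by (auto simp: two_sided_ideal_def)
  show "x \<in> I \<Longrightarrow> - x \<in> I" using *(3)[of x "-1"] by simp
  show "x \<in> I \<Longrightarrow> c *\<^sub>C x \<in> I" using *(3)[of x "c *\<^sub>C 1"] by (simp add: mult_scaleC_left)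
qed

lemma algebra_hom_ideal_hull_zero:
  assumes f: "algebra_hom f" and R: "\<And>r. r \<in> R \<Longrightarrow> f r = 0" and x: "x \<in> two_sided_ideal hull R"
  shows "f x = 0"
  using x
proof (rule hull_induct)
  show "two_sided_ideal {x. f x = 0}" by (auto simp: two_sided_ideal_def algebra_homD[OF f])
qed (rule R)

lemma ideal_equivp: "two_sided_ideal I \<Longrightarrow> equivp (\<lambda>x y. x - y \<in> I)"
proof (rule equivpI)
  assume I: "two_sided_ideal I"
  show "reflp (\<lambda>x y. x - y \<in> I)" by (simp add: reflp_def two_sided_idealD(1)[OF I])
  show "symp (\<lambda>x y. x - y \<in> I)"
  proof (rule sympI)
    fix x y assume "x - y \<in> I"
    from two_sided_idealD(5)[OF I this] show "y - x \<in> I" by simp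
  qed
  show "transp (\<lambda>x y. x - y \<in> I)"
  proof (rule transpI)
    fix x y z assume "x - y \<in> I" "y - z \<in> I"
    from two_sided_idealD(2)[OF I this] show "x - z \<in> I" by simp
  qed
qed

lemma ideal_cong:
  assumes I: "two_sided_ideal I"
  shows "x - x' \<in> I \<Longrightarrow> y - y' \<in> I \<Longrightarrow> (x + y) - (x' + y') \<in> I"
    "x - x' \<in> I \<Longrightarrow> y - y' \<in> I \<Longrightarrow> (x - y) - (x' - y') \<in> I"
    "x - x' \<in> I \<Longrightarrow> - x - (- x') \<in> I"
    "x - x' \<in> I \<Longrightarrow> y - y' \<in> I \<Longrightarrow> x * y - x' * y' \<in> I"
    "x - x' \<in> I \<Longrightarrow> c *\<^sub>C x - c *\<^sub>C x' \<in> I"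
proof -
  note D = two_sided_idealD[OF I]
  { assume a: "x - x' \<in> I" "y - y' \<in> I"
    show "(x + y) - (x' + y') \<in> I" using D(2)[OF a] by (simp add: algebra_simps)
    show "(x - y) - (x' - y') \<in> I" using D(2)[OF a(1) D(5)[OF a(2)]] by (simp add: algebra_simps)
    show "x * y - x' * y' \<in> I" using D(2)[OF D(4)[OF a(1), of y] D(3)[OF a(2), of x']]
      by (simp add: algebra_simps) }
  assume a: "x - x' \<in> I"
  show "- x - (- x') \<in> I" using D(5)[OF a] by (simp add: algebra_simps)
  show "c *\<^sub>C x - c *\<^sub>C x' \<in> I" using D(6)[OF a, of c] by (simp add: complex_vector.scale_right_diff_distrib)
qed

instantiation poly_mapping :: (type, complex_vector) complex_vector
begin
definition scaleC_poly_mapping :: "complex \<Rightarrow> ('a \<Rightarrow>\<^sub>0 'b) \<Rightarrow> ('a \<Rightarrow>\<^sub>0 'b)" where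
  "scaleC_poly_mapping c p = Poly_Mapping.map (scaleC c) p"

lemma lookup_scaleC: "Poly_Mapping.lookup (c *\<^sub>C p) k = c *\<^sub>C Poly_Mapping.lookup p k"
  by (simp add: scaleC_poly_mapping_def map.rep_eq when_def complex_vector.scale_zero_right)

instance
  by standard (auto intro!: poly_mapping_eqI simp: lookup_scaleC lookup_add
      complex_vector.scale_right_distrib complex_vector.scale_left_distrib)
end

lemma single_zero_mult: "Poly_Mapping.single 0 a * p = Poly_Mapping.map ((*) a) p"
  for p :: "'k::monoid_add \<Rightarrow>\<^sub>0 'b::semiring_1"
  by (rule mult_map_scale_conv_mult[symmetric])

lemma lookup_mult_single_zero:
  "Poly_Mapping.lookup (p * Poly_Mapping.single 0 a) k = Poly_Mapping.lookup p k * a"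
  for p :: "'k::monoid_add \<Rightarrow>\<^sub>0 'b::semiring_1"
proof -
  have *: "(\<Sum>q. (Poly_Mapping.lookup (Poly_Mapping.single 0 a) q when k = l + q)) = (a when k = l)" for l
  proof -
    have "(Poly_Mapping.lookup (Poly_Mapping.single 0 a) q when k = l + q) = ((a when k = l) when q = 0)" for q
      by (auto simp: lookup_single when_def)
    then show ?thesis by simp
  qed
  have "Poly_Mapping.lookup p l * (a when k = l) = (Poly_Mapping.lookup p k * a when l = k)" for l
    by (auto simp: when_def)
  then show ?thesis by (simp add: lookup_mult *)
qed

instance poly_mapping :: (monoid_add, complex_algebra_1) complex_algebra_1
proof
  fix c and x y :: "'a \<Rightarrow>\<^sub>0 'b"
  have l: "c *\<^sub>C x = Poly_Mapping.single 0 (c *\<^sub>C 1) * x" for x :: "'a \<Rightarrow>\<^sub>0 'b"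
  proof -
    have "(*) (c *\<^sub>C 1) = (scaleC c :: 'b \<Rightarrow> 'b)" by (rule ext) (simp add: mult_scaleC_left)
    then show ?thesis unfolding single_zero_mult scaleC_poly_mapping_def by simp
  qed
  have r: "c *\<^sub>C x = x * Poly_Mapping.single 0 (c *\<^sub>C 1)" for x :: "'a \<Rightarrow>\<^sub>0 'b"
    by (rule poly_mapping_eqI) (simp add: lookup_scaleC lookup_mult_single_zero mult_scaleC_right)
  show "(c *\<^sub>C x) * y = c *\<^sub>C (x * y)" by (simp only: l mult.assoc)
  show "x * (c *\<^sub>C y) = c *\<^sub>C (x * y)" by (simp only: r mult.assoc)
qed

lemma poly_mapping_sum_single:
  "p = (\<Sum>k\<in>Poly_Mapping.keys p. Poly_Mapping.lookup p k *\<^sub>C Poly_Mapping.single k 1)"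
  for p :: "'k \<Rightarrow>\<^sub>0 complex"
proof (rule poly_mapping_eqI)
  fix k
  have "Poly_Mapping.lookup (\<Sum>k\<in>Poly_Mapping.keys p. Poly_Mapping.lookup p k *\<^sub>C Poly_Mapping.single k 1) k
    = (\<Sum>l\<in>Poly_Mapping.keys p. Poly_Mapping.lookup p l * (if l = k then 1 else 0))"
    by (simp add: lookup_sum lookup_scaleC lookup_single when_def scaleC_complex_def)
  also have "\<dots> = (\<Sum>l\<in>Poly_Mapping.keys p. if l = k then Poly_Mapping.lookup p k else 0)"
    by (rule sum.cong) auto
  also have "\<dots> = Poly_Mapping.lookup p k" by (simp add: in_keys_iff)
  finally show "Poly_Mapping.lookup p k = Poly_Mapping.lookup
    (\<Sum>k\<in>Poly_Mapping.keys p. Poly_Mapping.lookup p k *\<^sub>C Poly_Mapping.single k 1) k" ..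
qed

subsection \<open>Free algebras\<close>

text \<open>The free algebra is the monoid algebra of the free monoid of words. \<^typ>\<open>'a \<Rightarrow>\<^sub>0 'b\<close>
  convolves along an additively written monoid, so concatenation of words is written as addition.\<close>

datatype 'g word = Word "'g list"

instantiation word :: (type) monoid_add
begin
definition zero_word :: "'a word" where "0 = Word []"
fun plus_word :: "'a word \<Rightarrow> 'a word \<Rightarrow> 'a word" where "Word xs + Word ys = Word (xs @ ys)"
instance
proof
  fix a b c :: "'a word"
  show "a + b + c = a + (b + c)" by (cases a; cases b; cases c) simp
  show "0 + a = a" "a + 0 = a" by (cases a; simp add: zero_word_def)+
qed
end

lemma word_add_eq_zero: "0 = a + b \<longleftrightarrow> a = 0 \<and> b = (0 :: 'g word)"
  by (cases a; cases b) (auto simp: zero_word_def)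

type_synonym 'g free_algebra = "'g word \<Rightarrow>\<^sub>0 complex"

definition gen :: "'g \<Rightarrow> 'g free_algebra" where
  "gen g = Poly_Mapping.single (Word [g]) 1"

definition augmentation :: "'g free_algebra \<Rightarrow> complex" where
  "augmentation p = Poly_Mapping.lookup p 0"

lemma augmentation_gen: "augmentation (gen g) = 0"
  by (simp add: augmentation_def gen_def lookup_single zero_word_def)

lemma augmentation_hom: "algebra_hom augmentation"
proof -
  have "augmentation (p * q) = augmentation p * augmentation q" for p q :: "'g free_algebra"
  proof -
    have 1: "(\<Sum>r. (Poly_Mapping.lookup q r when 0 = l + r)) = (Poly_Mapping.lookup q 0 when l = 0)" for l
    proof -
      have "(Poly_Mapping.lookup q r when 0 = l + r) = ((Poly_Mapping.lookup q 0 when l = 0) when r = 0)" for r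
        by (auto simp: word_add_eq_zero when_def)
      then show ?thesis by simp
    qed
    have "Poly_Mapping.lookup p l * (Poly_Mapping.lookup q 0 when l = 0)
      = (Poly_Mapping.lookup p 0 * Poly_Mapping.lookup q 0 when l = 0)" for l
      by (auto simp: when_def)
    then show ?thesis unfolding augmentation_def lookup_mult 1 by simp
  qed
  then show ?thesis
    by (auto simp: algebra_hom_def augmentation_def lookup_add lookup_scaleC intro!: clinearI)
qed

subsection \<open>Tensor products\<close>

text \<open>\<open>A \<otimes> B\<close> is the free vector space on \<open>A \<times> B\<close> modulo the bilinearity relators. The basis
  elements multiply componentwise; as above the multiplicative monoid \<open>A \<times> B\<close> is written
  additively, so that the free vector space becomes its monoid algebra.\<close>

datatype ('a, 'b) basis_pair = Basis_Pair 'a 'b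

instantiation basis_pair :: (monoid_mult, monoid_mult) monoid_add
begin
definition zero_basis_pair :: "('a, 'b) basis_pair" where "0 = Basis_Pair 1 1"
fun plus_basis_pair :: "('a, 'b) basis_pair \<Rightarrow> ('a, 'b) basis_pair \<Rightarrow> ('a, 'b) basis_pair" where
  "Basis_Pair a b + Basis_Pair a' b' = Basis_Pair (a * a') (b * b')"
instance
proof
  fix a b c :: "('a, 'b) basis_pair"
  show "a + b + c = a + (b + c)" by (cases a; cases b; cases c) (simp add: mult.assoc)
  show "0 + a = a" "a + 0 = a" by (cases a; simp add: zero_basis_pair_def)+
qed
end

definition free_pair :: "'a \<Rightarrow> 'b \<Rightarrow> ('a, 'b) basis_pair \<Rightarrow>\<^sub>0 complex" where
  "free_pair a b = Poly_Mapping.single (Basis_Pair a b) 1"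

lemma free_pair_mult: "free_pair a b * free_pair a' b' = free_pair (a * a') (b * b')"
  by (simp add: free_pair_def mult_single)

lemma free_pair_one: "free_pair 1 1 = 1"
  by (simp add: free_pair_def single_one[symmetric] zero_basis_pair_def del: single_one)

definition tensor_relators ::
  "(('a::complex_algebra_1, 'b::complex_algebra_1) basis_pair \<Rightarrow>\<^sub>0 complex) set" where
  "tensor_relators =
     {free_pair (a + a') b - free_pair a b - free_pair a' b | a a' b. True} \<union>
     {free_pair a (b + b') - free_pair a b - free_pair a b' | a b b'. True} \<union>
     {free_pair (c *\<^sub>C a) b - c *\<^sub>C free_pair a b | c a b. True} \<union>
     {free_pair a (c *\<^sub>C b) - c *\<^sub>C free_pair a b | c a b. True}"

definition tensor_rel ::
  "(('a::complex_algebra_1, 'b::complex_algebra_1) basis_pair \<Rightarrow>\<^sub>0 complex) \<Rightarrow>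
   (('a, 'b) basis_pair \<Rightarrow>\<^sub>0 complex) \<Rightarrow> bool" where
  "tensor_rel x y \<longleftrightarrow> x - y \<in> complex_vector.span tensor_relators"

lemma tensor_relatorsI:
  "free_pair (a + a') b - free_pair a b - free_pair a' b \<in> tensor_relators"
  "free_pair a (b + b') - free_pair a b - free_pair a b' \<in> tensor_relators"
  "free_pair (c *\<^sub>C a) b - c *\<^sub>C free_pair a b \<in> tensor_relators"
  "free_pair a (c *\<^sub>C b) - c *\<^sub>C free_pair a b \<in> tensor_relators"
  unfolding tensor_relators_def by blast+

lemma free_pair_mult_relator:
  assumes "r \<in> tensor_relators"
  shows "free_pair s t * r \<in> tensor_relators" "r * free_pair s t \<in> tensor_relators"
proof -
  consider (1) a a' b where "r = free_pair (a + a') b - free_pair a b - free_pair a' b"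
    | (2) a b b' where "r = free_pair a (b + b') - free_pair a b - free_pair a b'"
    | (3) c a b where "r = free_pair (c *\<^sub>C a) b - c *\<^sub>C free_pair a b"
    | (4) c a b where "r = free_pair a (c *\<^sub>C b) - c *\<^sub>C free_pair a b"
    using assms unfolding tensor_relators_def by blast
  note cases = this
  note simps = right_diff_distrib left_diff_distrib free_pair_mult distrib_left distrib_right
    mult_scaleC_left mult_scaleC_right
  show "free_pair s t * r \<in> tensor_relators"
    by (cases rule: cases; simp add: simps tensor_relatorsI)
  show "r * free_pair s t \<in> tensor_relators"
    by (cases rule: cases; simp add: simps tensor_relatorsI)
qed

lemma free_pair_sum:
  "p = (\<Sum>k\<in>Poly_Mapping.keys p. Poly_Mapping.lookup p k *\<^sub>C
     (case k of Basis_Pair a b \<Rightarrow> free_pair a b))"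
  by (subst poly_mapping_sum_single) (auto simp: free_pair_def intro!: sum.cong split: basis_pair.split)

lemma tensor_ideal: "two_sided_ideal (complex_vector.span tensor_relators)"
proof -
  let ?N = "complex_vector.span tensor_relators"
  have l: "p * x \<in> ?N" if "x \<in> ?N" for p x
    using that
  proof (induction rule: complex_vector.span_induct_alt)
    case (step c r y)
    have "p * r \<in> ?N"
      by (subst free_pair_sum[of p])
         (simp add: sum_distrib_right mult_scaleC_left, rule complex_vector.span_sum,
           rule complex_vector.span_scale, rule complex_vector.span_base,
           simp add: free_pair_mult_relator(1)[OF step(1)] split: basis_pair.split)
    with step show ?case
      by (simp add: distrib_left mult_scaleC_right complex_vector.span_add complex_vector.span_scale)
  qed (simp add: complex_vector.span_zero)
  have r: "x * p \<in> ?N" if "x \<in> ?N" for p x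
    using that
  proof (induction rule: complex_vector.span_induct_alt)
    case (step c r y)
    have "r * p \<in> ?N"
      by (subst free_pair_sum[of p])
         (simp add: sum_distrib_left mult_scaleC_right, rule complex_vector.span_sum,
           rule complex_vector.span_scale, rule complex_vector.span_base,
           simp add: free_pair_mult_relator(2)[OF step(1)] split: basis_pair.split)
    with step show ?case
      by (simp add: distrib_right mult_scaleC_left complex_vector.span_add complex_vector.span_scale)
  qed (simp add: complex_vector.span_zero)
  show ?thesis
    unfolding two_sided_ideal_def
    by (auto intro: l r complex_vector.span_zero complex_vector.span_add)
qed

text \<open>The linear extension to the free vector space of a map on basis pairs.\<close>

definition pair_extend ::
  "('a \<Rightarrow> 'b \<Rightarrow> 'c::complex_vector) \<Rightarrow> (('a, 'b) basis_pair \<Rightarrow>\<^sub>0 complex) \<Rightarrow> 'c" where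
  "pair_extend \<beta> p = (\<Sum>k\<in>Poly_Mapping.keys p. Poly_Mapping.lookup p k *\<^sub>C
     (case k of Basis_Pair a b \<Rightarrow> \<beta> a b))"

lemma pair_extend_superset:
  assumes "finite A" "Poly_Mapping.keys p \<subseteq> A"
  shows "pair_extend \<beta> p = (\<Sum>k\<in>A. Poly_Mapping.lookup p k *\<^sub>C (case k of Basis_Pair a b \<Rightarrow> \<beta> a b))"
  unfolding pair_extend_def using assms
  by (intro sum.mono_neutral_left) (auto simp: in_keys_iff)

lemma pair_extend_clinear: "clinear (pair_extend \<beta>)"
proof (rule clinearI)
  fix p q :: "('a, 'b) basis_pair \<Rightarrow>\<^sub>0 complex" and c
  let ?A = "Poly_Mapping.keys p \<union> Poly_Mapping.keys q \<union> Poly_Mapping.keys (p + q) \<union> Poly_Mapping.keys (c *\<^sub>C p)"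
  have [simp]: "pair_extend \<beta> r = (\<Sum>k\<in>?A. Poly_Mapping.lookup r k *\<^sub>C (case k of Basis_Pair a b \<Rightarrow> \<beta> a b))"
    if "Poly_Mapping.keys r \<subseteq> ?A" for r
    using that by (intro pair_extend_superset) auto
  show "pair_extend \<beta> (p + q) = pair_extend \<beta> p + pair_extend \<beta> q"
    by (simp add: le_supI1 le_supI2 lookup_add scaleC_add_left sum.distrib)
  have 1: "pair_extend \<beta> (c *\<^sub>C p) =
    (\<Sum>k\<in>?A. Poly_Mapping.lookup (c *\<^sub>C p) k *\<^sub>C (case k of Basis_Pair a b \<Rightarrow> \<beta> a b))"
    by (rule pair_extend_superset) auto
  have 2: "pair_extend \<beta> p = (\<Sum>k\<in>?A. Poly_Mapping.lookup p k *\<^sub>C (case k of Basis_Pair a b \<Rightarrow> \<beta> a b))"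
    by (rule pair_extend_superset) auto
  show "pair_extend \<beta> (c *\<^sub>C p) = c *\<^sub>C pair_extend \<beta> p"
    unfolding 1 2
    by (simp add: lookup_scaleC complex_vector.scale_sum_right scaleC_complex_def)
qed

lemma pair_extend_free_pair: "pair_extend \<beta> (free_pair a b) = \<beta> a b"
  by (simp add: pair_extend_def free_pair_def)

definition cbilinear ::
  "('a::complex_vector \<Rightarrow> 'b::complex_vector \<Rightarrow> 'c::complex_vector) \<Rightarrow> bool" where
  "cbilinear \<beta> \<longleftrightarrow> (\<forall>b. clinear (\<lambda>a. \<beta> a b)) \<and> (\<forall>a. clinear (\<beta> a))"

lemma pair_extend_relators:
  assumes "cbilinear \<beta>" "x \<in> complex_vector.span tensor_relators"
  shows "pair_extend \<beta> x = 0"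
  using assms(2)
proof (induction rule: complex_vector.span_induct_alt)
  case base
  show ?case by (rule clinear_zero[OF pair_extend_clinear])
next
  case (step c r y)
  have "\<And>b. clinear (\<lambda>a. \<beta> a b)" "\<And>a. clinear (\<beta> a)"
    using assms(1) by (auto simp: cbilinear_def)
  note \<beta> = this[THEN clinear_add] this[THEN clinear_scaleC]
  from step(1) have "pair_extend \<beta> r = 0"
    by (auto simp: tensor_relators_def clinear_diff[OF pair_extend_clinear]
        clinear_scaleC[OF pair_extend_clinear] pair_extend_free_pair \<beta>)
  with step(2) show ?case
    by (simp add: clinear_add[OF pair_extend_clinear] clinear_scaleC[OF pair_extend_clinear])
qed

lemma functional_one: "\<exists>f :: 'a::complex_algebra_1 \<Rightarrow> complex. clinear f \<and> f 1 = 1"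
proof -
  interpret vector_space_pair "scaleC :: complex \<Rightarrow> 'a \<Rightarrow> 'a" "scaleC :: complex \<Rightarrow> complex \<Rightarrow> complex"
    by unfold_locales
  have "complex_vector.independent {1::'a}" by (simp add: complex_vector.dependent_single)
  from linear_independent_extend[OF this, of "\<lambda>_. 1"] show ?thesis by auto
qed

lemma one_not_tensor_rel_zero:
  "\<not> tensor_rel 0 (1 :: ('a::complex_algebra_1, 'b::complex_algebra_1) basis_pair \<Rightarrow>\<^sub>0 complex)"
proof
  assume "tensor_rel (0 :: ('a, 'b) basis_pair \<Rightarrow>\<^sub>0 complex) 1"
  then have *: "1 \<in> complex_vector.span (tensor_relators :: (('a, 'b) basis_pair \<Rightarrow>\<^sub>0 complex) set)"
    using complex_vector.span_neg by (fastforce simp: tensor_rel_def)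
  obtain f :: "'a \<Rightarrow> complex" and g :: "'b \<Rightarrow> complex"
    where fg: "clinear f" "f 1 = 1" "clinear g" "g 1 = 1"
    using functional_one by metis
  have "cbilinear (\<lambda>a b. f a * g b)"
    unfolding cbilinear_def
    by (safe intro!: clinearI) (simp_all add: clinear_add[OF fg(1)] clinear_add[OF fg(3)]
        clinear_scaleC[OF fg(1)] clinear_scaleC[OF fg(3)] scaleC_complex_def algebra_simps)
  from pair_extend_relators[OF this *] have "pair_extend (\<lambda>a b. f a * g b) (free_pair 1 1) = 0"
    by (simp only: free_pair_one)
  then show False by (simp add: pair_extend_free_pair fg)
qed

quotient_type (overloaded) ('a, 'b) tensor =
  "('a::complex_algebra_1, 'b::complex_algebra_1) basis_pair \<Rightarrow>\<^sub>0 complex" / tensor_rel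
  unfolding tensor_rel_def by (rule ideal_equivp[OF tensor_ideal])

instantiation tensor :: (complex_algebra_1, complex_algebra_1) complex_algebra_1
begin
lift_definition zero_tensor :: "('a, 'b) tensor" is 0 .
lift_definition one_tensor :: "('a, 'b) tensor" is 1 .
lift_definition plus_tensor :: "('a, 'b) tensor \<Rightarrow> ('a, 'b) tensor \<Rightarrow> ('a, 'b) tensor" is "(+)"
  unfolding tensor_rel_def by (rule ideal_cong[OF tensor_ideal])
lift_definition minus_tensor :: "('a, 'b) tensor \<Rightarrow> ('a, 'b) tensor \<Rightarrow> ('a, 'b) tensor" is "(-)"
  unfolding tensor_rel_def by (rule ideal_cong[OF tensor_ideal])
lift_definition uminus_tensor :: "('a, 'b) tensor \<Rightarrow> ('a, 'b) tensor" is uminus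
  unfolding tensor_rel_def by (rule ideal_cong[OF tensor_ideal])
lift_definition times_tensor :: "('a, 'b) tensor \<Rightarrow> ('a, 'b) tensor \<Rightarrow> ('a, 'b) tensor" is "(*)"
  unfolding tensor_rel_def by (rule ideal_cong[OF tensor_ideal])
lift_definition scaleC_tensor :: "complex \<Rightarrow> ('a, 'b) tensor \<Rightarrow> ('a, 'b) tensor" is scaleC
  unfolding tensor_rel_def by (rule ideal_cong[OF tensor_ideal])
instance
proof
  note [simp] = equivp_reflp[OF tensor_equivp]
  fix x y z :: "('a, 'b) tensor" and c d :: complex
  show "x + y + z = x + (y + z)" by transfer (simp add: add.assoc)
  show "x + y = y + x" by transfer (simp add: add.commute)
  show "0 + x = x" by transfer simp
  show "- x + x = 0" by transfer simp
  show "x - y = x + - y" by transfer simp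
  show "c *\<^sub>C (x + y) = c *\<^sub>C x + c *\<^sub>C y" by transfer (simp add: scaleC_add_right)
  show "(c + d) *\<^sub>C x = c *\<^sub>C x + d *\<^sub>C x" by transfer (simp add: scaleC_add_left)
  show "c *\<^sub>C d *\<^sub>C x = (c * d) *\<^sub>C x" by transfer simp
  show "1 *\<^sub>C x = x" by transfer simp
  show "x * y * z = x * (y * z)" by transfer (simp add: mult.assoc)
  show "1 * x = x" by transfer simp
  show "x * 1 = x" by transfer simp
  show "(x + y) * z = x * z + y * z" by transfer (simp add: distrib_right)
  show "x * (y + z) = x * y + x * z" by transfer (simp add: distrib_left)
  show "(0 :: ('a, 'b) tensor) \<noteq> 1" by transfer (rule one_not_tensor_rel_zero)
  show "(c *\<^sub>C x) * y = c *\<^sub>C (x * y)" by transfer (simp add: mult_scaleC_left)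
  show "x * (c *\<^sub>C y) = c *\<^sub>C (x * y)" by transfer (simp add: mult_scaleC_right)
qed
end

lift_definition tensor :: "'a::complex_algebra_1 \<Rightarrow> 'b::complex_algebra_1 \<Rightarrow> ('a, 'b) tensor" (infixr "\<otimes>\<^sub>C" 72)
  is free_pair .

lemma tensor_mult: "(a \<otimes>\<^sub>C b) * (a' \<otimes>\<^sub>C b') = (a * a') \<otimes>\<^sub>C (b * b')"
  by transfer (simp add: free_pair_mult equivp_reflp[OF tensor_equivp])

lemma tensor_one: "1 \<otimes>\<^sub>C 1 = 1"
  by transfer (simp add: free_pair_one equivp_reflp[OF tensor_equivp])

lemma tensor_bilinear:
  "(a + a') \<otimes>\<^sub>C b = a \<otimes>\<^sub>C b + a' \<otimes>\<^sub>C b"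
  "a \<otimes>\<^sub>C (b + b') = a \<otimes>\<^sub>C b + a \<otimes>\<^sub>C b'"
  "(c *\<^sub>C a) \<otimes>\<^sub>C b = c *\<^sub>C (a \<otimes>\<^sub>C b)"
  "a \<otimes>\<^sub>C (c *\<^sub>C b) = c *\<^sub>C (a \<otimes>\<^sub>C b)"
  by (transfer, unfold tensor_rel_def diff_diff_add[symmetric],
      rule complex_vector.span_base, rule tensor_relatorsI)+

lemma tensor_clinear: "clinear (\<lambda>a. a \<otimes>\<^sub>C b)" "clinear (tensor a)"
  by (auto intro!: clinearI simp: tensor_bilinear)

lemma abs_tensor_cases: obtains p where "z = abs_tensor p"
  using Quotient_abs_rep[OF Quotient_tensor, of z] by metis

lemma tensor_induct:
  fixes z :: "('a::complex_algebra_1, 'b::complex_algebra_1) tensor"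
  assumes "\<And>a b. P (a \<otimes>\<^sub>C b)" "\<And>x y. P x \<Longrightarrow> P y \<Longrightarrow> P (x + y)"
  shows "P z"
proof -
  obtain p where p: "z = abs_tensor p" by (rule abs_tensor_cases)
  have zero: "abs_tensor 0 = (0 :: 'a) \<otimes>\<^sub>C (0 :: 'b)"
  proof -
    have "clinear (\<lambda>a :: 'a. a \<otimes>\<^sub>C (0 :: 'b))" by (rule tensor_clinear)
    from clinear_zero[OF this] show ?thesis by (simp add: zero_tensor_def)
  qed
  have "P (abs_tensor (\<Sum>k\<in>A. Poly_Mapping.lookup p k *\<^sub>C (case k of Basis_Pair a b \<Rightarrow> free_pair a b)))"
    if "finite A" for A
    using that
  proof (induction A)
    case empty
    then show ?case using assms(1)[of 0 0] by (simp add: zero)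
  next
    case (insert k A)
    obtain a b where k: "k = Basis_Pair a b" by (cases k)
    have "abs_tensor (c *\<^sub>C free_pair a b) = (c *\<^sub>C a) \<otimes>\<^sub>C b" for c
      by (simp only: tensor_bilinear) (simp only: tensor.abs_eq scaleC_tensor.abs_eq)
    with insert show ?case
      by (simp add: k plus_tensor.abs_eq[symmetric] assms)
  qed
  from this[OF finite_keys[of p]] show ?thesis unfolding free_pair_sum[symmetric] by (simp add: p)
qed

text \<open>The map \<open>f \<otimes> g\<close> induced by linear maps \<open>f\<close> and \<open>g\<close>.\<close>

definition tensor_map ::
  "('a::complex_algebra_1 \<Rightarrow> 'c::complex_algebra_1) \<Rightarrow> ('b::complex_algebra_1 \<Rightarrow> 'd::complex_algebra_1) \<Rightarrow>
   ('a, 'b) tensor \<Rightarrow> ('c, 'd) tensor" where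
  "tensor_map f g = (THE h. clinear h \<and> (\<forall>a b. h (a \<otimes>\<^sub>C b) = f a \<otimes>\<^sub>C g b))"

lemma tensor_map_unique:
  assumes "clinear f" "clinear g"
  shows "\<exists>!h. clinear h \<and> (\<forall>a b. h (a \<otimes>\<^sub>C b) = f a \<otimes>\<^sub>C g b)"
proof (rule ex_ex1I)
  have \<beta>: "cbilinear (\<lambda>a b. f a \<otimes>\<^sub>C g b)"
    by (auto simp: cbilinear_def assms[THEN clinear_add] assms[THEN clinear_scaleC] tensor_bilinear
        intro!: clinearI)
  define h where "h z = pair_extend (\<lambda>a b. f a \<otimes>\<^sub>C g b) (rep_tensor z)" for z
  have h: "h (abs_tensor p) = pair_extend (\<lambda>a b. f a \<otimes>\<^sub>C g b) p" for p
  proof -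
    have "tensor_rel (rep_tensor (abs_tensor p)) p"
      by (rule Quotient_rep_abs[OF Quotient_tensor]) (rule equivp_reflp[OF tensor_equivp])
    then show ?thesis
      using pair_extend_relators[OF \<beta>, of "rep_tensor (abs_tensor p) - p"]
      by (simp add: tensor_rel_def h_def clinear_diff[OF pair_extend_clinear])
  qed
  have "clinear h"
  proof (rule clinearI)
    fix x y :: "('a, 'c) tensor" and c
    obtain p q where pq: "x = abs_tensor p" "y = abs_tensor q"
      using abs_tensor_cases by metis
    show "h (x + y) = h x + h y"
      by (simp add: pq plus_tensor.abs_eq h clinear_add[OF pair_extend_clinear])
    show "h (c *\<^sub>C x) = c *\<^sub>C h x"
      by (simp add: pq scaleC_tensor.abs_eq h clinear_scaleC[OF pair_extend_clinear])
  qed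
  moreover have "h (a \<otimes>\<^sub>C b) = f a \<otimes>\<^sub>C g b" for a b
    by (simp add: tensor.abs_eq h pair_extend_free_pair)
  ultimately show "\<exists>h. clinear h \<and> (\<forall>a b. h (a \<otimes>\<^sub>C b) = f a \<otimes>\<^sub>C g b)" by blast
next
  fix h h'
  assume h: "clinear h \<and> (\<forall>a b. h (a \<otimes>\<^sub>C b) = f a \<otimes>\<^sub>C g b)"
    and h': "clinear h' \<and> (\<forall>a b. h' (a \<otimes>\<^sub>C b) = f a \<otimes>\<^sub>C g b)"
  show "h = h'"
  proof
    fix z
    show "h z = h' z"
    proof (induction z rule: tensor_induct)
      case (1 a b)
      then show ?case using h h' by simp
    next
      case (2 x y)
      then show ?case using h h' clinear_add by metis
    qed
  qed
qed

lemma tensor_map: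
  assumes "clinear f" "clinear g"
  shows "clinear (tensor_map f g)" "tensor_map f g (a \<otimes>\<^sub>C b) = f a \<otimes>\<^sub>C g b"
  using theI'[OF tensor_map_unique[OF assms]] unfolding tensor_map_def by blast+

lemma tensor_map_hom:
  assumes "algebra_hom f" "algebra_hom g"
  shows "algebra_hom (tensor_map f g)"
proof -
  note fg = algebra_homD[OF assms(1)] algebra_homD[OF assms(2)]
  note T = tensor_map[OF fg(1) algebra_homD(1)[OF assms(2)]]
  have "tensor_map f g (x * y) = tensor_map f g x * tensor_map f g y" for x y
  proof (induction x rule: tensor_induct)
    case (1 a b)
    show ?case
      by (induction y rule: tensor_induct)
         (simp_all add: tensor_mult T(2) fg distrib_left clinear_add[OF T(1)])
  qed (simp_all add: distrib_right clinear_add[OF T(1)])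
  moreover have "tensor_map f g 1 = 1"
    by (simp add: T(2) fg flip: tensor_one)
  ultimately show ?thesis using T(1) by (simp add: algebra_hom_def)
qed

section \<open>Matrices of formal series\<close>

text \<open>An \<^typ>\<open>'a fps\<close> is read as a series in \<open>u\<^sup>-\<^sup>1\<close>.\<close>

definition map_coeffs :: "('a \<Rightarrow> 'b) \<Rightarrow> 'a fps \<Rightarrow> 'b fps" where
  "map_coeffs f F = Abs_fps (\<lambda>n. f (fps_nth F n))"

definition map_entries :: "('a \<Rightarrow> 'b) \<Rightarrow> 'a^'n^'m \<Rightarrow> 'b^'n^'m" where
  "map_entries f M = (\<chi> i j. f (M $ i $ j))"

definition coefficients :: "'a fps^'n^'m \<Rightarrow> 'a set" where
  "coefficients M = {fps_nth (M $ i $ j) r | i j r. True}"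

text \<open>\<open>subst_affine a b F\<close> is \<open>F(a u + b)\<close> for \<open>a \<noteq> 0\<close>, expanded in \<open>u\<^sup>-\<^sup>1\<close> by
  \<open>(a u + b)\<^sup>-\<^sup>1 = u\<^sup>-\<^sup>1 (a + b u\<^sup>-\<^sup>1)\<^sup>-\<^sup>1\<close>. The coefficient of \<open>u\<^sup>-\<^sup>n\<close> only involves the first
  \<open>n + 1\<close> coefficients of \<open>F\<close>.\<close>

definition subst_affine :: "complex \<Rightarrow> complex \<Rightarrow> 'a::complex_vector fps \<Rightarrow> 'a fps" where
  "subst_affine a b F = Abs_fps (\<lambda>n. \<Sum>r\<le>n.
     fps_nth ((fps_X * inverse (fps_const a + fps_const b * fps_X)) ^ r) n *\<^sub>C fps_nth F r)"

definition matrix_unit :: "'n \<Rightarrow> 'n \<Rightarrow> 'a::zero_neq_one^'n^'n" where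
  "matrix_unit i j = (\<chi> k l. if k = i \<and> l = j then 1 else 0)"

definition kron :: "'a::times^'n^'n \<Rightarrow> 'a^'m^'m \<Rightarrow> 'a^('n \<times> 'm)^('n \<times> 'm)" where
  "kron A B = (\<chi> p q. A $ fst p $ fst q * B $ snd p $ snd q)"

text \<open>The linear map \<open>E\<^sub>i\<^sub>j \<mapsto> E\<^sub>-\<^sub>j\<^sub>,\<^sub>-\<^sub>i\<close>.\<close>

definition transpose_neg :: "'a^'n::{finite, uminus}^'n::{finite, uminus} \<Rightarrow> 'a^'n::{finite, uminus}^'n::{finite, uminus}" where
  "transpose_neg A = (\<chi> k l. A $ (- l) $ (- k))"

definition matrix_P :: "'a::ring_1^('n::finite \<times> 'n)^('n \<times> 'n)" where
  "matrix_P = (\<Sum>i\<in>UNIV. \<Sum>j\<in>UNIV. kron (matrix_unit i j) (matrix_unit j i))"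

definition matrix_Q :: "'a::ring_1^('n::{finite, uminus} \<times> 'n)^('n \<times> 'n)" where
  "matrix_Q = (\<Sum>i\<in>UNIV. \<Sum>j\<in>UNIV. kron (matrix_unit i j) (matrix_unit (- i) (- j)))"

subsection \<open>The relation \<open>R(u - v) T\<^sub>1(u) T\<^sub>2(v) = T\<^sub>2(v) T\<^sub>1(u) R(u - v)\<close>\<close>

text \<open>The two sides are matrices over the power series in \<open>u\<^sup>-\<^sup>1\<close> whose coefficients are Laurent
  series in \<open>v\<^sup>-\<^sup>1\<close>. Thus \<open>v\<close> is \<^const>\<open>fls_X_inv\<close>, and
  \<open>(u - w)\<^sup>-\<^sup>1 = \<Sum>k. w\<^sup>k u\<^sup>-\<^sup>k\<^sup>-\<^sup>1\<close> for \<open>w\<close> not involving \<open>u\<close>.\<close>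

type_synonym 'a series2 = "'a fls fps"

definition at_u :: "'a::zero fps \<Rightarrow> 'a series2" where
  "at_u F = map_coeffs fls_const F"

definition at_v :: "'a::zero fps \<Rightarrow> 'a series2" where
  "at_v F = fps_const (fps_to_fls F)"

definition inverse_u_minus :: "'a::ring_1 fls \<Rightarrow> 'a series2" where
  "inverse_u_minus w = Abs_fps (\<lambda>n. case n of 0 \<Rightarrow> 0 | Suc k \<Rightarrow> w ^ k)"

definition rtt_relators ::
  "'a::ring_1 series2^('n::finite \<times> 'n)^('n \<times> 'n) \<Rightarrow> 'a fps^'n^'n \<Rightarrow> 'a set" where
  "rtt_relators R T =
     (let T1 = kron (map_entries at_u T) (mat 1);
          T2 = kron (mat 1) (map_entries at_v T);
          D = R ** T1 ** T2 - T2 ** T1 ** R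
      in {fls_nth (fps_nth (D $ p $ q) r) s | p q r s. True})"

text \<open>The generators are the \<open>t\<^sub>i\<^sub>j\<^sup>(\<^sup>r\<^sup>+\<^sup>1\<^sup>)\<close> for \<open>r \<ge> 0\<close>, and \<open>t\<^sub>i\<^sub>j\<^sup>(\<^sup>0\<^sup>) = \<delta>\<^sub>i\<^sub>j\<close>.\<close>

definition generator_matrix :: "('n \<times> 'n \<times> nat) free_algebra fps^'n^'n" where
  "generator_matrix = (\<chi> i j. Abs_fps (\<lambda>n. case n of
     0 \<Rightarrow> if i = j then 1 else 0 | Suc r \<Rightarrow> gen (i, j, r)))"

subsection \<open>Ring homomorphisms and series\<close>

definition unital_ring_hom :: "('a::ring_1 \<Rightarrow> 'b::ring_1) \<Rightarrow> bool" where
  "unital_ring_hom h \<longleftrightarrow> h 1 = 1 \<and> (\<forall>x y. h (x + y) = h x + h y \<and> h (x * y) = h x * h y)"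

lemma unital_ring_homD:
  assumes "unital_ring_hom h"
  shows "h 1 = 1" "h (x + y) = h x + h y" "h (x * y) = h x * h y" "h 0 = 0" "h (- x) = - h x"
    "h (x - y) = h x - h y" "h (sum g A) = (\<Sum>i\<in>A. h (g i))" "h (x ^ n) = h x ^ n"
proof -
  show *: "h 1 = 1" "h (x + y) = h x + h y" "h (x * y) = h x * h y" for x y
    using assms by (auto simp: unital_ring_hom_def)
  show 0: "h 0 = 0" using *(2)[of 0 0] by simp
  show m: "h (- x) = - h x" for x
    using *(2)[of x "- x"] 0 by (simp add: eq_neg_iff_add_eq_0 add.commute)
  show "h (x - y) = h x - h y" using *(2)[of x "- y"] m by simp
  show "h (sum g A) = (\<Sum>i\<in>A. h (g i))" by (induction A rule: infinite_finite_induct) (auto simp: 0 *)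
  show "h (x ^ n) = h x ^ n" by (induction n) (auto simp: *)
qed

lemma algebra_hom_unital_ring_hom: "algebra_hom h \<Longrightarrow> unital_ring_hom h"
  using algebra_homD by (auto simp: unital_ring_hom_def)

lemma nth_map_coeffs [simp]: "fps_nth (map_coeffs h F) n = h (fps_nth F n)"
  by (simp add: map_coeffs_def)

lemma nth_map_entries [simp]: "map_entries h M $ i $ j = h (M $ i $ j)"
  by (simp add: map_entries_def)

lemma unital_ring_hom_map_coeffs:
  assumes "unital_ring_hom h"
  shows "unital_ring_hom (map_coeffs h)"
  unfolding unital_ring_hom_def
  by (auto intro!: fps_ext simp: unital_ring_homD[OF assms] fps_mult_nth fps_one_nth)

lemma map_entries_hom:
  assumes "unital_ring_hom h"
  shows "map_entries h (A ** B) = map_entries h A ** map_entries h B"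
    "map_entries h (A + C) = map_entries h A + map_entries h C"
    "map_entries h (A - C) = map_entries h A - map_entries h C"
    "map_entries h (mat c) = mat (h c)"
    "map_entries h (sum f I) = (\<Sum>i\<in>I. map_entries h (f i))"
    "map_entries h (kron D E) = kron (map_entries h D) (map_entries h E)"
    "map_entries h (matrix_unit i j) = matrix_unit i j"
  by (simp_all add: vec_eq_iff matrix_matrix_mult_def unital_ring_homD[OF assms] mat_def kron_def
      matrix_unit_def sum_component)

lemma map_entries_P_Q:
  assumes "unital_ring_hom h"
  shows "map_entries h matrix_P = matrix_P" "map_entries h matrix_Q = matrix_Q"
  by (simp_all add: matrix_P_def matrix_Q_def map_entries_hom[OF assms])

definition map_fls :: "('a::zero \<Rightarrow> 'b::zero) \<Rightarrow> 'a fls \<Rightarrow> 'b fls" where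
  "map_fls h F = Abs_fls (\<lambda>n. h (fls_nth F n))"

lemma nth_map_fls: "h 0 = 0 \<Longrightarrow> fls_nth (map_fls h F) n = h (fls_nth F n)"
  unfolding map_fls_def
  by (subst nth_Abs_fls_lower_bound[of "fls_subdegree F"]) auto

lemma fls_times_nth_wide:
  fixes f g :: "'a::ring_1 fls"
  assumes "\<And>k. k < N \<Longrightarrow> fls_nth f k = 0" "\<And>k. k < M \<Longrightarrow> fls_nth g k = 0"
  shows "fls_nth (f * g) n = (\<Sum>i=N..n - M. fls_nth f i * fls_nth g (n - i))"
proof (cases "f = 0 \<or> g = 0")
  case False
  then have NM: "N \<le> fls_subdegree f" "M \<le> fls_subdegree g"
    using assms nth_fls_subdegree_nonzero[of f] nth_fls_subdegree_nonzero[of g] by (metis not_le)+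
  show ?thesis
    unfolding fls_times_nth(2)
  proof (rule sum.mono_neutral_left)
    show "{fls_subdegree f..n - fls_subdegree g} \<subseteq> {N..n - M}" using NM by auto
    show "\<forall>i\<in>{N..n - M} - {fls_subdegree f..n - fls_subdegree g}. fls_nth f i * fls_nth g (n - i) = 0"
    proof
      fix i assume "i \<in> {N..n - M} - {fls_subdegree f..n - fls_subdegree g}"
      then have "i < fls_subdegree f \<or> n - i < fls_subdegree g" by auto
      then show "fls_nth f i * fls_nth g (n - i) = 0" by auto
    qed
  qed simp
qed auto

lemma unital_ring_hom_map_fls:
  assumes "unital_ring_hom h"
  shows "unital_ring_hom (map_fls h)"
proof -
  note h = unital_ring_homD[OF assms]
  note nth = nth_map_fls[of h, OF h(4)]
  have "map_fls h (f * g) = map_fls h f * map_fls h g" for f g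
  proof (rule fls_eqI)
    fix n
    have "fls_nth (map_fls h f * map_fls h g) n =
        (\<Sum>i=fls_subdegree f..n - fls_subdegree g. h (fls_nth f i) * h (fls_nth g (n - i)))"
      by (subst fls_times_nth_wide[of "fls_subdegree f" _ "fls_subdegree g"]) (auto simp: nth h)
    then show "fls_nth (map_fls h (f * g)) n = fls_nth (map_fls h f * map_fls h g) n"
      by (simp add: nth h fls_times_nth(2))
  qed
  then show ?thesis
    by (auto simp: unital_ring_hom_def h nth intro!: fls_eqI)
qed

lemma rtt_relators_map:
  assumes h: "unital_ring_hom h"
    and R: "map_entries (map_coeffs (map_fls h)) R = R'"
  shows "rtt_relators R' (map_entries (map_coeffs h) T) = h ` rtt_relators R T"
proof -
  note hs = unital_ring_hom_map_coeffs[OF unital_ring_hom_map_fls[OF h]]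
  have 1: "map_entries (map_coeffs (map_fls h)) (map_entries at_u T) = map_entries at_u (map_entries (map_coeffs h) T)"
    by (simp add: vec_eq_iff fps_eq_iff fls_eq_iff at_u_def nth_map_fls unital_ring_homD[OF h])
  have 2: "map_entries (map_coeffs (map_fls h)) (map_entries at_v T) = map_entries at_v (map_entries (map_coeffs h) T)"
    by (simp add: vec_eq_iff fps_eq_iff fls_eq_iff at_v_def nth_map_fls unital_ring_homD[OF h])
  define D where "D = R ** kron (map_entries at_u T) (mat 1) ** kron (mat 1) (map_entries at_v T)
    - kron (mat 1) (map_entries at_v T) ** kron (map_entries at_u T) (mat 1) ** R"
  have "map_entries (map_coeffs (map_fls h)) D =
    R' ** kron (map_entries at_u (map_entries (map_coeffs h) T)) (mat 1) **
      kron (mat 1) (map_entries at_v (map_entries (map_coeffs h) T))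
    - kron (mat 1) (map_entries at_v (map_entries (map_coeffs h) T)) **
      kron (map_entries at_u (map_entries (map_coeffs h) T)) (mat 1) ** R'"
    by (simp add: D_def map_entries_hom[OF hs] 1 2 R unital_ring_homD[OF hs])
  then have *: "rtt_relators R' (map_entries (map_coeffs h) T) =
      {fls_nth (fps_nth (map_entries (map_coeffs (map_fls h)) D $ p $ q) r) s | p q r s. True}"
    by (simp add: rtt_relators_def Let_def)
  have "rtt_relators R T = {fls_nth (fps_nth (D $ p $ q) r) s | p q r s. True}"
    by (simp add: rtt_relators_def Let_def D_def)
  then show ?thesis
    unfolding * by (simp add: nth_map_fls unital_ring_homD[OF h] setcompr_eq_image image_def) blast
qed

lemma at_u_v_zero_one: "at_u 0 = 0" "at_v 0 = 0" "at_u (1 :: 'a::ring_1 fps) = 1" "at_v (1 :: 'a fps) = 1"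
proof -
  show "at_u 0 = 0" "at_v 0 = 0" by (simp_all add: at_u_def at_v_def fps_eq_iff)
  show "at_u (1 :: 'a fps) = 1" by (rule fps_ext) (simp add: at_u_def fls_const_1)
  show "at_v (1 :: 'a fps) = 1" by (rule fps_ext) (simp add: at_v_def)
qed

lemma rtt_relators_mat_1: "rtt_relators R (mat 1 :: 'a::ring_1 fps^'n^'n) \<subseteq> {0}"
proof -
  have 1: "map_entries at_u (mat 1 :: 'a fps^'n^'n) = mat 1" "map_entries at_v (mat 1 :: 'a fps^'n^'n) = mat 1"
    by (simp_all add: vec_eq_iff mat_def at_u_v_zero_one)
  have 2: "kron (mat 1 :: 'a series2^'n^'n) (mat 1 :: 'a series2^'n^'n) = mat 1"
    by (simp add: vec_eq_iff mat_def kron_def prod_eq_iff)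
  show ?thesis by (auto simp: rtt_relators_def Let_def 1 2)
qed

lemma augmentation_generator_matrix:
  "map_entries (map_coeffs augmentation) generator_matrix = mat 1"
  by (auto simp: vec_eq_iff fps_eq_iff generator_matrix_def mat_def fps_one_nth augmentation_gen
      algebra_homD[OF augmentation_hom] split: nat.split)

lemma rtt_quotient_nontrivial:
  assumes R: "map_entries (map_coeffs (map_fls augmentation)) R = R'"
    and "x \<in> two_sided_ideal hull (rtt_relators R generator_matrix)"
  shows "augmentation x = 0"
proof (rule algebra_hom_ideal_hull_zero[OF augmentation_hom _ assms(2)])
  fix r assume r: "r \<in> rtt_relators R (generator_matrix :: ('a \<times> 'a \<times> nat) free_algebra fps^'a^'a)"
  have "augmentation ` rtt_relators R (generator_matrix :: ('a \<times> 'a \<times> nat) free_algebra fps^'a^'a) \<subseteq> {0}"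
    using rtt_relators_mat_1[of R']
    by (simp add: augmentation_generator_matrix
        flip: rtt_relators_map[OF algebra_hom_unital_ring_hom[OF augmentation_hom] R])
  with r show "augmentation r = 0" by auto
qed

lemma map_inverse_u_minus:
  assumes "unital_ring_hom h"
  shows "map_coeffs (map_fls h) (inverse_u_minus w) = inverse_u_minus (map_fls h w)"
  by (auto simp: fps_eq_iff inverse_u_minus_def unital_ring_homD[OF unital_ring_hom_map_fls[OF assms]]
      split: nat.split)

lemma map_fls_X_inv:
  assumes "unital_ring_hom h"
  shows "map_fls h fls_X_inv = fls_X_inv"
  by (auto simp: fls_eq_iff nth_map_fls unital_ring_homD[OF assms])

lemma subst_affine_map:
  assumes "clinear h"
  shows "map_coeffs h (subst_affine a b F) = subst_affine a b (map_coeffs h F)"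
  by (simp add: fps_eq_iff subst_affine_def clinear_sum[OF assms] clinear_scaleC[OF assms])

lemma subst_affine_zero: "subst_affine a b 0 = 0"
  by (simp add: fps_eq_iff subst_affine_def complex_vector.scale_zero_right)

lemma subst_affine_one: "subst_affine a b (1 :: 'a::complex_algebra_1 fps) = 1"
proof (rule fps_ext)
  fix n
  have "fps_nth (subst_affine a b (1 :: 'a fps)) n = (\<Sum>r\<le>n. if r = 0 then (if n = 0 then 1 else 0) else 0)"
    unfolding subst_affine_def fps_nth_Abs_fps
    by (rule sum.cong) (auto simp: fps_one_nth complex_vector.scale_zero_right complex_vector.scale_zero_left)
  then show "fps_nth (subst_affine a b (1 :: 'a fps)) n = fps_nth 1 n" by (simp add: fps_one_nth)
qed

section \<open>The Yangian \<open>Y(2)\<close> and its subquotients\<close>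

text \<open>The index set \<open>{-1, 1}\<close>.\<close>

datatype ix2 = I_m1 | I_p1

instance ix2 :: finite
proof
  have "x \<in> {I_m1, I_p1}" for x by (cases x) auto
  then have "UNIV \<subseteq> {I_m1, I_p1}" by blast
  then show "finite (UNIV :: ix2 set)" by (rule finite_subset) simp
qed

instantiation ix2 :: uminus
begin
fun uminus_ix2 :: "ix2 \<Rightarrow> ix2" where "- I_m1 = I_p1" | "- I_p1 = I_m1"
instance ..
end

definition matrix_K :: "'a::ring_1^ix2^ix2" where
  "matrix_K = matrix_unit I_p1 I_p1 - matrix_unit I_m1 I_m1"

text \<open>This is \<open>R\<^sup>\<circ>(u - v)\<close> for \<open>R\<^sup>\<circ>(u) = I - P / u\<close>.\<close>

definition R_Y2 :: "'a::ring_1 series2^(ix2 \<times> ix2)^(ix2 \<times> ix2)" where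
  "R_Y2 = mat 1 - mat (inverse_u_minus fls_X_inv) ** matrix_P"

type_synonym y2_free = "(ix2 \<times> ix2 \<times> nat) free_algebra"

definition y2_rel :: "y2_free \<Rightarrow> y2_free \<Rightarrow> bool" where
  "y2_rel x y \<longleftrightarrow> x - y \<in> two_sided_ideal hull (rtt_relators R_Y2 generator_matrix)"

lemma augmentation_y2_rel: "y2_rel x y \<Longrightarrow> augmentation x = augmentation y"
proof -
  have h: "unital_ring_hom augmentation" by (rule algebra_hom_unital_ring_hom[OF augmentation_hom])
  note hs = unital_ring_hom_map_coeffs[OF unital_ring_hom_map_fls[OF h]]
  have "map_entries (map_coeffs (map_fls augmentation)) R_Y2 = R_Y2"
    by (simp add: R_Y2_def map_entries_hom[OF hs] map_entries_P_Q[OF hs] map_inverse_u_minus[OF h]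
        map_fls_X_inv[OF h] unital_ring_homD[OF hs])
  moreover assume "y2_rel x y"
  ultimately have "augmentation (x - y) = 0"
    unfolding y2_rel_def by (rule rtt_quotient_nontrivial)
  then show ?thesis by (simp add: algebra_homD[OF augmentation_hom])
qed

lemma y2_nontrivial: "\<not> y2_rel 0 1"
  using augmentation_y2_rel[of 0 1] by (auto simp: algebra_homD[OF augmentation_hom])

quotient_type y2 = y2_free / y2_rel
  unfolding y2_rel_def by (rule ideal_equivp[OF two_sided_ideal_hull])

instantiation y2 :: complex_algebra_1
begin
lift_definition zero_y2 :: y2 is 0 .
lift_definition one_y2 :: y2 is 1 .
lift_definition plus_y2 :: "y2 \<Rightarrow> y2 \<Rightarrow> y2" is "(+)"
  unfolding y2_rel_def by (rule ideal_cong[OF two_sided_ideal_hull])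
lift_definition minus_y2 :: "y2 \<Rightarrow> y2 \<Rightarrow> y2" is "(-)"
  unfolding y2_rel_def by (rule ideal_cong[OF two_sided_ideal_hull])
lift_definition uminus_y2 :: "y2 \<Rightarrow> y2" is uminus
  unfolding y2_rel_def by (rule ideal_cong[OF two_sided_ideal_hull])
lift_definition times_y2 :: "y2 \<Rightarrow> y2 \<Rightarrow> y2" is "(*)"
  unfolding y2_rel_def by (rule ideal_cong[OF two_sided_ideal_hull])
lift_definition scaleC_y2 :: "complex \<Rightarrow> y2 \<Rightarrow> y2" is scaleC
  unfolding y2_rel_def by (rule ideal_cong[OF two_sided_ideal_hull])
instance
proof
  note [simp] = equivp_reflp[OF y2_equivp]
  fix x y z :: y2 and c d :: complex
  show "x + y + z = x + (y + z)" by transfer (simp add: add.assoc)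
  show "x + y = y + x" by transfer (simp add: add.commute)
  show "0 + x = x" by transfer simp
  show "- x + x = 0" by transfer simp
  show "x - y = x + - y" by transfer simp
  show "c *\<^sub>C (x + y) = c *\<^sub>C x + c *\<^sub>C y" by transfer (simp add: scaleC_add_right)
  show "(c + d) *\<^sub>C x = c *\<^sub>C x + d *\<^sub>C x" by transfer (simp add: scaleC_add_left)
  show "c *\<^sub>C d *\<^sub>C x = (c * d) *\<^sub>C x" by transfer simp
  show "1 *\<^sub>C x = x" by transfer simp
  show "x * y * z = x * (y * z)" by transfer (simp add: mult.assoc)
  show "1 * x = x" by transfer simp
  show "x * 1 = x" by transfer simp
  show "(x + y) * z = x * z + y * z" by transfer (simp add: distrib_right)
  show "x * (y + z) = x * y + x * z" by transfer (simp add: distrib_left)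
  show "(0 :: y2) \<noteq> 1" by transfer (rule y2_nontrivial)
  show "(c *\<^sub>C x) * y = c *\<^sub>C (x * y)" by transfer (simp add: mult_scaleC_left)
  show "x * (c *\<^sub>C y) = c *\<^sub>C (x * y)" by transfer (simp add: mult_scaleC_right)
qed
end

lemma abs_y2_hom: "algebra_hom abs_y2"
  by (auto simp: algebra_hom_def plus_y2.abs_eq scaleC_y2.abs_eq one_y2_def times_y2.abs_eq
      intro!: clinearI)

lift_definition counit_y2 :: "y2 \<Rightarrow> complex" is augmentation
  by (rule augmentation_y2_rel)

lemma counit_y2_hom: "algebra_hom counit_y2"
  unfolding algebra_hom_def
  by (safe intro!: clinearI; transfer) (simp_all add: algebra_homD[OF augmentation_hom])

definition T_Y2 :: "y2 fps^ix2^ix2" where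
  "T_Y2 = map_entries (map_coeffs abs_y2) generator_matrix"

definition qdet :: "'a::complex_algebra_1 fps^ix2^ix2 \<Rightarrow> 'a fps" where
  "qdet T = subst_affine 1 (-1) (T $ I_m1 $ I_m1) * T $ I_p1 $ I_p1
    - subst_affine 1 (-1) (T $ I_m1 $ I_p1) * T $ I_p1 $ I_m1"

definition sy2_rel :: "y2 \<Rightarrow> y2 \<Rightarrow> bool" where
  "sy2_rel x y \<longleftrightarrow> x - y \<in> two_sided_ideal hull {fps_nth (qdet T_Y2 - 1) r | r. True}"

lemma sy2_nontrivial: "\<not> sy2_rel 0 1"
proof
  assume "sy2_rel 0 1"
  have h: "unital_ring_hom counit_y2" by (rule algebra_hom_unital_ring_hom[OF counit_y2_hom])
  note hs = unital_ring_homD[OF unital_ring_hom_map_coeffs[OF h]]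
  have "map_entries (map_coeffs counit_y2) T_Y2 = map_entries (map_coeffs augmentation) generator_matrix"
    by (simp add: vec_eq_iff fps_eq_iff T_Y2_def counit_y2.abs_eq)
  then have T: "map_coeffs counit_y2 (T_Y2 $ i $ j) = (if i = j then 1 else 0)" for i j
    by (simp add: augmentation_generator_matrix vec_eq_iff mat_def)
  have "map_coeffs counit_y2 (qdet T_Y2 - 1) = 0"
    by (simp add: qdet_def hs subst_affine_map[OF algebra_homD(1)[OF counit_y2_hom]] T
        subst_affine_zero subst_affine_one)
  then have "counit_y2 (fps_nth (qdet T_Y2 - 1) r) = 0" for r
    by (metis nth_map_coeffs fps_zero_nth)
  then have "counit_y2 x = 0" if "x \<in> {fps_nth (qdet T_Y2 - 1) r | r. True}" for x
    using that by (elim CollectE exE conjE) simp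
  then have "counit_y2 (0 - 1) = 0"
    by (rule algebra_hom_ideal_hull_zero[OF counit_y2_hom _ \<open>sy2_rel 0 1\<close>[unfolded sy2_rel_def]])
  then show False
    unfolding algebra_homD(6)[OF counit_y2_hom] algebra_homD(2)[OF counit_y2_hom]
      algebra_homD(5)[OF counit_y2_hom] by simp
qed

quotient_type sy2 = y2 / sy2_rel
  unfolding sy2_rel_def by (rule ideal_equivp[OF two_sided_ideal_hull])

instantiation sy2 :: complex_algebra_1
begin
lift_definition zero_sy2 :: sy2 is 0 .
lift_definition one_sy2 :: sy2 is 1 .
lift_definition plus_sy2 :: "sy2 \<Rightarrow> sy2 \<Rightarrow> sy2" is "(+)"
  unfolding sy2_rel_def by (rule ideal_cong[OF two_sided_ideal_hull])
lift_definition minus_sy2 :: "sy2 \<Rightarrow> sy2 \<Rightarrow> sy2" is "(-)"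
  unfolding sy2_rel_def by (rule ideal_cong[OF two_sided_ideal_hull])
lift_definition uminus_sy2 :: "sy2 \<Rightarrow> sy2" is uminus
  unfolding sy2_rel_def by (rule ideal_cong[OF two_sided_ideal_hull])
lift_definition times_sy2 :: "sy2 \<Rightarrow> sy2 \<Rightarrow> sy2" is "(*)"
  unfolding sy2_rel_def by (rule ideal_cong[OF two_sided_ideal_hull])
lift_definition scaleC_sy2 :: "complex \<Rightarrow> sy2 \<Rightarrow> sy2" is scaleC
  unfolding sy2_rel_def by (rule ideal_cong[OF two_sided_ideal_hull])
instance
proof
  note [simp] = equivp_reflp[OF sy2_equivp]
  fix x y z :: sy2 and c d :: complex
  show "x + y + z = x + (y + z)" by transfer (simp add: add.assoc)
  show "x + y = y + x" by transfer (simp add: add.commute)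
  show "0 + x = x" by transfer simp
  show "- x + x = 0" by transfer simp
  show "x - y = x + - y" by transfer simp
  show "c *\<^sub>C (x + y) = c *\<^sub>C x + c *\<^sub>C y" by transfer (simp add: scaleC_add_right)
  show "(c + d) *\<^sub>C x = c *\<^sub>C x + d *\<^sub>C x" by transfer (simp add: scaleC_add_left)
  show "c *\<^sub>C d *\<^sub>C x = (c * d) *\<^sub>C x" by transfer simp
  show "1 *\<^sub>C x = x" by transfer simp
  show "x * y * z = x * (y * z)" by transfer (simp add: mult.assoc)
  show "1 * x = x" by transfer simp
  show "x * 1 = x" by transfer simp
  show "(x + y) * z = x * z + y * z" by transfer (simp add: distrib_right)
  show "x * (y + z) = x * y + x * z" by transfer (simp add: distrib_left)
  show "(0 :: sy2) \<noteq> 1" by transfer (rule sy2_nontrivial)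
  show "(c *\<^sub>C x) * y = c *\<^sub>C (x * y)" by transfer (simp add: mult_scaleC_left)
  show "x * (c *\<^sub>C y) = c *\<^sub>C (x * y)" by transfer (simp add: mult_scaleC_right)
qed
end

lemma abs_sy2_hom: "algebra_hom abs_sy2"
  by (auto simp: algebra_hom_def plus_sy2.abs_eq scaleC_sy2.abs_eq one_sy2_def times_sy2.abs_eq
      intro!: clinearI)

definition T_SY2 :: "sy2 fps^ix2^ix2" where
  "T_SY2 = map_entries (map_coeffs abs_sy2) T_Y2"

text \<open>\<open>T(u) T(-u)\<^sup>t\<close>, where the transposition is \<open>t\<^sub>+\<close>.\<close>

definition twisted_matrix :: "'a::complex_algebra_1 fps^ix2^ix2 \<Rightarrow> 'a fps^ix2^ix2" where
  "twisted_matrix T = T ** transpose_neg (map_entries (subst_affine (-1) 0) T)"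

lemma twisted_matrix_map:
  assumes "algebra_hom h"
  shows "map_entries (map_coeffs h) (twisted_matrix T) = twisted_matrix (map_entries (map_coeffs h) T)"
  unfolding twisted_matrix_def
    map_entries_hom(1)[OF unital_ring_hom_map_coeffs[OF algebra_hom_unital_ring_hom[OF assms]]]
  by (rule arg_cong2[of _ _ _ _ "(**)"])
     (simp_all add: vec_eq_iff transpose_neg_def subst_affine_map[OF algebra_homD(1)[OF assms]])

lemma coefficients_map: "coefficients (map_entries (map_coeffs h) M) = h ` coefficients M"
  by (simp add: coefficients_def setcompr_eq_image image_def) blast

typedef y2tw = "subalgebra hull coefficients (twisted_matrix T_Y2)"
  using subalgebraD(1)[OF subalgebra_hull] by blast

setup_lifting type_definition_y2tw

instantiation y2tw :: complex_algebra_1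
begin
lift_definition zero_y2tw :: y2tw is 0 by (rule subalgebraD[OF subalgebra_hull])
lift_definition one_y2tw :: y2tw is 1 by (rule subalgebraD[OF subalgebra_hull])
lift_definition plus_y2tw :: "y2tw \<Rightarrow> y2tw \<Rightarrow> y2tw" is "(+)" by (rule subalgebraD[OF subalgebra_hull])
lift_definition minus_y2tw :: "y2tw \<Rightarrow> y2tw \<Rightarrow> y2tw" is "(-)" by (rule subalgebraD[OF subalgebra_hull])
lift_definition uminus_y2tw :: "y2tw \<Rightarrow> y2tw" is uminus by (rule subalgebraD[OF subalgebra_hull])
lift_definition times_y2tw :: "y2tw \<Rightarrow> y2tw \<Rightarrow> y2tw" is "(*)" by (rule subalgebraD[OF subalgebra_hull])
lift_definition scaleC_y2tw :: "complex \<Rightarrow> y2tw \<Rightarrow> y2tw" is scaleC by (rule subalgebraD[OF subalgebra_hull])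
instance
proof
  fix x y z :: y2tw and c d :: complex
  show "x + y + z = x + (y + z)" by transfer (simp add: add.assoc)
  show "x + y = y + x" by transfer (simp add: add.commute)
  show "0 + x = x" by transfer simp
  show "- x + x = 0" by transfer simp
  show "x - y = x + - y" by transfer simp
  show "c *\<^sub>C (x + y) = c *\<^sub>C x + c *\<^sub>C y" by transfer (simp add: scaleC_add_right)
  show "(c + d) *\<^sub>C x = c *\<^sub>C x + d *\<^sub>C x" by transfer (simp add: scaleC_add_left)
  show "c *\<^sub>C d *\<^sub>C x = (c * d) *\<^sub>C x" by transfer simp
  show "1 *\<^sub>C x = x" by transfer simp
  show "x * y * z = x * (y * z)" by transfer (simp add: mult.assoc)
  show "1 * x = x" by transfer simp
  show "x * 1 = x" by transfer simp
  show "(x + y) * z = x * z + y * z" by transfer (simp add: distrib_right)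
  show "x * (y + z) = x * y + x * z" by transfer (simp add: distrib_left)
  show "(0 :: y2tw) \<noteq> 1" by transfer simp
  show "(c *\<^sub>C x) * y = c *\<^sub>C (x * y)" by transfer (simp add: mult_scaleC_left)
  show "x * (c *\<^sub>C y) = c *\<^sub>C (x * y)" by transfer (simp add: mult_scaleC_right)
qed
end

lemma Rep_y2tw_hom: "algebra_hom Rep_y2tw"
  by (auto simp: algebra_hom_def plus_y2tw.rep_eq scaleC_y2tw.rep_eq one_y2tw.rep_eq times_y2tw.rep_eq
      intro!: clinearI)

typedef sy2tw = "subalgebra hull coefficients (twisted_matrix T_SY2)"
  using subalgebraD(1)[OF subalgebra_hull] by blast

setup_lifting type_definition_sy2tw

instantiation sy2tw :: complex_algebra_1
begin
lift_definition zero_sy2tw :: sy2tw is 0 by (rule subalgebraD[OF subalgebra_hull])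
lift_definition one_sy2tw :: sy2tw is 1 by (rule subalgebraD[OF subalgebra_hull])
lift_definition plus_sy2tw :: "sy2tw \<Rightarrow> sy2tw \<Rightarrow> sy2tw" is "(+)" by (rule subalgebraD[OF subalgebra_hull])
lift_definition minus_sy2tw :: "sy2tw \<Rightarrow> sy2tw \<Rightarrow> sy2tw" is "(-)" by (rule subalgebraD[OF subalgebra_hull])
lift_definition uminus_sy2tw :: "sy2tw \<Rightarrow> sy2tw" is uminus by (rule subalgebraD[OF subalgebra_hull])
lift_definition times_sy2tw :: "sy2tw \<Rightarrow> sy2tw \<Rightarrow> sy2tw" is "(*)" by (rule subalgebraD[OF subalgebra_hull])
lift_definition scaleC_sy2tw :: "complex \<Rightarrow> sy2tw \<Rightarrow> sy2tw" is scaleC by (rule subalgebraD[OF subalgebra_hull])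
instance
proof
  fix x y z :: sy2tw and c d :: complex
  show "x + y + z = x + (y + z)" by transfer (simp add: add.assoc)
  show "x + y = y + x" by transfer (simp add: add.commute)
  show "0 + x = x" by transfer simp
  show "- x + x = 0" by transfer simp
  show "x - y = x + - y" by transfer simp
  show "c *\<^sub>C (x + y) = c *\<^sub>C x + c *\<^sub>C y" by transfer (simp add: scaleC_add_right)
  show "(c + d) *\<^sub>C x = c *\<^sub>C x + d *\<^sub>C x" by transfer (simp add: scaleC_add_left)
  show "c *\<^sub>C d *\<^sub>C x = (c * d) *\<^sub>C x" by transfer simp
  show "1 *\<^sub>C x = x" by transfer simp
  show "x * y * z = x * (y * z)" by transfer (simp add: mult.assoc)
  show "1 * x = x" by transfer simp
  show "x * 1 = x" by transfer simp
  show "(x + y) * z = x * z + y * z" by transfer (simp add: distrib_right)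
  show "x * (y + z) = x * y + x * z" by transfer (simp add: distrib_left)
  show "(0 :: sy2tw) \<noteq> 1" by transfer simp
  show "(c *\<^sub>C x) * y = c *\<^sub>C (x * y)" by transfer (simp add: mult_scaleC_left)
  show "x * (c *\<^sub>C y) = c *\<^sub>C (x * y)" by transfer (simp add: mult_scaleC_right)
qed
end

lemma Rep_sy2tw_hom: "algebra_hom Rep_sy2tw"
  by (auto simp: algebra_hom_def plus_sy2tw.rep_eq scaleC_sy2tw.rep_eq one_sy2tw.rep_eq times_sy2tw.rep_eq
      intro!: clinearI)

definition S_Y2 :: "y2tw fps^ix2^ix2" where
  "S_Y2 = map_entries (map_coeffs Abs_y2tw) (twisted_matrix T_Y2)"

lemma Rep_S_Y2: "map_entries (map_coeffs Rep_y2tw) S_Y2 = twisted_matrix T_Y2"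
proof -
  have "fps_nth ((twisted_matrix T_Y2) $ i $ j) r \<in> subalgebra hull coefficients (twisted_matrix T_Y2)" for i j r
    by (rule hull_inc) (auto simp: coefficients_def)
  then show ?thesis by (simp add: vec_eq_iff fps_eq_iff S_Y2_def Abs_y2tw_inverse)
qed

lift_definition Pr :: "y2tw \<Rightarrow> sy2tw" is abs_sy2
proof -
  fix x assume "x \<in> subalgebra hull coefficients (twisted_matrix T_Y2)"
  from algebra_hom_hull_image[OF abs_sy2_hom this]
  show "abs_sy2 x \<in> subalgebra hull coefficients (twisted_matrix T_SY2)"
    by (simp add: T_SY2_def coefficients_map flip: twisted_matrix_map[OF abs_sy2_hom])
qed

definition Pr1 :: "(y2tw, y2tw) tensor \<Rightarrow> (sy2tw, y2tw) tensor" where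
  "Pr1 = tensor_map Pr id"

definition Pr2 :: "(y2tw, y2tw) tensor \<Rightarrow> (y2tw, sy2tw) tensor" where
  "Pr2 = tensor_map id Pr"

lemma Pr_hom: "algebra_hom Pr"
  unfolding algebra_hom_def
  by (safe intro!: clinearI; transfer) (simp_all add: algebra_homD[OF abs_sy2_hom])

lemma Pr1_Pr2_hom: "algebra_hom Pr1" "algebra_hom Pr2"
proof -
  have "algebra_hom (id :: y2tw \<Rightarrow> y2tw)" by (auto simp: algebra_hom_def intro!: clinearI)
  then show "algebra_hom Pr1" "algebra_hom Pr2"
    unfolding Pr1_def Pr2_def by (auto intro: tensor_map_hom Pr_hom)
qed

section \<open>The extended Yangian \<open>X(so\<^sub>4)\<close> and its twisted Yangian\<close>

text \<open>The index set \<open>{-2, -1, 1, 2}\<close>.\<close>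

datatype ix4 = J_m2 | J_m1 | J_p1 | J_p2

instance ix4 :: finite
proof
  have "x \<in> {J_m2, J_m1, J_p1, J_p2}" for x by (cases x) auto
  then have "UNIV \<subseteq> {J_m2, J_m1, J_p1, J_p2}" by blast
  then show "finite (UNIV :: ix4 set)" by (rule finite_subset) simp
qed

instantiation ix4 :: uminus
begin
fun uminus_ix4 :: "ix4 \<Rightarrow> ix4" where
  "- J_m2 = J_p2" | "- J_m1 = J_p1" | "- J_p1 = J_m1" | "- J_p2 = J_m2"
instance ..
end

text \<open>This is \<open>R(u - v)\<close> for \<open>R(u) = I - P / u + Q / (u - 1)\<close>.\<close>

definition R_X4 :: "'a::ring_1 series2^(ix4 \<times> ix4)^(ix4 \<times> ix4)" where
  "R_X4 = mat 1 - mat (inverse_u_minus fls_X_inv) ** matrix_P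
    + mat (inverse_u_minus (fls_X_inv + 1)) ** matrix_Q"

type_synonym x4_free = "(ix4 \<times> ix4 \<times> nat) free_algebra"

definition x4_rel :: "x4_free \<Rightarrow> x4_free \<Rightarrow> bool" where
  "x4_rel x y \<longleftrightarrow> x - y \<in> two_sided_ideal hull (rtt_relators R_X4 generator_matrix)"

lemma x4_nontrivial: "\<not> x4_rel 0 1"
proof
  have h: "unital_ring_hom augmentation" by (rule algebra_hom_unital_ring_hom[OF augmentation_hom])
  note hs = unital_ring_hom_map_coeffs[OF unital_ring_hom_map_fls[OF h]]
  have "map_entries (map_coeffs (map_fls augmentation)) R_X4 = R_X4"
    by (simp add: R_X4_def map_entries_hom[OF hs] map_entries_P_Q[OF hs] map_inverse_u_minus[OF h]
        map_fls_X_inv[OF h] unital_ring_homD[OF hs] unital_ring_homD[OF unital_ring_hom_map_fls[OF h]])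
  moreover assume "x4_rel 0 1"
  ultimately have "augmentation (0 - 1 :: x4_free) = 0"
    unfolding x4_rel_def by (rule rtt_quotient_nontrivial)
  then show False
    by (simp add: augmentation_def lookup_minus)
qed

quotient_type x4 = x4_free / x4_rel
  unfolding x4_rel_def by (rule ideal_equivp[OF two_sided_ideal_hull])

instantiation x4 :: complex_algebra_1
begin
lift_definition zero_x4 :: x4 is 0 .
lift_definition one_x4 :: x4 is 1 .
lift_definition plus_x4 :: "x4 \<Rightarrow> x4 \<Rightarrow> x4" is "(+)"
  unfolding x4_rel_def by (rule ideal_cong[OF two_sided_ideal_hull])
lift_definition minus_x4 :: "x4 \<Rightarrow> x4 \<Rightarrow> x4" is "(-)"
  unfolding x4_rel_def by (rule ideal_cong[OF two_sided_ideal_hull])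
lift_definition uminus_x4 :: "x4 \<Rightarrow> x4" is uminus
  unfolding x4_rel_def by (rule ideal_cong[OF two_sided_ideal_hull])
lift_definition times_x4 :: "x4 \<Rightarrow> x4 \<Rightarrow> x4" is "(*)"
  unfolding x4_rel_def by (rule ideal_cong[OF two_sided_ideal_hull])
lift_definition scaleC_x4 :: "complex \<Rightarrow> x4 \<Rightarrow> x4" is scaleC
  unfolding x4_rel_def by (rule ideal_cong[OF two_sided_ideal_hull])
instance
proof
  note [simp] = equivp_reflp[OF x4_equivp]
  fix x y z :: x4 and c d :: complex
  show "x + y + z = x + (y + z)" by transfer (simp add: add.assoc)
  show "x + y = y + x" by transfer (simp add: add.commute)
  show "0 + x = x" by transfer simp
  show "- x + x = 0" by transfer simp
  show "x - y = x + - y" by transfer simp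
  show "c *\<^sub>C (x + y) = c *\<^sub>C x + c *\<^sub>C y" by transfer (simp add: scaleC_add_right)
  show "(c + d) *\<^sub>C x = c *\<^sub>C x + d *\<^sub>C x" by transfer (simp add: scaleC_add_left)
  show "c *\<^sub>C d *\<^sub>C x = (c * d) *\<^sub>C x" by transfer simp
  show "1 *\<^sub>C x = x" by transfer simp
  show "x * y * z = x * (y * z)" by transfer (simp add: mult.assoc)
  show "1 * x = x" by transfer simp
  show "x * 1 = x" by transfer simp
  show "(x + y) * z = x * z + y * z" by transfer (simp add: distrib_right)
  show "x * (y + z) = x * y + x * z" by transfer (simp add: distrib_left)
  show "(0 :: x4) \<noteq> 1" by transfer (rule x4_nontrivial)
  show "(c *\<^sub>C x) * y = c *\<^sub>C (x * y)" by transfer (simp add: mult_scaleC_left)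
  show "x * (c *\<^sub>C y) = c *\<^sub>C (x * y)" by transfer (simp add: mult_scaleC_right)
qed
end

lemma abs_x4_hom: "algebra_hom abs_x4"
  by (auto simp: algebra_hom_def plus_x4.abs_eq scaleC_x4.abs_eq one_x4_def times_x4.abs_eq
      intro!: clinearI)

definition T_X4 :: "x4 fps^ix4^ix4" where
  "T_X4 = map_entries (map_coeffs abs_x4) generator_matrix"

definition matrix_G' :: "'a::ring_1^ix4^ix4" where
  "matrix_G' = (\<chi> i j. if i = j then (if i = J_m2 \<or> i = J_p2 then 1 else -1) else 0)"

definition S_X4_ambient :: "x4 fps^ix4^ix4" where
  "S_X4_ambient = map_entries (subst_affine 1 (-1/2)) T_X4 ** matrix_G' **
     transpose_neg (map_entries (subst_affine (-1) (1/2)) T_X4)"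

typedef x4tw = "subalgebra hull coefficients S_X4_ambient"
  using subalgebraD(1)[OF subalgebra_hull] by blast

setup_lifting type_definition_x4tw

instantiation x4tw :: complex_algebra_1
begin
lift_definition zero_x4tw :: x4tw is 0 by (rule subalgebraD[OF subalgebra_hull])
lift_definition one_x4tw :: x4tw is 1 by (rule subalgebraD[OF subalgebra_hull])
lift_definition plus_x4tw :: "x4tw \<Rightarrow> x4tw \<Rightarrow> x4tw" is "(+)" by (rule subalgebraD[OF subalgebra_hull])
lift_definition minus_x4tw :: "x4tw \<Rightarrow> x4tw \<Rightarrow> x4tw" is "(-)" by (rule subalgebraD[OF subalgebra_hull])
lift_definition uminus_x4tw :: "x4tw \<Rightarrow> x4tw" is uminus by (rule subalgebraD[OF subalgebra_hull])
lift_definition times_x4tw :: "x4tw \<Rightarrow> x4tw \<Rightarrow> x4tw" is "(*)" by (rule subalgebraD[OF subalgebra_hull])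
lift_definition scaleC_x4tw :: "complex \<Rightarrow> x4tw \<Rightarrow> x4tw" is scaleC by (rule subalgebraD[OF subalgebra_hull])
instance
proof
  fix x y z :: x4tw and c d :: complex
  show "x + y + z = x + (y + z)" by transfer (simp add: add.assoc)
  show "x + y = y + x" by transfer (simp add: add.commute)
  show "0 + x = x" by transfer simp
  show "- x + x = 0" by transfer simp
  show "x - y = x + - y" by transfer simp
  show "c *\<^sub>C (x + y) = c *\<^sub>C x + c *\<^sub>C y" by transfer (simp add: scaleC_add_right)
  show "(c + d) *\<^sub>C x = c *\<^sub>C x + d *\<^sub>C x" by transfer (simp add: scaleC_add_left)
  show "c *\<^sub>C d *\<^sub>C x = (c * d) *\<^sub>C x" by transfer simp
  show "1 *\<^sub>C x = x" by transfer simp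
  show "x * y * z = x * (y * z)" by transfer (simp add: mult.assoc)
  show "1 * x = x" by transfer simp
  show "x * 1 = x" by transfer simp
  show "(x + y) * z = x * z + y * z" by transfer (simp add: distrib_right)
  show "x * (y + z) = x * y + x * z" by transfer (simp add: distrib_left)
  show "(0 :: x4tw) \<noteq> 1" by transfer simp
  show "(c *\<^sub>C x) * y = c *\<^sub>C (x * y)" by transfer (simp add: mult_scaleC_left)
  show "x * (c *\<^sub>C y) = c *\<^sub>C (x * y)" by transfer (simp add: mult_scaleC_right)
qed
end

lemma Rep_x4tw_hom: "algebra_hom Rep_x4tw"
  by (auto simp: algebra_hom_def plus_x4tw.rep_eq scaleC_x4tw.rep_eq one_x4tw.rep_eq times_x4tw.rep_eq
      intro!: clinearI)

definition S_X4 :: "x4tw fps^ix4^ix4" where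
  "S_X4 = map_entries (map_coeffs Abs_x4tw) S_X4_ambient"

lemma Rep_S_X4: "map_entries (map_coeffs Rep_x4tw) S_X4 = S_X4_ambient"
proof -
  have "fps_nth (S_X4_ambient $ i $ j) r \<in> subalgebra hull coefficients (S_X4_ambient)" for i j r
    by (rule hull_inc) (auto simp: coefficients_def)
  then show ?thesis by (simp add: vec_eq_iff fps_eq_iff S_X4_def Abs_x4tw_inverse)
qed

section \<open>The target matrix of the embedding\<close>

text \<open>\<open>v\<^sub>i = v_sign i \<cdot> e\<^sub>a \<otimes> e\<^sub>b\<close> with \<open>(a, b) = v_index i\<close>. As \<open>v_sign i\<close> is its own inverse, an
  operator \<open>M\<close> satisfies \<open>M v\<^sub>j = (\<Sum>i. v_sign i \<cdot> v_sign j \<cdot> M\<^bsub>v_index i, v_index j\<^esub> v\<^sub>i)\<close>.\<close>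

fun v_index :: "ix4 \<Rightarrow> ix2 \<times> ix2" where
  "v_index J_m2 = (I_m1, I_m1)"
| "v_index J_m1 = (I_m1, I_p1)"
| "v_index J_p1 = (I_p1, I_m1)"
| "v_index J_p2 = (I_p1, I_p1)"

fun v_sign :: "ix4 \<Rightarrow> 'a::ring_1" where
  "v_sign J_m2 = 1"
| "v_sign J_m1 = 1"
| "v_sign J_p1 = 1"
| "v_sign J_p2 = -1"

definition in_basis_v :: "'a::ring_1^(ix2 \<times> ix2)^(ix2 \<times> ix2) \<Rightarrow> 'a^ix4^ix4" where
  "in_basis_v M = (\<chi> i j. v_sign i * v_sign j * M $ v_index i $ v_index j)"

text \<open>\<open>S\<^sup>\<circ>(u - 1/2) K\<^sub>1 S\<^sup>\<bullet>(u - 1/2) K\<^sub>2\<close>, where the two copies of \<open>Y\<^sup>+(2)\<close> are the two tensor factors of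
  the coefficient algebra.\<close>

definition phi2_matrix :: "(y2tw, y2tw) tensor fps^(ix2 \<times> ix2)^(ix2 \<times> ix2)" where
  "phi2_matrix =
     (let S_circ = map_entries (map_coeffs (\<lambda>a. a \<otimes>\<^sub>C 1)) (map_entries (subst_affine 1 (-1/2)) S_Y2);
          S_bullet = map_entries (map_coeffs (\<lambda>a. 1 \<otimes>\<^sub>C a)) (map_entries (subst_affine 1 (-1/2)) S_Y2)
      in kron S_circ (mat 1) ** kron matrix_K (mat 1) ** kron (mat 1) S_bullet ** kron (mat 1) matrix_K)"

end

theory Submission
  imports Defs
begin

text \<open>
  Let \<open>D\<close> be the subalgebra of \<open>Y\<^sup>+(2) \<otimes> Y\<^sup>+(2)\<close> generated by the coefficients of all products
  \<open>s\<^sub>i\<^sub>j(u) \<otimes> s\<^sub>k\<^sub>l(u)\<close>. Up to signs and the shift by \<open>1/2\<close> these are the images of the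
  generators under \<open>\<phi>\<^sub>2\<close>, so \<open>D\<close> is the image of \<open>\<phi>\<^sub>2\<close>, and the claim is that \<open>Pr\<^sub>1\<close> and \<open>Pr\<^sub>2\<close> are
  bijective on \<open>D\<close>. As \<open>D\<close> is stable under the flip of the factors, \<open>Pr\<^sub>1\<close> suffices.

  Injectivity: the quantum determinant \<open>d(u)\<close> is central, hence \<open>y(u) y(u - 1) = d(u)\<close> has a central
  solution \<open>y\<close>. The maps \<open>T(u) \<mapsto> y(u)\<^sup>-\<^sup>1 T(u)\<close> on \<open>SY(2)\<close> and \<open>T(u) \<mapsto> y(u) \<otimes> T(u)\<close> on \<open>Y(2)\<close>
  combine to a homomorphism \<open>SY(2) \<otimes> Y(2) \<rightarrow> Y(2) \<otimes> Y(2)\<close>. It sends \<open>s\<^sub>i\<^sub>j(u) \<otimes> s\<^sub>k\<^sub>l(u)\<close> to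
  \<open>s\<^sub>i\<^sub>j(u) \<otimes> s\<^sub>k\<^sub>l(u)\<close>, because the scalar factors cancel, and thus inverts \<open>Pr\<^sub>1\<close> on \<open>D\<close>.

  Surjectivity: in \<open>SY\<^sup>+(2)\<close> one has \<open>S(u) K S(-u - 1) K = 1\<close>, since the adjugate \<open>K T(u)\<^sup>t K\<close> is
  \<open>d(u) T(u - 1)\<^sup>-\<^sup>1\<close>. Multiplying out, the image of \<open>D\<close> contains the coefficients of
  \<open>1 \<otimes> s\<^sub>k\<^sub>l(u) s\<^sub>p\<^sub>q(-u - 1)\<close>. These give all coefficients of \<open>1 \<otimes> s\<^sub>k\<^sub>l(u)\<close> by induction on the degree;
  the diagonal entries in odd degree need the symmetry relation of \<open>Y\<^sup>+(2)\<close>.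
\<close>

section \<open>Substitution of an affine function\<close>

text \<open>The expansion of (a u + b)^(-1) in powers of u^(-1) for nonzero a. Its constant term is
  zero, which makes substitution finite in each degree.\<close>

definition affine_kernel :: "complex \<Rightarrow> complex \<Rightarrow> complex fps" where
  "affine_kernel a b = fps_X * inverse (fps_const a + fps_const b * fps_X)"

lemma affine_kernel_power_nth: "n < r \<Longrightarrow> fps_nth (affine_kernel a b ^ r) n = 0"
  using startsby_zero_power_prefix[of "affine_kernel a b" r] by (simp add: affine_kernel_def)

text \<open>Powers r > n of the kernel contribute nothing in degree n, so the bound may be enlarged
  and sums for different degrees share one index range.\<close>

lemma subst_affine_nth:
  assumes "n \<le> N"
  shows "fps_nth (subst_affine a b F) n = (\<Sum>r\<le>N. fps_nth (affine_kernel a b ^ r) n *\<^sub>C fps_nth F r)"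
  unfolding subst_affine_def affine_kernel_def[symmetric] fps_nth_Abs_fps
  using assms by (intro sum.mono_neutral_left) (auto simp: affine_kernel_power_nth)

lemma subst_affine_add: "subst_affine a b (F + G) = subst_affine a b F + subst_affine a b G"
  by (rule fps_ext) (simp add: subst_affine_nth[OF order_refl] scaleC_add_right sum.distrib)

lemma subst_affine_diff: "subst_affine a b (F - G) = subst_affine a b F - subst_affine a b G"
  by (rule fps_ext)
     (simp add: subst_affine_nth[OF order_refl] complex_vector.scale_right_diff_distrib sum_subtractf)

lemma subst_affine_sum: "subst_affine a b (sum f A) = (\<Sum>i\<in>A. subst_affine a b (f i))"
  by (induction A rule: infinite_finite_induct) (simp_all add: subst_affine_zero subst_affine_add)

text \<open>The kernel is scalar, so the order of the coefficients of \<open>F\<close> and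
  \<open>G\<close> is kept while the kernel powers combine to exponent i + j, which vanishes in
  degree n for i + j > n.\<close>

lemma subst_affine_mult:
  fixes F G :: "'a::complex_algebra_1 fps"
  shows "subst_affine a b (F * G) = subst_affine a b F * subst_affine a b G"
proof (rule fps_ext)
  fix n
  let ?p = "affine_kernel a b"
  let ?f = "\<lambda>i j. fps_nth (?p ^ (i + j)) n *\<^sub>C (fps_nth F i * fps_nth G j)"
  have "fps_nth (subst_affine a b F * subst_affine a b G) n =
    (\<Sum>m\<le>n. (\<Sum>i\<le>n. fps_nth (?p ^ i) m *\<^sub>C fps_nth F i) * (\<Sum>j\<le>n. fps_nth (?p ^ j) (n - m) *\<^sub>C fps_nth G j))"
    unfolding fps_mult_nth atLeast0AtMost
    by (intro sum.cong refl arg_cong2[of _ _ _ _ "(*)"] subst_affine_nth) auto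
  also have "\<dots> = (\<Sum>m\<le>n. \<Sum>i\<le>n. \<Sum>j\<le>n. (fps_nth (?p ^ i) m * fps_nth (?p ^ j) (n - m)) *\<^sub>C (fps_nth F i * fps_nth G j))"
    unfolding sum_product by (simp add: mult_scaleC_left mult_scaleC_right mult.commute)
  also have "\<dots> = (\<Sum>i\<le>n. \<Sum>j\<le>n. \<Sum>m\<le>n. (fps_nth (?p ^ i) m * fps_nth (?p ^ j) (n - m)) *\<^sub>C (fps_nth F i * fps_nth G j))"
    by (rule trans[OF sum.swap], rule sum.cong[OF refl], rule sum.swap)
  also have "\<dots> = (\<Sum>i\<le>n. \<Sum>j\<le>n. ?f i j)"
    by (simp add: power_add fps_mult_nth atLeast0AtMost complex_vector.scale_sum_left)
  also have "\<dots> = (\<Sum>(i, j)\<in>{..n} \<times> {..n}. ?f i j)"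
    by (simp add: sum.cartesian_product)
  also have "\<dots> = (\<Sum>(i, j)\<in>{(i, j). i + j \<le> n}. ?f i j)"
    by (rule sum.mono_neutral_right) (auto, metis affine_kernel_power_nth linorder_not_le)
  also have "\<dots> = (\<Sum>r\<le>n. \<Sum>i\<le>r. ?f i (r - i))"
    by (rule sum.triangle_reindex_eq)
  also have "\<dots> = fps_nth (subst_affine a b (F * G)) n"
    by (simp add: subst_affine_nth[OF order_refl] fps_mult_nth atLeast0AtMost complex_vector.scale_sum_right)
  finally show "fps_nth (subst_affine a b (F * G)) n = fps_nth (subst_affine a b F * subst_affine a b G) n" ..
qed

lemma subst_affine_const: "subst_affine a b (fps_const c) = fps_const c"
proof (rule fps_ext)
  fix n
  have "fps_nth (subst_affine a b (fps_const c)) n = (\<Sum>r\<le>n. if r = 0 then (if n = 0 then c else 0) else 0)"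
    unfolding subst_affine_nth[OF order_refl]
    by (rule sum.cong) (auto simp: fps_one_nth complex_vector.scale_zero_right complex_vector.scale_zero_left)
  then show "fps_nth (subst_affine a b (fps_const c)) n = fps_nth (fps_const c) n" by simp
qed

lemma subst_affine_nth_0: "fps_nth (subst_affine a b F) 0 = fps_nth F 0"
  by (simp add: subst_affine_nth[OF order_refl])

lemma affine_kernel_mult:
  assumes "a \<noteq> 0"
  shows "affine_kernel a b * (fps_const a + fps_const b * fps_X) = fps_X"
  using assms by (simp add: affine_kernel_def mult.assoc inverse_mult_eq_1)

text \<open>Over the complex numbers the nonzero denominator \<open>?B\<close> can be cancelled, so
  it is enough that both sides become \<open>fps_X\<close> after multiplication by it.\<close>

lemma affine_kernel_compose:
  assumes "a \<noteq> 0" "c \<noteq> 0"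
  shows "fps_compose (affine_kernel c d) (affine_kernel a b) = affine_kernel (c * a) (c * b + d)"
proof -
  let ?p = "affine_kernel a b" and ?A = "fps_const a + fps_const b * fps_X :: complex fps"
  let ?B = "fps_const (c * a) + fps_const (c * b + d) * fps_X :: complex fps"
  have p0: "fps_nth ?p 0 = 0" by (simp add: affine_kernel_def)
  have "fps_compose (affine_kernel c d) ?p = ?p * fps_compose (inverse (fps_const c + fps_const d * fps_X)) ?p"
    unfolding affine_kernel_def[of c d] using p0 by (simp add: fps_compose_mult_distrib)
  also have "fps_compose (inverse (fps_const c + fps_const d * fps_X)) ?p = inverse (fps_const c + fps_const d * ?p)"
    using p0 assms by (simp add: fps_inverse_compose fps_compose_add_distrib fps_compose_mult_distrib)
  finally have 1: "fps_compose (affine_kernel c d) ?p = ?p * inverse (fps_const c + fps_const d * ?p)" .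
  have "(fps_const c + fps_const d * ?p) * ?A = fps_const c * ?A + fps_const d * fps_X"
    by (simp only: distrib_right mult.assoc affine_kernel_mult[OF assms(1)])
  also have "\<dots> = ?B"
    by (simp add: distrib_left distrib_right fps_const_add[symmetric] mult.assoc[symmetric]
        flip: fps_const_mult)
  finally have 2: "(fps_const c + fps_const d * ?p) * ?A = ?B" .
  have ne: "fps_nth (fps_const c + fps_const d * ?p) 0 \<noteq> 0" using p0 assms by simp
  have "fps_compose (affine_kernel c d) ?p * ?B = ?p * ?A * (inverse (fps_const c + fps_const d * ?p) * (fps_const c + fps_const d * ?p))"
    unfolding 1 2[symmetric] by (simp only: mult_ac)
  also have "\<dots> = fps_X"
    using ne by (simp add: inverse_mult_eq_1 affine_kernel_mult[OF assms(1)])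
  also have "\<dots> = affine_kernel (c * a) (c * b + d) * ?B"
    using assms by (simp add: affine_kernel_mult)
  finally have eq: "fps_compose (affine_kernel c d) ?p * ?B = affine_kernel (c * a) (c * b + d) * ?B" .
  have "?B \<noteq> 0"
  proof
    assume "?B = 0"
    then have "fps_nth ?B 0 = 0" by simp
    then show False using assms by simp
  qed
  then show ?thesis using eq by (simp only: mult_cancel_right) blast
qed

text \<open>Composition turns powers of one kernel into powers of the composite kernel; the outer
  variable enters as c (a u + b) + d.\<close>

lemma subst_affine_compose:
  assumes "a \<noteq> 0" "c \<noteq> 0"
  shows "subst_affine a b (subst_affine c d F) = subst_affine (c * a) (c * b + d) F"
proof (rule fps_ext)
  fix n
  let ?p = "affine_kernel a b" and ?q = "affine_kernel c d"
  have "fps_nth ?p 0 = 0" by (simp add: affine_kernel_def)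
  then have q: "fps_compose (?q ^ s) ?p = affine_kernel (c * a) (c * b + d) ^ s" for s
    by (simp add: affine_kernel_compose[OF assms] flip: fps_compose_power)
  have "fps_nth (subst_affine a b (subst_affine c d F)) n =
    (\<Sum>r\<le>n. fps_nth (?p ^ r) n *\<^sub>C (\<Sum>s\<le>n. fps_nth (?q ^ s) r *\<^sub>C fps_nth F s))"
    unfolding subst_affine_nth[OF order_refl, of a b]
    by (intro sum.cong refl arg_cong2[of _ _ _ _ scaleC] subst_affine_nth) auto
  also have "\<dots> = (\<Sum>s\<le>n. \<Sum>r\<le>n. (fps_nth (?q ^ s) r * fps_nth (?p ^ r) n) *\<^sub>C fps_nth F s)"
    by (subst sum.swap) (simp add: complex_vector.scale_sum_right mult.commute)
  also have "\<dots> = (\<Sum>s\<le>n. fps_nth (fps_compose (?q ^ s) ?p) n *\<^sub>C fps_nth F s)"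
    by (simp add: fps_compose_nth atLeast0AtMost complex_vector.scale_sum_left)
  finally show "fps_nth (subst_affine a b (subst_affine c d F)) n = fps_nth (subst_affine (c * a) (c * b + d) F) n"
    by (simp add: q subst_affine_nth[OF order_refl])
qed

lemma subst_affine_id: "subst_affine 1 0 F = F"
proof (rule fps_ext)
  fix n
  have "fps_nth (subst_affine 1 0 F) n = (\<Sum>r\<le>n. if r = n then fps_nth F r else 0)"
    unfolding subst_affine_nth[OF order_refl]
    by (rule sum.cong) (auto simp: affine_kernel_def fps_X_power_iff complex_vector.scale_zero_left)
  then show "fps_nth (subst_affine 1 0 F) n = fps_nth F n" by simp
qed

text \<open>Stated without division, as the coefficients are noncommutative; it is the image of the
  scalar identity \<open>affine_kernel_mult\<close>.\<close>

lemma subst_affine_X: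
  assumes "a \<noteq> 0"
  shows "subst_affine a b (fps_X :: 'a::complex_algebra_1 fps) * (fps_const (a *\<^sub>C 1) + fps_const (b *\<^sub>C 1) * fps_X) = fps_X"
proof -
  have "fps_nth (subst_affine a b (fps_X :: 'a fps)) n = fps_nth (affine_kernel a b) n *\<^sub>C 1" for n
  proof -
    have "fps_nth (subst_affine a b (fps_X :: 'a fps)) n = (\<Sum>r\<le>Suc n. if r = 1 then fps_nth (affine_kernel a b) n *\<^sub>C 1 else 0)"
      by (subst subst_affine_nth[of n "Suc n"], simp, rule sum.cong) 
         (auto simp: complex_vector.scale_zero_right)
    then show ?thesis by simp
  qed
  then have X: "subst_affine a b (fps_X :: 'a fps) = map_coeffs (\<lambda>c. c *\<^sub>C 1) (affine_kernel a b)"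
    by (simp add: fps_eq_iff)
  have h: "unital_ring_hom (\<lambda>c. c *\<^sub>C (1 :: 'a))"
    by (simp add: unital_ring_hom_def scaleC_add_left mult_scaleC_left)
  note hs = unital_ring_homD[OF unital_ring_hom_map_coeffs[OF h]]
  have "map_coeffs (\<lambda>c. c *\<^sub>C (1 :: 'a)) (affine_kernel a b * (fps_const a + fps_const b * fps_X)) = map_coeffs (\<lambda>c. c *\<^sub>C 1) fps_X"
    by (simp only: affine_kernel_mult[OF assms])
  moreover have "map_coeffs (\<lambda>c. c *\<^sub>C (1 :: 'a)) fps_X = fps_X" "map_coeffs (\<lambda>c. c *\<^sub>C (1 :: 'a)) (fps_const e) = fps_const (e *\<^sub>C 1)" for e
    by (auto simp: fps_eq_iff)
  ultimately show ?thesis unfolding X by (simp add: hs)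
qed

section \<open>Universal properties\<close>

lemma algebra_hom_id: "algebra_hom id"
  by (auto simp: algebra_hom_def intro!: clinearI)

lemma algebra_hom_compose: "algebra_hom f \<Longrightarrow> algebra_hom g \<Longrightarrow> algebra_hom (\<lambda>x. g (f x))"
  by (auto simp: algebra_hom_def Vector_Spaces.linear_iff intro!: clinearI)

lemma algebra_hom_eq_on_hull:
  assumes "algebra_hom f" "algebra_hom g" "\<And>x. x \<in> G \<Longrightarrow> f x = g x" "x \<in> subalgebra hull G"
  shows "f x = g x"
  using assms(4)
proof (rule hull_induct)
  show "subalgebra {x. f x = g x}"
    by (auto simp: subalgebra_def algebra_homD[OF assms(1)] algebra_homD[OF assms(2)])
qed (rule assms(3))

lemma subalgebra_image: "algebra_hom f \<Longrightarrow> subalgebra A \<Longrightarrow> subalgebra (f ` A)"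
  unfolding subalgebra_def by (auto simp: image_iff) (metis algebra_homD(2,3,4,7))+

lemma image_hull:
  assumes "algebra_hom f"
  shows "f ` (subalgebra hull G) = subalgebra hull (f ` G)"
proof
  show "f ` (subalgebra hull G) \<subseteq> subalgebra hull (f ` G)"
    using algebra_hom_hull_image[OF assms] by blast
  show "subalgebra hull (f ` G) \<subseteq> f ` (subalgebra hull G)"
    by (rule hull_minimal[where S = subalgebra])
       (auto intro: hull_inc subalgebra_image[OF assms subalgebra_hull])
qed

lemma subalgebra_sum: "subalgebra A \<Longrightarrow> (\<And>i. i \<in> I \<Longrightarrow> f i \<in> A) \<Longrightarrow> sum f I \<in> A"
  by (induction I rule: infinite_finite_induct) (auto intro: subalgebraD)

text \<open>The homomorphism theorem for a surjection, used for \<open>y2\<close>,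
  \<open>sy2\<close> and the tensor product alike. Any preimage may be chosen, because two of them
  differ by an element of the kernel of \<open>p\<close>, which \<open>f\<close> kills.\<close>

lemma quotient_hom_lift:
  assumes p: "algebra_hom p" "surj p" and f: "algebra_hom f" and ker: "\<And>x. p x = 0 \<Longrightarrow> f x = 0"
  obtains h where "algebra_hom h" "\<And>x. h (p x) = f x"
proof -
  define h where "h z = f (inv p z)" for z
  have h: "h (p x) = f x" for x
    using ker[of "inv p (p x) - x"] by (simp add: h_def algebra_homD[OF p(1)] algebra_homD[OF f] surj_f_inv_f[OF p(2)])
  have "algebra_hom h"
    unfolding algebra_hom_def
  proof (intro conjI allI clinearI)
    fix x y c
    obtain a b where ab: "x = p a" "y = p b" using p(2) by (metis surjD)
    show "h (x + y) = h x + h y" using h[of "a + b"] by (simp add: ab h algebra_homD[OF p(1)] algebra_homD[OF f])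
    show "h (x * y) = h x * h y" using h[of "a * b"] by (simp add: ab h algebra_homD[OF p(1)] algebra_homD[OF f])
    show "h (c *\<^sub>C x) = c *\<^sub>C h x" using h[of "c *\<^sub>C a"] by (simp add: ab h algebra_homD[OF p(1)] algebra_homD[OF f])
    show "h 1 = 1" using h[of 1] by (simp add: algebra_homD[OF p(1)] algebra_homD[OF f])
  qed
  with h show ?thesis using that by blast
qed

section \<open>Linear extension, tensor products and free algebras\<close>

definition lin_extend :: "('k \<Rightarrow> 'c::complex_vector) \<Rightarrow> ('k \<Rightarrow>\<^sub>0 complex) \<Rightarrow> 'c" where
  "lin_extend \<beta> p = (\<Sum>k\<in>Poly_Mapping.keys p. Poly_Mapping.lookup p k *\<^sub>C \<beta> k)"

lemma lin_extend_superset: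
  assumes "finite A" "Poly_Mapping.keys p \<subseteq> A"
  shows "lin_extend \<beta> p = (\<Sum>k\<in>A. Poly_Mapping.lookup p k *\<^sub>C \<beta> k)"
  unfolding lin_extend_def using assms
  by (intro sum.mono_neutral_left) (auto simp: in_keys_iff)

lemma lin_extend_clinear: "clinear (lin_extend \<beta>)"
proof (rule clinearI)
  fix p q :: "'a \<Rightarrow>\<^sub>0 complex" and c
  let ?A = "Poly_Mapping.keys p \<union> Poly_Mapping.keys q \<union> Poly_Mapping.keys (p + q) \<union> Poly_Mapping.keys (c *\<^sub>C p)"
  have *: "lin_extend \<beta> r = (\<Sum>k\<in>?A. Poly_Mapping.lookup r k *\<^sub>C \<beta> k)"
    if "Poly_Mapping.keys r \<subseteq> ?A" for r
    using that by (intro lin_extend_superset) auto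
  have "lin_extend \<beta> p = (\<Sum>k\<in>?A. Poly_Mapping.lookup p k *\<^sub>C \<beta> k)"
    "lin_extend \<beta> q = (\<Sum>k\<in>?A. Poly_Mapping.lookup q k *\<^sub>C \<beta> k)"
    "lin_extend \<beta> (p + q) = (\<Sum>k\<in>?A. Poly_Mapping.lookup (p + q) k *\<^sub>C \<beta> k)"
    "lin_extend \<beta> (c *\<^sub>C p) = (\<Sum>k\<in>?A. Poly_Mapping.lookup (c *\<^sub>C p) k *\<^sub>C \<beta> k)"
    by (rule *; blast)+
  then show "lin_extend \<beta> (p + q) = lin_extend \<beta> p + lin_extend \<beta> q"
    "lin_extend \<beta> (c *\<^sub>C p) = c *\<^sub>C lin_extend \<beta> p"
    by (simp_all add: lookup_add scaleC_add_left sum.distrib lookup_scaleC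
        complex_vector.scale_sum_right scaleC_complex_def)
qed

lemma lin_extend_single: "lin_extend \<beta> (Poly_Mapping.single k 1) = \<beta> k"
  by (simp add: lin_extend_def)

lemma lin_extend_hom:
  fixes \<beta> :: "'k::monoid_add \<Rightarrow> 'c::complex_algebra_1"
  assumes "\<beta> 0 = 1" "\<And>k l. \<beta> (k + l) = \<beta> k * \<beta> l"
  shows "algebra_hom (lin_extend \<beta>)"
proof -
  note L = clinear_sum[OF lin_extend_clinear] clinear_scaleC[OF lin_extend_clinear]
  have "lin_extend \<beta> (p * q) = lin_extend \<beta> p * lin_extend \<beta> q" for p q
  proof -
    have "lin_extend \<beta> (p * q) = lin_extend \<beta> ((\<Sum>k\<in>Poly_Mapping.keys p. Poly_Mapping.lookup p k *\<^sub>C Poly_Mapping.single k 1) *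
        (\<Sum>k\<in>Poly_Mapping.keys q. Poly_Mapping.lookup q k *\<^sub>C Poly_Mapping.single k 1))"
      by (simp only: poly_mapping_sum_single[symmetric])
    also have "\<dots> = lin_extend \<beta> p * lin_extend \<beta> q"
      by (simp add: sum_product mult_scaleC_left mult_scaleC_right mult_single L lin_extend_single assms
          lin_extend_def[of \<beta> p] lin_extend_def[of \<beta> q])
    finally show ?thesis .
  qed
  moreover have "lin_extend \<beta> 1 = 1"
    using lin_extend_single[of \<beta> 0] by (simp add: assms)
  ultimately show ?thesis by (simp add: algebra_hom_def lin_extend_clinear)
qed

text \<open>Commutation of the two images makes the linear extension multiplicative on basis pairs;
  bilinearity makes it vanish on the relators.\<close>

lemma tensor_lift:
  fixes f :: "'a::complex_algebra_1 \<Rightarrow> 'c::complex_algebra_1" and g :: "'b::complex_algebra_1 \<Rightarrow> 'c"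
  assumes f: "algebra_hom f" and g: "algebra_hom g" and comm: "\<And>a b. f a * g b = g b * f a"
  obtains h where "algebra_hom h" "\<And>a b. h (a \<otimes>\<^sub>C b) = f a * g b"
proof -
  let ?\<beta> = "\<lambda>a b. f a * g b"
  let ?b = "case_basis_pair ?\<beta>"
  have ext: "pair_extend ?\<beta> = lin_extend ?b"
    by (simp add: fun_eq_iff pair_extend_def lin_extend_def)
  have "cbilinear ?\<beta>"
    by (auto simp: cbilinear_def algebra_homD[OF f] algebra_homD[OF g] distrib_left distrib_right
        mult_scaleC_left mult_scaleC_right intro!: clinearI)
  note rel = pair_extend_relators[OF this, unfolded ext]
  have hom: "algebra_hom (lin_extend ?b)"
  proof (rule lin_extend_hom)
    show "?b 0 = 1" by (simp add: zero_basis_pair_def algebra_homD[OF f] algebra_homD[OF g])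
    show "?b (k + l) = ?b k * ?b l" for k l
    proof (cases k; cases l)
      fix a b a' b' assume "k = Basis_Pair a b" "l = Basis_Pair a' b'"
      moreover have "f a * f a' * (g b * g b') = f a * g b * (f a' * g b')"
        by (metis comm mult.assoc)
      ultimately show ?thesis
        by (simp add: algebra_homD[OF f] algebra_homD[OF g])
    qed
  qed
  have abs: "algebra_hom (abs_tensor :: (('a, 'b) basis_pair \<Rightarrow>\<^sub>0 complex) \<Rightarrow> _)"
    by (auto simp: algebra_hom_def plus_tensor.abs_eq scaleC_tensor.abs_eq one_tensor_def times_tensor.abs_eq
        intro!: clinearI)
  have "surj (abs_tensor :: (('a, 'b) basis_pair \<Rightarrow>\<^sub>0 complex) \<Rightarrow> _)"
    by (metis abs_tensor_cases surjI surj_def)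
  moreover have "lin_extend ?b x = 0" if "abs_tensor x = (0 :: ('a, 'b) tensor)" for x
  proof -
    have "tensor_rel x 0" using that tensor.abs_eq_iff[of x 0] by (simp add: zero_tensor_def)
    then show ?thesis using rel[of x] by (simp add: tensor_rel_def)
  qed
  ultimately obtain h where h: "algebra_hom h" "\<And>x. h (abs_tensor x) = lin_extend ?b x"
    using quotient_hom_lift[OF abs _ hom] by blast
  have "h (a \<otimes>\<^sub>C b) = f a * g b" for a b
    by (simp add: tensor.abs_eq h(2) free_pair_def lin_extend_single)
  with h(1) show ?thesis using that by blast
qed

lemma hull_range_gen: "subalgebra hull range gen = (UNIV :: 'g free_algebra set)"
proof -
  let ?A = "subalgebra hull range (gen :: 'g \<Rightarrow> _)"
  note A = subalgebraD[OF subalgebra_hull[of "range (gen :: 'g \<Rightarrow> _)"]]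
  have w: "Poly_Mapping.single (Word xs) 1 \<in> ?A" for xs :: "'g list"
  proof (induction xs)
    case Nil
    show ?case using A(1) by (simp add: zero_word_def flip: single_one)
  next
    case (Cons x xs)
    have "Poly_Mapping.single (Word (x # xs)) 1 = gen x * Poly_Mapping.single (Word xs) 1"
      by (simp add: gen_def mult_single)
    then show ?case using A(4)[OF hull_inc Cons, of "gen x"] by simp
  qed
  have "p \<in> ?A" for p :: "'g free_algebra"
  proof (subst poly_mapping_sum_single, intro subalgebra_sum[OF subalgebra_hull] A(5))
    fix k :: "'g word"
    show "Poly_Mapping.single k 1 \<in> ?A" using w by (cases k) simp
  qed
  then show ?thesis by blast
qed

lemma free_algebra_lift:
  fixes g :: "'g \<Rightarrow> 'a::complex_algebra_1"
  obtains h where "algebra_hom h" "\<And>x. h (gen x) = g x"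
proof -
  let ?b = "\<lambda>w. case w of Word xs \<Rightarrow> prod_list (map g xs)"
  have "algebra_hom (lin_extend ?b)"
  proof (rule lin_extend_hom)
    show "?b 0 = 1" by (simp add: zero_word_def)
    show "?b (k + l) = ?b k * ?b l" for k l by (cases k; cases l) simp
  qed
  moreover have "lin_extend ?b (gen x) = g x" for x by (simp add: gen_def lin_extend_single)
  ultimately show ?thesis using that by blast
qed

section \<open>Universal properties of Y(2) and SY(2)\<close>

lemma map_R_Y2:
  assumes h: "unital_ring_hom h"
  shows "map_entries (map_coeffs (map_fls h)) R_Y2 = R_Y2"
proof -
  note hs = unital_ring_hom_map_coeffs[OF unital_ring_hom_map_fls[OF h]]
  show ?thesis
    by (simp add: R_Y2_def map_entries_hom[OF hs] map_entries_P_Q[OF hs] map_inverse_u_minus[OF h]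
        map_fls_X_inv[OF h] unital_ring_homD[OF hs])
qed

lemma surj_abs_y2: "surj abs_y2"
  by (metis Quotient3_abs_rep Quotient3_y2 surjI)

lemma surj_abs_sy2: "surj abs_sy2"
  by (metis Quotient3_abs_rep Quotient3_sy2 surjI)

lemma rtt_T_Y2: "rtt_relators R_Y2 T_Y2 \<subseteq> {0}"
proof -
  have "abs_y2 x = 0" if "x \<in> rtt_relators R_Y2 generator_matrix" for x
    unfolding zero_y2_def y2.abs_eq_iff y2_rel_def using that by (simp add: hull_inc)
  then show ?thesis
    unfolding T_Y2_def
    by (auto simp: rtt_relators_map[OF algebra_hom_unital_ring_hom[OF abs_y2_hom] map_R_Y2]
        algebra_hom_unital_ring_hom[OF abs_y2_hom])
qed

lemma rtt_T_SY2: "rtt_relators R_Y2 T_SY2 \<subseteq> {0}"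
  using rtt_T_Y2 algebra_homD(5)[OF abs_sy2_hom] unfolding T_SY2_def
  by (subst rtt_relators_map[OF algebra_hom_unital_ring_hom[OF abs_sy2_hom] map_R_Y2])
     (auto simp: algebra_hom_unital_ring_hom[OF abs_sy2_hom])

text \<open>The homomorphism from the free algebra carries the defining relators to those of
  \<open>T\<close>, by naturality of \<open>rtt_relators\<close>, and hence descends to the
  quotient.\<close>

lemma y2_lift:
  fixes T :: "'a::complex_algebra_1 fps^ix2^ix2"
  assumes 0: "\<And>i j. fps_nth (T $ i $ j) 0 = (if i = j then 1 else 0)" and rtt: "rtt_relators R_Y2 T \<subseteq> {0}"
  obtains h where "algebra_hom h" "map_entries (map_coeffs h) T_Y2 = T"
proof -
  \<comment> \<open>The generator (i, j, r) stands for the coefficient of degree r + 1; degree 0 is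
    matched by assumption \<open>0\<close>.\<close>
  obtain f where f: "algebra_hom f" "\<And>x. f (gen x) = (case x of (i, j, r) \<Rightarrow> fps_nth (T $ i $ j) (Suc r))"
    using free_algebra_lift[of "\<lambda>(i, j, r). fps_nth (T $ i $ j) (Suc r)"] by blast
  have T: "map_entries (map_coeffs f) generator_matrix = T"
    by (auto simp: vec_eq_iff fps_eq_iff generator_matrix_def f(2) 0 algebra_homD[OF f(1)] split: nat.split)
  have "f r = 0" if "r \<in> rtt_relators R_Y2 generator_matrix" for r
    using rtt that rtt_relators_map[OF algebra_hom_unital_ring_hom[OF f(1)] map_R_Y2, of generator_matrix]
    by (auto simp: T algebra_hom_unital_ring_hom[OF f(1)])
  then have "f x = 0" if "abs_y2 x = 0" for x
    using that algebra_hom_ideal_hull_zero[OF f(1), of _ x] y2.abs_eq_iff[of x 0]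
    by (auto simp: zero_y2_def y2_rel_def)
  from quotient_hom_lift[OF abs_y2_hom surj_abs_y2 f(1) this] obtain h
    where h: "algebra_hom h" "\<And>x. h (abs_y2 x) = f x" by blast
  have "map_entries (map_coeffs h) T_Y2 = T"
    unfolding T[symmetric] by (simp add: vec_eq_iff fps_eq_iff T_Y2_def h(2))
  with h(1) show ?thesis using that by blast
qed

lemma qdet_map:
  assumes "algebra_hom h"
  shows "qdet (map_entries (map_coeffs h) T) = map_coeffs h (qdet T)"
  by (simp add: qdet_def subst_affine_map[OF algebra_homD(1)[OF assms]]
      unital_ring_homD[OF unital_ring_hom_map_coeffs[OF algebra_hom_unital_ring_hom[OF assms]]])

lemma qdet_T_SY2: "qdet T_SY2 = 1"
proof -
  have "abs_sy2 (fps_nth (qdet T_Y2 - 1) r) = 0" for r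
    unfolding zero_sy2_def sy2.abs_eq_iff sy2_rel_def by (rule hull_inc) (auto simp del: fps_sub_nth)
  then show ?thesis
    unfolding T_SY2_def qdet_map[OF abs_sy2_hom]
    by (simp add: fps_eq_iff algebra_homD[OF abs_sy2_hom] fps_one_nth split: if_splits)
qed

lemma sy2_lift:
  fixes f :: "y2 \<Rightarrow> 'a::complex_algebra_1"
  assumes f: "algebra_hom f" and 1: "qdet (map_entries (map_coeffs f) T_Y2) = 1"
  obtains h where "algebra_hom h" "\<And>x. h (abs_sy2 x) = f x"
proof -
  have 0: "f r = 0" if "r \<in> {fps_nth (qdet T_Y2 - 1) r | r. True}" for r
    using 1 that unfolding qdet_map[OF f] by (auto simp: fps_eq_iff algebra_homD[OF f] fps_one_nth)
  have "f x = 0" if "abs_sy2 x = 0" for x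
  proof (rule algebra_hom_ideal_hull_zero[OF f 0])
    show "x \<in> two_sided_ideal hull {fps_nth (qdet T_Y2 - 1) r | r. True}"
      using that sy2.abs_eq_iff[of x 0] by (simp add: zero_sy2_def sy2_rel_def del: fps_sub_nth)
  qed
  from quotient_hom_lift[OF abs_sy2_hom surj_abs_sy2 f this] that show ?thesis by blast
qed

lemma hull_T_Y2: "subalgebra hull coefficients T_Y2 = UNIV"
proof -
  have "gen x \<in> coefficients generator_matrix" for x :: "ix2 \<times> ix2 \<times> nat"
  proof (cases x)
    case (fields i j r)
    then have "gen x = fps_nth (generator_matrix $ i $ j) (Suc r)" by (simp add: generator_matrix_def)
    then show ?thesis unfolding coefficients_def by blast
  qed
  then have "subalgebra hull coefficients generator_matrix = (UNIV :: y2_free set)"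
    using hull_range_gen hull_mono[of "range gen" "coefficients generator_matrix" subalgebra] by blast
  then show ?thesis
    unfolding T_Y2_def coefficients_map image_hull[OF abs_y2_hom, symmetric] by (simp add: surj_abs_y2)
qed

section \<open>Consequences of the RTT relation\<close>

definition commutator :: "'a::ring_1 \<Rightarrow> 'a \<Rightarrow> 'a" where
  "commutator x y = x * y - y * x"

lemma commutator_simps:
  "commutator x (y * z) = commutator x y * z + y * commutator x z"
  "commutator x (y + z) = commutator x y + commutator x z"
  "commutator x (y - z) = commutator x y - commutator x z"
  "commutator x (- y) = - commutator x y"
  "commutator x 0 = 0" "commutator x 1 = 0" "commutator 0 x = 0" "commutator 1 x = 0"
  by (simp_all add: commutator_def algebra_simps)

lemma commutator_sum: "commutator x (sum f I) = (\<Sum>i\<in>I. commutator x (f i))"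
  by (induction I rule: infinite_finite_induct) (simp_all add: commutator_simps)

text \<open>The coefficients may have zero divisors, but multiplication by \<open>fps_X\<close>
  merely shifts them and can be cancelled.\<close>

lemma fps_X_mult_cancel:
  fixes F G :: "'a::ring_1 fps"
  assumes "fps_X * F = fps_X * G"
  shows "F = G"
proof (rule fps_ext)
  fix n
  have "fps_nth (fps_X * F) (Suc n) = fps_nth (fps_X * G) (Suc n)" by (simp only: assms)
  then show "fps_nth F n = fps_nth G n" by simp
qed

lemma matrix_P_nth: "(matrix_P :: 'a::ring_1^('n::finite \<times> 'n)^('n \<times> 'n)) $ p $ q = (if prod.swap p = q then 1 else 0)"
proof -
  obtain i k j l where pq: "p = (i, k)" "q = (j, l)" by (cases p; cases q)
  have "(matrix_P :: 'a^('n::finite \<times> 'n)^('n \<times> 'n)) $ p $ q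
      = (\<Sum>a\<in>UNIV. \<Sum>b\<in>UNIV. if a = i then if b = j then if k = j \<and> l = i then 1 else 0 else 0 else 0)"
    unfolding matrix_P_def sum_component pq
    by (intro sum.cong refl) (auto simp: kron_def matrix_unit_def)
  also have "\<dots> = (\<Sum>a\<in>UNIV. if a = i then (if k = j \<and> l = i then 1 else 0) else 0)"
    by (rule sum.cong) auto
  also have "\<dots> = (if prod.swap p = q then 1 else 0)"
    by (auto simp: pq)
  finally show ?thesis .
qed

lemma matrix_P_mult:
  fixes M :: "'a::ring_1^('n::finite \<times> 'n)^('n \<times> 'n)"
  shows "(matrix_P ** M) $ p $ q = M $ prod.swap p $ q" "(M ** matrix_P) $ p $ q = M $ p $ prod.swap q"
proof -
  have "(matrix_P ** M) $ p $ q = (\<Sum>r\<in>UNIV. if prod.swap p = r then M $ r $ q else 0)"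
    unfolding matrix_matrix_mult_def matrix_P_nth vec_lambda_beta by (rule sum.cong) auto
  then show "(matrix_P ** M) $ p $ q = M $ prod.swap p $ q" by simp
  have "(M ** matrix_P) $ p $ q = (\<Sum>r\<in>UNIV. if prod.swap q = r then M $ p $ r else 0)"
    unfolding matrix_matrix_mult_def matrix_P_nth vec_lambda_beta by (rule sum.cong) (cases q; auto)+
  then show "(M ** matrix_P) $ p $ q = M $ p $ prod.swap q" by simp
qed

lemma kron_mat_1_mult:
  fixes A B :: "'a::ring_1^'n::finite^'n"
  shows "(kron A (mat 1) ** kron (mat 1) B) $ (i, k) $ (j, l) = A $ i $ j * B $ k $ l"
    "(kron (mat 1) B ** kron A (mat 1)) $ (i, k) $ (j, l) = B $ k $ l * A $ i $ j"
proof -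
  have "(kron A (mat 1) ** kron (mat 1) B) $ (i, k) $ (j, l)
      = (\<Sum>r\<in>UNIV. if r = (j, k) then A $ i $ j * B $ k $ l else 0)"
    unfolding matrix_matrix_mult_def kron_def mat_def vec_lambda_beta by (rule sum.cong) auto
  then show "(kron A (mat 1) ** kron (mat 1) B) $ (i, k) $ (j, l) = A $ i $ j * B $ k $ l" by simp
  have "(kron (mat 1) B ** kron A (mat 1)) $ (i, k) $ (j, l)
      = (\<Sum>r\<in>UNIV. if r = (i, l) then B $ k $ l * A $ i $ j else 0)"
    unfolding matrix_matrix_mult_def kron_def mat_def vec_lambda_beta by (rule sum.cong) auto
  then show "(kron (mat 1) B ** kron A (mat 1)) $ (i, k) $ (j, l) = B $ k $ l * A $ i $ j" by simp
qed

lemma mat_mult_nth: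
  fixes M :: "'a::ring_1^'m^'n"
  shows "(mat c ** M) $ p $ q = c * M $ p $ q"
proof -
  have "(mat c ** M) $ p $ q = (\<Sum>r\<in>UNIV. if r = p then c * M $ r $ q else 0)"
    unfolding matrix_matrix_mult_def mat_def vec_lambda_beta by (rule sum.cong) auto
  then show ?thesis by simp
qed

text \<open>Stronger than \<open>F * G = G * F\<close>: it persists when different arguments are
  substituted into the two series.\<close>

definition coeffs_commute :: "'a::ring_1 fps \<Rightarrow> 'a fps \<Rightarrow> bool" where
  "coeffs_commute F G \<longleftrightarrow> (\<forall>r s. fps_nth F r * fps_nth G s = fps_nth G s * fps_nth F r)"

lemma coeffs_commute_mult:
  assumes "coeffs_commute F G"
  shows "F * G = G * F"
proof (rule fps_ext)
  fix n
  have "fps_nth (F * G) n = (\<Sum>i=0..n. fps_nth G (n - i) * fps_nth F i)"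
    using assms by (simp add: fps_mult_nth coeffs_commute_def)
  also have "\<dots> = (\<Sum>i=0..n. fps_nth G i * fps_nth F (n - i))"
    by (subst sum.atLeastAtMost_rev) simp
  finally show "fps_nth (F * G) n = fps_nth (G * F) n" by (simp add: fps_mult_nth)
qed

text \<open>The coefficients are powers of v, which commute with all Laurent series in
  v^(-1).\<close>

lemma inverse_u_minus_commute:
  fixes F :: "'a::ring_1 series2"
  shows "inverse_u_minus fls_X_inv * F = F * inverse_u_minus fls_X_inv"
proof -
  have "fls_X_inv ^ k * f = f * fls_X_inv ^ k" for k and f :: "'a fls"
  proof (induction k)
    case (Suc k)
    have "fls_X_inv ^ Suc k * f = fls_X_inv * (f * fls_X_inv ^ k)" using Suc by (simp add: mult.assoc)
    also have "\<dots> = f * fls_X_inv ^ Suc k" by (metis fls_X_inv_times_comm mult.assoc power_Suc)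
    finally show ?case .
  qed simp
  then have "fps_nth (inverse_u_minus fls_X_inv) n * f = f * fps_nth (inverse_u_minus fls_X_inv) n" for n and f :: "'a fls"
    by (auto simp: inverse_u_minus_def split: nat.split)
  then show ?thesis by (intro coeffs_commute_mult) (simp add: coeffs_commute_def)
qed

text \<open>This is (u - w)^(-1) = u^(-1) (1 + w (u - w)^(-1)), a form that clears the denominator
  without positive powers of u.\<close>

lemma inverse_u_minus_unfold: "inverse_u_minus w = fps_X * (1 + fps_const w * inverse_u_minus w)"
  by (rule fps_ext) (auto simp: inverse_u_minus_def fps_one_nth gr0_conv_Suc split: nat.split)

text \<open>Multiplication by P swaps the row pair from the left and the column pair from the right;
  the factor (u - v)^(-1) may stand on the left in both cases.\<close>

lemma R_Y2_mult:
  "(R_Y2 ** M) $ p $ q = M $ p $ q - inverse_u_minus fls_X_inv * M $ prod.swap p $ q"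
  "(M ** R_Y2) $ p $ q = M $ p $ q - inverse_u_minus fls_X_inv * M $ p $ prod.swap q"
proof -
  have R: "R_Y2 $ p $ q = mat 1 $ p $ q - inverse_u_minus fls_X_inv * matrix_P $ p $ q" for p q
    by (simp add: R_Y2_def mat_mult_nth)
  have "(R_Y2 ** M) $ p $ q = (mat 1 ** M) $ p $ q - inverse_u_minus fls_X_inv * (matrix_P ** M) $ p $ q"
    by (simp add: matrix_matrix_mult_def R left_diff_distrib sum_subtractf sum_distrib_left mult.assoc)
  then show "(R_Y2 ** M) $ p $ q = M $ p $ q - inverse_u_minus fls_X_inv * M $ prod.swap p $ q"
    by (simp add: matrix_P_mult)
  have "(M ** R_Y2) $ p $ q = (M ** mat 1) $ p $ q - inverse_u_minus fls_X_inv * (M ** matrix_P) $ p $ q"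
    by (simp add: matrix_matrix_mult_def R right_diff_distrib sum_subtractf inverse_u_minus_commute
        sum_distrib_right mult.assoc)
  then show "(M ** R_Y2) $ p $ q = M $ p $ q - inverse_u_minus fls_X_inv * M $ p $ prod.swap q"
    by (simp add: matrix_P_mult)
qed

text \<open>Entry ((i, k), (j, l)) of the matrix relation: both matrix products reduce to products
  of single entries, and P exchanges i with k or j with l.\<close>

lemma rtt_iff:
  fixes T :: "'a::ring_1 fps^ix2^ix2"
  shows "rtt_relators R_Y2 T \<subseteq> {0} \<longleftrightarrow> (\<forall>i j k l.
    commutator (at_u (T $ i $ j)) (at_v (T $ k $ l)) =
    inverse_u_minus fls_X_inv * (at_u (T $ k $ j) * at_v (T $ i $ l) - at_v (T $ k $ j) * at_u (T $ i $ l)))"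
proof -
  let ?T1 = "kron (map_entries at_u T) (mat 1)" and ?T2 = "kron (mat 1) (map_entries at_v T)"
  let ?D = "R_Y2 ** ?T1 ** ?T2 - ?T2 ** ?T1 ** R_Y2"
  have "?D $ (i, k) $ (j, l) = commutator (at_u (T $ i $ j)) (at_v (T $ k $ l)) -
    inverse_u_minus fls_X_inv * (at_u (T $ k $ j) * at_v (T $ i $ l) - at_v (T $ k $ j) * at_u (T $ i $ l))" for i j k l
    unfolding matrix_mul_assoc[symmetric] vector_minus_component R_Y2_mult(1)
    unfolding matrix_mul_assoc vector_minus_component R_Y2_mult(2)
    by (simp add: kron_mat_1_mult commutator_def algebra_simps)
  moreover have "rtt_relators R_Y2 T \<subseteq> {0} \<longleftrightarrow> (\<forall>i j k l. ?D $ (i, k) $ (j, l) = 0)"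
  proof -
    have "rtt_relators R_Y2 T = {fls_nth (fps_nth (?D $ p $ q) r) s | p q r s. True}"
      by (simp add: rtt_relators_def Let_def)
    also have "\<dots> \<subseteq> {0} \<longleftrightarrow> (\<forall>p q r s. fls_nth (fps_nth (?D $ p $ q) r) s = 0)"
      by blast
    also have "\<dots> \<longleftrightarrow> (\<forall>i j k l. ?D $ (i, k) $ (j, l) = 0)"
      by (simp only: split_paired_All fps_eq_iff fls_eq_iff fps_zero_nth fls_zero_nth) blast
    finally show ?thesis .
  qed
  ultimately show ?thesis by simp
qed

text \<open>Obtained by multiplying the entrywise relation by u - v and comparing the coefficients
  of u^(-r) v^(-s).\<close>

lemma rtt_coefficients:
  assumes "rtt_relators R_Y2 T \<subseteq> {0}"
  shows "commutator (fps_nth (T $ i $ j) (Suc r)) (fps_nth (T $ k $ l) s)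
      - commutator (fps_nth (T $ i $ j) r) (fps_nth (T $ k $ l) (Suc s))
    = fps_nth (T $ k $ j) r * fps_nth (T $ i $ l) s - fps_nth (T $ k $ j) s * fps_nth (T $ i $ l) r"
proof -
  let ?M = "at_u (T $ k $ j) * at_v (T $ i $ l) - at_v (T $ k $ j) * at_u (T $ i $ l)"
  let ?C = "commutator (at_u (T $ i $ j)) (at_v (T $ k $ l))"
  have C: "?C = inverse_u_minus fls_X_inv * ?M" using assms by (simp add: rtt_iff)
  also have "\<dots> = fps_X * (?M + fps_const fls_X_inv * (inverse_u_minus fls_X_inv * ?M))"
    by (subst inverse_u_minus_unfold) (simp add: algebra_simps)
  \<comment> \<open>This fixed point equation, read in degree r + 1, replaces multiplication by u -
    v among series that contain no positive powers of u.\<close>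
  finally have "?C = fps_X * (?M + fps_const fls_X_inv * ?C)" by (simp add: C)
  then have "fps_nth ?C (Suc r) = fps_nth (fps_X * (?M + fps_const fls_X_inv * ?C)) (Suc r)" by simp
  then have "fps_nth ?C (Suc r) - fls_X_inv * fps_nth ?C r = fps_nth ?M r" by simp
  then have "fls_nth (fps_nth ?C (Suc r) - fls_X_inv * fps_nth ?C r) (int s) = fls_nth (fps_nth ?M r) (int s)" by simp
  moreover have "nat (int s + 1) = Suc s" by simp
  ultimately show ?thesis
    by (simp add: commutator_def at_u_def at_v_def fls_X_inv_times_conv_shift(1) algebra_simps)
qed


text \<open>\<open>double_subst p q c\<close> is the value of \<open>\<Sum>r s. c r s u\<^sup>-\<^sup>r v\<^sup>-\<^sup>s\<close> at \<open>u\<^sup>-\<^sup>1 = p\<close>, \<open>v\<^sup>-\<^sup>1 = q\<close>.\<close>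

definition double_subst :: "complex fps \<Rightarrow> complex fps \<Rightarrow> (nat \<Rightarrow> nat \<Rightarrow> 'a::complex_vector) \<Rightarrow> 'a fps" where
  "double_subst p q c = Abs_fps (\<lambda>n. \<Sum>r\<le>n. \<Sum>s\<le>n. fps_nth (p ^ r * q ^ s) n *\<^sub>C c r s)"

text \<open>Carries complex series into series over the algebra, so that denominators can be handled
  among commuting scalar series first.\<close>

definition scalar_series :: "complex fps \<Rightarrow> 'a::complex_algebra_1 fps" where
  "scalar_series = map_coeffs (\<lambda>c. c *\<^sub>C 1)"

lemma scalar_series_hom: "unital_ring_hom (scalar_series :: complex fps \<Rightarrow> 'a::complex_algebra_1 fps)"
  unfolding scalar_series_def
  by (rule unital_ring_hom_map_coeffs) (simp add: unital_ring_hom_def scaleC_add_left mult_scaleC_left)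

lemma scalar_series_simps:
  "scalar_series fps_X = fps_X" "scalar_series (fps_const c) = fps_const (c *\<^sub>C 1)"
  by (auto simp: scalar_series_def fps_eq_iff)

lemma double_subst_nth:
  assumes "fps_nth p 0 = 0" "fps_nth q 0 = 0" "n \<le> N" "n \<le> M"
  shows "fps_nth (double_subst p q c) n = (\<Sum>r\<le>N. \<Sum>s\<le>M. fps_nth (p ^ r * q ^ s) n *\<^sub>C c r s)"
proof -
  have 0: "fps_nth (p ^ r * q ^ s) n = 0" if "n < r \<or> n < s" for r s
  proof -
    have "fps_nth (p ^ r) i * fps_nth (q ^ s) (n - i) = 0" if "i \<le> n" for i
      using \<open>n < r \<or> n < s\<close> startsby_zero_power_prefix[OF assms(1), of r] startsby_zero_power_prefix[OF assms(2), of s] that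
      by auto
    then show ?thesis unfolding fps_mult_nth by (intro sum.neutral) auto
  qed
  have "fps_nth (double_subst p q c) n = (\<Sum>(r, s)\<in>{..n} \<times> {..n}. fps_nth (p ^ r * q ^ s) n *\<^sub>C c r s)"
    by (simp add: double_subst_def sum.cartesian_product)
  also have "\<dots> = (\<Sum>(r, s)\<in>{..N} \<times> {..M}. fps_nth (p ^ r * q ^ s) n *\<^sub>C c r s)"
    using assms(3,4) by (intro sum.mono_neutral_left) (auto, (metis 0 not_le)+)
  finally show ?thesis by (simp add: sum.cartesian_product)
qed

lemma double_subst_diff: "double_subst p q (\<lambda>r s. c r s - d r s) = double_subst p q c - double_subst p q d"
  by (rule fps_ext) (simp add: double_subst_def complex_vector.scale_right_diff_distrib sum_subtractf)

lemma double_subst_flip: "double_subst p q (\<lambda>r s. c s r) = double_subst q p c"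
  by (rule fps_ext) (simp add: double_subst_def mult.commute[of "p ^ _"], rule sum.swap)

text \<open>Multiplication by \<open>p\<close> raises the first index by one; the summands with r =
  0, which are not reached, vanish by assumption \<open>c\<close>.\<close>

lemma double_subst_Suc:
  fixes c :: "nat \<Rightarrow> nat \<Rightarrow> 'a::complex_algebra_1"
  assumes "fps_nth p 0 = 0" "fps_nth q 0 = 0" and c: "\<And>s. c 0 s = 0"
  shows "scalar_series p * double_subst p q (\<lambda>r. c (Suc r)) = double_subst p q c"
proof (rule fps_ext)
  fix n
  have "fps_nth (scalar_series p * double_subst p q (\<lambda>r. c (Suc r))) n =
    (\<Sum>m=0..n. fps_nth p m *\<^sub>C (\<Sum>r\<le>n. \<Sum>s\<le>n. fps_nth (p ^ r * q ^ s) (n - m) *\<^sub>C c (Suc r) s))"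
    unfolding fps_mult_nth[of "scalar_series p"]
    by (intro sum.cong refl) (simp add: scalar_series_def mult_scaleC_left double_subst_nth[OF assms(1,2), of _ n n])
  also have "\<dots> = (\<Sum>m=0..n. \<Sum>r\<le>n. \<Sum>s\<le>n. (fps_nth p m * fps_nth (p ^ r * q ^ s) (n - m)) *\<^sub>C c (Suc r) s)"
    by (simp add: complex_vector.scale_sum_right)
  also have "\<dots> = (\<Sum>r\<le>n. \<Sum>s\<le>n. \<Sum>m=0..n. (fps_nth p m * fps_nth (p ^ r * q ^ s) (n - m)) *\<^sub>C c (Suc r) s)"
    by (rule trans[OF sum.swap], rule sum.cong[OF refl], rule sum.swap)
  also have "\<dots> = (\<Sum>r\<le>n. \<Sum>s\<le>n. fps_nth (p * (p ^ r * q ^ s)) n *\<^sub>C c (Suc r) s)"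
    by (simp only: fps_mult_nth[of p] complex_vector.scale_sum_left)
  also have "\<dots> = (\<Sum>r\<le>Suc n. \<Sum>s\<le>n. fps_nth (p ^ r * q ^ s) n *\<^sub>C c r s)"
    unfolding sum.atMost_Suc_shift by (simp add: c complex_vector.scale_zero_right mult.assoc)
  also have "\<dots> = fps_nth (double_subst p q c) n"
    by (rule double_subst_nth[OF assms(1,2), symmetric]) auto
  finally show "fps_nth (scalar_series p * double_subst p q (\<lambda>r. c (Suc r))) n = fps_nth (double_subst p q c) n" .
qed

lemma double_subst_mult:
  fixes F G :: "'a::complex_algebra_1 fps"
  shows "double_subst (affine_kernel a b) (affine_kernel c d) (\<lambda>r s. fps_nth F r * fps_nth G s)
    = subst_affine a b F * subst_affine c d G"
proof (rule fps_ext)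
  fix n
  let ?p = "affine_kernel a b" and ?q = "affine_kernel c d"
  have "fps_nth (subst_affine a b F * subst_affine c d G) n =
    (\<Sum>m\<le>n. (\<Sum>i\<le>n. fps_nth (?p ^ i) m *\<^sub>C fps_nth F i) * (\<Sum>j\<le>n. fps_nth (?q ^ j) (n - m) *\<^sub>C fps_nth G j))"
    unfolding fps_mult_nth atLeast0AtMost
    by (intro sum.cong refl arg_cong2[of _ _ _ _ "(*)"] subst_affine_nth) auto
  also have "\<dots> = (\<Sum>m\<le>n. \<Sum>i\<le>n. \<Sum>j\<le>n. (fps_nth (?p ^ i) m * fps_nth (?q ^ j) (n - m)) *\<^sub>C (fps_nth F i * fps_nth G j))"
    unfolding sum_product by (simp add: mult_scaleC_left mult_scaleC_right mult.commute)
  also have "\<dots> = (\<Sum>i\<le>n. \<Sum>j\<le>n. \<Sum>m\<le>n. (fps_nth (?p ^ i) m * fps_nth (?q ^ j) (n - m)) *\<^sub>C (fps_nth F i * fps_nth G j))"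
    by (rule trans[OF sum.swap], rule sum.cong[OF refl], rule sum.swap)
  also have "\<dots> = fps_nth (double_subst ?p ?q (\<lambda>r s. fps_nth F r * fps_nth G s)) n"
    by (simp add: double_subst_def fps_mult_nth atLeast0AtMost complex_vector.scale_sum_left)
  finally show "fps_nth (double_subst ?p ?q (\<lambda>r s. fps_nth F r * fps_nth G s)) n
    = fps_nth (subst_affine a b F * subst_affine c d G) n" ..
qed

lemma double_subst_mult_flip:
  fixes F G :: "'a::complex_algebra_1 fps"
  shows "double_subst (affine_kernel a b) (affine_kernel c d) (\<lambda>r s. fps_nth F s * fps_nth G r)
    = subst_affine c d F * subst_affine a b G"
  by (subst double_subst_flip[symmetric]) (rule double_subst_mult)

text \<open>Collects what the generating matrices of Y(2) and SY(2) have in common, so that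
  consequences of the RTT relation are derived once for both.\<close>

locale yangian_matrix =
  fixes T :: "'a::complex_algebra_1 fps^ix2^ix2"
  assumes rtt: "rtt_relators R_Y2 T \<subseteq> {0}"
    and nth_0: "fps_nth (T $ i $ j) 0 = (if i = j then 1 else 0)"
begin

text \<open>The RTT relation along the line \<open>u = a w + b\<close>, \<open>v = c w + d\<close>, where \<open>u - v = (a - c) w + (b - d)\<close>.\<close>

lemma rtt_on_line:
  assumes "a \<noteq> 0" "c \<noteq> 0"
  shows "scalar_series (fps_const (a - c) + fps_const (b - d) * fps_X) *
      commutator (subst_affine a b (T $ i $ j)) (subst_affine c d (T $ k $ l))
    = fps_X * (subst_affine a b (T $ k $ j) * subst_affine c d (T $ i $ l)
        - subst_affine c d (T $ k $ j) * subst_affine a b (T $ i $ l))"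
proof -
  let ?p = "affine_kernel a b" and ?q = "affine_kernel c d"
  let ?A = "fps_const a + fps_const b * fps_X :: complex fps" and ?C = "fps_const c + fps_const d * fps_X :: complex fps"
  let ?t = "\<lambda>i j. fps_nth (T $ i $ j)"
  note S = unital_ring_homD[OF scalar_series_hom]
  define x where "x r s = commutator (?t i j r) (?t k l s)" for r s
  define m where "m r s = ?t k j r * ?t i l s - ?t k j s * ?t i l r" for r s
  have pq: "fps_nth ?p 0 = 0" "fps_nth ?q 0 = 0" by (simp_all add: affine_kernel_def)
  have m: "m = (\<lambda>r s. x (Suc r) s - x r (Suc s))"
    by (simp add: fun_eq_iff m_def x_def rtt_coefficients[OF rtt])
  have x0: "x 0 s = 0" "x r 0 = 0" for r s
    by (simp_all add: x_def nth_0 commutator_simps)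
  have flip: "double_subst ?p ?q f = double_subst ?q ?p (\<lambda>s r. f r s)" for f :: "nat \<Rightarrow> nat \<Rightarrow> 'a"
    by (rule double_subst_flip[symmetric])
  have 1: "scalar_series ?p * double_subst ?p ?q (\<lambda>r s. x (Suc r) s) = double_subst ?p ?q x"
    using double_subst_Suc[OF pq, of x] x0(1) by simp
  have 2: "scalar_series ?q * double_subst ?p ?q (\<lambda>r s. x r (Suc s)) = double_subst ?p ?q x"
    using double_subst_Suc[OF pq(2,1), of "\<lambda>s r. x r s"] x0(2) unfolding flip by simp
  \<comment> \<open>With u^(-1) = \<open>?p\<close> and v^(-1) = \<open>?q\<close>, this applies
    u^(-1) v^(-1) (u - v) = v^(-1) - u^(-1) to the commutator.\<close>
  have "scalar_series (?p * ?q) * double_subst ?p ?q m =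
      scalar_series (?q * ?p) * double_subst ?p ?q (\<lambda>r s. x (Suc r) s)
      - scalar_series (?p * ?q) * double_subst ?p ?q (\<lambda>r s. x r (Suc s))"
    unfolding m double_subst_diff by (simp add: right_diff_distrib mult.commute)
  also have "\<dots> = (scalar_series ?q - scalar_series ?p) * double_subst ?p ?q x"
    by (simp add: S mult.assoc 1 2 left_diff_distrib)
  finally have 3: "scalar_series (?p * ?q) * double_subst ?p ?q m = scalar_series (?q - ?p) * double_subst ?p ?q x"
    by (simp add: S)
  \<comment> \<open>\<open>?A\<close> and \<open>?C\<close> are u and v divided by w, so multiplying
    by both clears the denominators and leaves a common factor \<open>fps_X\<close> to
    cancel.\<close>
  have "?A * ?C * (?p * ?q) = (?p * ?A) * (?q * ?C)" by (simp only: mult_ac)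
  then have 4: "?A * ?C * (?p * ?q) = fps_X * fps_X" by (simp only: affine_kernel_mult[OF assms(1)] affine_kernel_mult[OF assms(2)])
  have "A * C * (q - p) = A * (q * C) - (p * A) * C" for A C p q :: "complex fps"
    by (simp add: algebra_simps)
  from this[of ?A ?C ?q ?p]
  have 5: "?A * ?C * (?q - ?p) = fps_X * (fps_const (a - c) + fps_const (b - d) * fps_X)"
    by (simp only: affine_kernel_mult[OF assms(1)] affine_kernel_mult[OF assms(2)]) (simp add: algebra_simps flip: fps_const_sub)
  have "scalar_series (?A * ?C * (?p * ?q)) * double_subst ?p ?q m = scalar_series (?A * ?C * (?q - ?p)) * double_subst ?p ?q x"
    using arg_cong[OF 3, of "\<lambda>F. scalar_series (?A * ?C) * F"] by (simp only: S(3) mult.assoc)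
  then have "fps_X * (fps_X * double_subst ?p ?q m) =
      fps_X * (scalar_series (fps_const (a - c) + fps_const (b - d) * fps_X) * double_subst ?p ?q x)"
    unfolding 4 5 by (simp only: S(3) scalar_series_simps mult.assoc)
  then have "fps_X * double_subst ?p ?q m =
      scalar_series (fps_const (a - c) + fps_const (b - d) * fps_X) * double_subst ?p ?q x"
    by (rule fps_X_mult_cancel)
  moreover have "double_subst ?p ?q m = subst_affine a b (T $ k $ j) * subst_affine c d (T $ i $ l)
        - subst_affine c d (T $ k $ j) * subst_affine a b (T $ i $ l)"
    unfolding m_def double_subst_diff double_subst_mult double_subst_mult_flip ..
  moreover have "double_subst ?p ?q x = commutator (subst_affine a b (T $ i $ j)) (subst_affine c d (T $ k $ l))"
    unfolding x_def commutator_def double_subst_diff double_subst_mult double_subst_mult_flip ..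
  ultimately show ?thesis by simp
qed

end

section \<open>The adjugate matrix and centrality of the quantum determinant\<close>

lemma UNIV_ix2: "UNIV = {I_m1, I_p1}"
  using ix2.exhaust by blast

lemma sum_ix2: "(\<Sum>i\<in>UNIV. f i) = f I_m1 + f I_p1"
  by (simp add: UNIV_ix2)

lemma all_ix2: "(\<forall>i. P i) \<longleftrightarrow> P I_m1 \<and> P I_p1"
  by (metis ix2.exhaust)

lemma minus_ix2_simps: "- (- i) = i" "- i \<noteq> i" "i \<noteq> - i" for i :: ix2
  by (cases i; simp)+

lemma subst_affine_1_m1_X: "subst_affine 1 (-1) (fps_X :: 'a::complex_algebra_1 fps) * (1 - fps_X) = fps_X"
proof -
  have "fps_const (- 1 :: 'a) * fps_X = - fps_X" by (rule fps_ext) simp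
  then show ?thesis using subst_affine_X[of 1 "-1", where 'a = 'a] by (simp add: complex_vector.scale_minus_left)
qed

text \<open>In the notation of the paper, this is \<open>K T\<^sup>t K\<close>.\<close>

definition adjugate :: "'a::ring_1^ix2^ix2 \<Rightarrow> 'a^ix2^ix2" where
  "adjugate T = (\<chi> i j. if i = j then T $ (- j) $ (- i) else - T $ (- j) $ (- i))"

context yangian_matrix
begin

abbreviation shifted :: "'a fps^ix2^ix2" where
  "shifted \<equiv> map_entries (subst_affine 1 (-1)) T"

text \<open>On the line v = u - 1 the difference u - v equals 1, so the denominator disappears from
  the RTT relation.\<close>

lemma rtt_shifted:
  "commutator (T $ i $ j) (shifted $ k $ l) = T $ k $ j * shifted $ i $ l - shifted $ k $ j * T $ i $ l"
proof (rule fps_X_mult_cancel)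
  show "fps_X * commutator (T $ i $ j) (shifted $ k $ l) =
    fps_X * (T $ k $ j * shifted $ i $ l - shifted $ k $ j * T $ i $ l)"
    using rtt_on_line[of 1 1 0 "-1" i j k l]
    by (simp add: subst_affine_id scalar_series_simps unital_ring_homD[OF scalar_series_hom])
qed

text \<open>At u - v = 1 the R-matrix is the antisymmetrizer I - P. In coordinates, instances of
  \<open>rtt_shifted\<close> annihilate the off-diagonal entries and identify the diagonal
  ones.\<close>

lemma shifted_adjugate: "shifted ** adjugate T = mat (qdet T)" "adjugate T ** shifted = mat (qdet T)"
proof -
  note r = rtt_shifted[unfolded commutator_def nth_map_entries]
  have chain: "t - v = y - w" if "x - y = z - w" "z - v = x - t" for t v w x y z :: "'a fps"
  proof -
    have "x - z = y - w" using that(1) by (simp add: algebra_simps)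
    moreover have "t - v = x - z" using that(2) by (simp add: algebra_simps)
    ultimately show ?thesis by simp
  qed
  \<comment> \<open>Two instances together eliminate the products with \<open>T\<close> on the left
    and equate the two diagonal entries of the first matrix product.\<close>
  note d = chain[OF r[of I_p1 I_p1 I_m1 I_m1] r[of I_m1 I_p1 I_p1 I_m1]]
  \<comment> \<open>One more instance carries a diagonal entry of the opposite product to a side of
    \<open>d\<close>.\<close>
  have d': "T $ I_m1 $ I_m1 * shifted $ I_p1 $ I_p1 - T $ I_p1 $ I_m1 * shifted $ I_m1 $ I_p1 =
    shifted $ I_p1 $ I_p1 * T $ I_m1 $ I_m1 - shifted $ I_p1 $ I_m1 * T $ I_m1 $ I_p1"
    using r[of I_m1 I_m1 I_p1 I_p1] by (simp add: algebra_simps)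
  show "shifted ** adjugate T = mat (qdet T)"
    unfolding vec_eq_iff all_ix2
    using r[of I_m1 I_p1 I_m1 I_m1] r[of I_p1 I_p1 I_p1 I_m1] d
    by (simp add: matrix_matrix_mult_def sum_ix2 adjugate_def mat_def qdet_def)
  show "adjugate T ** shifted = mat (qdet T)"
    unfolding vec_eq_iff all_ix2
    using r[of I_p1 I_p1 I_m1 I_p1] r[of I_p1 I_m1 I_m1 I_m1] r[of I_p1 I_p1 I_m1 I_m1] d'[simplified, unfolded d]
    by (simp add: matrix_matrix_mult_def sum_ix2 adjugate_def mat_def qdet_def) (simp add: algebra_simps)
qed

text \<open>With a single coefficient as a constant series, its commutation relations become series
  identities in the variable of the other entry.\<close>

abbreviation const_entry :: "nat \<Rightarrow> ix2 \<Rightarrow> ix2 \<Rightarrow> 'a fps" where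
  "const_entry r i j \<equiv> fps_const (fps_nth (T $ i $ j) r)"

text \<open>Summation of \<open>rtt_coefficients\<close> over s; the factor \<open>fps_X\<close>
  absorbs the shift from s + 1 to s.\<close>

lemma rtt_const_entry:
  "fps_X * commutator (const_entry (Suc r) i j) (T $ k $ l) =
    commutator (const_entry r i j) (T $ k $ l) + fps_X * (const_entry r k j * T $ i $ l - T $ k $ j * const_entry r i l)"
proof (rule fps_ext)
  fix n
  show "fps_nth (fps_X * commutator (const_entry (Suc r) i j) (T $ k $ l)) n =
    fps_nth (commutator (const_entry r i j) (T $ k $ l) + fps_X * (const_entry r k j * T $ i $ l - T $ k $ j * const_entry r i l)) n"
  proof (cases n)
    case 0
    then show ?thesis by (simp add: commutator_def nth_0)
  next
    case (Suc s)
    then show ?thesis using rtt_coefficients[OF rtt, of i j r k l s]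
      by (simp add: commutator_def algebra_simps)
  qed
qed

text \<open>Exchanging the two entries in \<open>rtt_coefficients\<close> reverses the products on
  the right, which is the form that suits the adjugate.\<close>

lemma rtt_const_entry':
  "fps_X * commutator (const_entry (Suc r) i j) (T $ k $ l) =
    commutator (const_entry r i j) (T $ k $ l) + fps_X * (T $ i $ l * const_entry r k j - const_entry r i l * T $ k $ j)"
proof (rule fps_ext)
  fix n
  show "fps_nth (fps_X * commutator (const_entry (Suc r) i j) (T $ k $ l)) n =
    fps_nth (commutator (const_entry r i j) (T $ k $ l) + fps_X * (T $ i $ l * const_entry r k j - const_entry r i l * T $ k $ j)) n"
  proof (cases n)
    case 0
    then show ?thesis by (simp add: commutator_def nth_0)
  next
    case (Suc s)
    then show ?thesis using rtt_coefficients[OF rtt, of k l s i j r]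
      by (simp add: commutator_def algebra_simps)
  qed
qed

text \<open>Substituting u - 1 in \<open>rtt_const_entry\<close> turns \<open>fps_X\<close> into (u
  - 1)^(-1); multiplication by 1 - u^(-1) turns it back into u^(-1).\<close>

lemma rtt_const_entry_shifted:
  "fps_X * commutator (const_entry (Suc r) i j) (shifted $ k $ l) =
    (1 - fps_X) * commutator (const_entry r i j) (shifted $ k $ l)
    + fps_X * (const_entry r k j * shifted $ i $ l - shifted $ k $ j * const_entry r i l)"
proof -
  let ?Y = "subst_affine 1 (-1) (fps_X :: 'a fps)"
  have comm: "subst_affine 1 (-1) (commutator (fps_const c) F) = commutator (fps_const c) (subst_affine 1 (-1) F)"
    for c and F :: "'a fps"
    by (simp add: commutator_def subst_affine_diff subst_affine_mult subst_affine_const)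
  have "(1 - fps_X) * ?Y = ?Y * (1 - fps_X)"
    by (simp add: left_diff_distrib right_diff_distrib fps_mult_fps_X_commute)
  then have Y: "(1 - fps_X) * (?Y * F) = fps_X * F" for F
    by (simp add: subst_affine_1_m1_X flip: mult.assoc)
  have "?Y * commutator (const_entry (Suc r) i j) (shifted $ k $ l) =
    commutator (const_entry r i j) (shifted $ k $ l)
    + ?Y * (const_entry r k j * shifted $ i $ l - shifted $ k $ j * const_entry r i l)"
    using arg_cong[OF rtt_const_entry[of i j r k l], of "subst_affine 1 (-1)"]
    by (simp add: subst_affine_add subst_affine_diff subst_affine_mult subst_affine_const comm)
  from arg_cong[OF this, of "\<lambda>F. (1 - fps_X) * F"] show ?thesis
    unfolding distrib_left Y .
qed

text \<open>Up to \<open>qdet T\<close> the adjugate is inverse to \<open>shifted\<close>, so its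
  relation has contracted indices, and these collapse in products with \<open>shifted\<close>. The
  identity is settled in the sixteen index cases.\<close>

lemma rtt_const_entry_adjugate:
  "fps_X * commutator (const_entry (Suc r) i j) (adjugate T $ k $ l) =
    (1 - fps_X) * commutator (const_entry r i j) (adjugate T $ k $ l)
    + fps_X * ((if j = k then \<Sum>m\<in>UNIV. const_entry r i m * adjugate T $ m $ l else 0)
      - (if i = l then \<Sum>m\<in>UNIV. adjugate T $ k $ m * const_entry r m j else 0))"
proof -
  have "fps_X * (commutator (const_entry (Suc r) i j) (adjugate T $ k $ l)) =
    commutator (const_entry r i j) (adjugate T $ k $ l) +
    fps_X * (if k = l then T $ i $ (- k) * const_entry r (- l) j - const_entry r i (- k) * T $ (- l) $ j
      else const_entry r i (- k) * T $ (- l) $ j - T $ i $ (- k) * const_entry r (- l) j)"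
    using rtt_const_entry'[of i j r "- l" "- k"]
    by (cases "k = l") (simp_all add: adjugate_def commutator_simps algebra_simps)
  also have "\<dots> = (1 - fps_X) * commutator (const_entry r i j) (adjugate T $ k $ l)
    + fps_X * ((if j = k then \<Sum>m\<in>UNIV. const_entry r i m * adjugate T $ m $ l else 0)
      - (if i = l then \<Sum>m\<in>UNIV. adjugate T $ k $ m * const_entry r m j else 0))"
    by (cases i; cases j; cases k; cases l;
        simp add: sum_ix2 adjugate_def commutator_def algebra_simps)
  finally show ?thesis .
qed

text \<open>The commutator is a derivation, so it acts factor by factor on an entry of
  \<open>shifted ** adjugate T\<close>; mixed terms cancel and the other sums collapse by
  \<open>shifted_adjugate\<close>.\<close>

lemma qdet_commutator_Suc:
  "fps_X * commutator (const_entry (Suc r) i j) (qdet T) =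
    (1 - fps_X) * commutator (const_entry r i j) (qdet T)
    + fps_X * (if i = I_m1 then commutator (const_entry r I_m1 j) (qdet T) else 0)"
proof -
  \<comment> \<open>A fixed diagonal entry of the matrix product represents \<open>qdet T\<close>;
    the choice reappears in the case distinction on \<open>i\<close>.\<close>
  let ?k = I_m1
  let ?a = "const_entry r" and ?S = "\<lambda>i j. adjugate T $ i $ j" and ?B = "\<lambda>i j. shifted $ i $ j"
  have BS: "(\<Sum>m\<in>UNIV. ?B p m * ?S m q) = (if p = q then qdet T else 0)" for p q
    using arg_cong[OF shifted_adjugate(1), of "\<lambda>M. M $ p $ q"] by (simp add: matrix_matrix_mult_def mat_def)
  have d: "qdet T = (\<Sum>m\<in>UNIV. ?B ?k m * ?S m ?k)" unfolding BS by simp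
  have X: "F * (fps_X * G) = fps_X * (F * G)" "F * ((1 - fps_X) * G) = (1 - fps_X) * (F * G)" for F G :: "'a fps"
  proof -
    show X: "F * (fps_X * G) = fps_X * (F * G)" for F G :: "'a fps"
      by (metis fps_mult_fps_X_commute mult.assoc)
    show "F * ((1 - fps_X) * G) = (1 - fps_X) * (F * G)" for F G :: "'a fps"
      by (simp add: left_diff_distrib right_diff_distrib X)
  qed
  have 1: "(\<Sum>m\<in>UNIV. ?B ?k m * (if j = m then \<Sum>p\<in>UNIV. ?a i p * ?S p ?k else 0)) = (\<Sum>p\<in>UNIV. ?B ?k j * ?a i p * ?S p ?k)"
  proof -
    have "(\<Sum>m\<in>UNIV. ?B ?k m * (if j = m then \<Sum>p\<in>UNIV. ?a i p * ?S p ?k else 0)) =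
      (\<Sum>m\<in>UNIV. if j = m then ?B ?k m * (\<Sum>p\<in>UNIV. ?a i p * ?S p ?k) else 0)"
      by (rule sum.cong) auto
    then show ?thesis by (simp add: sum_distrib_left mult.assoc)
  qed
  have 2: "(\<Sum>m\<in>UNIV. ?B ?k m * (if i = ?k then \<Sum>p\<in>UNIV. ?S m p * ?a p j else 0)) = (if i = ?k then qdet T * ?a ?k j else 0)"
  proof -
    have "(\<Sum>m\<in>UNIV. ?B ?k m * (\<Sum>p\<in>UNIV. ?S m p * ?a p j)) = (\<Sum>p\<in>UNIV. (\<Sum>m\<in>UNIV. ?B ?k m * ?S m p) * ?a p j)"
      by (simp add: sum_distrib_left sum_distrib_right mult.assoc) (rule sum.swap)
    also have "\<dots> = (\<Sum>p\<in>UNIV. if ?k = p then qdet T * ?a ?k j else 0)"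
      unfolding BS by (rule sum.cong) auto
    finally show ?thesis by simp
  qed
  have 3: "(\<Sum>m\<in>UNIV. ?a ?k j * ?B i m * ?S m ?k) = (if i = ?k then ?a ?k j * qdet T else 0)"
    using BS[of i ?k] by (simp add: mult.assoc flip: sum_distrib_left)
  have "fps_X * commutator (const_entry (Suc r) i j) (qdet T) =
    (\<Sum>m\<in>UNIV. (fps_X * commutator (const_entry (Suc r) i j) (?B ?k m)) * ?S m ?k
      + ?B ?k m * (fps_X * commutator (const_entry (Suc r) i j) (?S m ?k)))"
    unfolding d commutator_sum by (simp only: commutator_simps sum_distrib_left distrib_left X mult.assoc)
  also have "\<dots> = (\<Sum>m\<in>UNIV. (1 - fps_X) * commutator (?a i j) (?B ?k m * ?S m ?k)
      + fps_X * (?a ?k j * ?B i m * ?S m ?k - ?B ?k j * ?a i m * ?S m ?k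
        + (?B ?k m * (if j = m then \<Sum>p\<in>UNIV. ?a i p * ?S p ?k else 0)
          - ?B ?k m * (if i = ?k then \<Sum>p\<in>UNIV. ?S m p * ?a p j else 0))))"
    unfolding rtt_const_entry_shifted rtt_const_entry_adjugate
    by (intro sum.cong refl)
       (simp only: commutator_simps distrib_right distrib_left left_diff_distrib[of _ _ "?S _ _"]
         right_diff_distrib[of fps_X] right_diff_distrib[of "?B _ _"] X mult.assoc add_ac)
  also have "\<dots> = (1 - fps_X) * commutator (?a i j) (qdet T)
      + fps_X * ((\<Sum>m\<in>UNIV. ?a ?k j * ?B i m * ?S m ?k) - (\<Sum>m\<in>UNIV. ?B ?k j * ?a i m * ?S m ?k)
        + ((\<Sum>m\<in>UNIV. ?B ?k m * (if j = m then \<Sum>p\<in>UNIV. ?a i p * ?S p ?k else 0))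
          - (\<Sum>m\<in>UNIV. ?B ?k m * (if i = ?k then \<Sum>p\<in>UNIV. ?S m p * ?a p j else 0))))"
    unfolding d commutator_sum by (simp only: sum.distrib sum_subtractf flip: sum_distrib_left)
  \<comment> \<open>By \<open>1\<close> the second sum cancels against the third; by
    \<open>3\<close> and \<open>2\<close> the first and the fourth form the commutator.\<close>
  also have "\<dots> = (1 - fps_X) * commutator (?a i j) (qdet T)
    + fps_X * (if i = I_m1 then commutator (?a I_m1 j) (qdet T) else 0)"
    unfolding 1 2 3 by (simp add: commutator_def)
  finally show ?thesis .
qed

text \<open>Induction on r: the recursion expresses degree r + 1 by commutators of degree r, and in
  degree 0 the entries are 0 or 1.\<close>

lemma qdet_commutes: "fps_const (fps_nth (T $ i $ j) r) * qdet T = qdet T * fps_const (fps_nth (T $ i $ j) r)"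
proof -
  have "\<forall>i j. commutator (const_entry r i j) (qdet T) = 0"
  proof (induction r)
    case 0
    show ?case by (simp add: nth_0 commutator_simps)
  next
    case (Suc r)
    have "fps_X * commutator (const_entry (Suc r) i j) (qdet T) = fps_X * 0" for i j
      using Suc by (simp only: qdet_commutator_Suc) simp
    then show ?case using fps_X_mult_cancel by blast
  qed
  then show ?thesis by (simp add: commutator_def)
qed

end

section \<open>Unitarity and symmetry of the twisted matrix\<close>

lemma unital_ring_hom_subst_affine: "unital_ring_hom (subst_affine a b :: 'a::complex_algebra_1 fps \<Rightarrow> _)"
  by (simp add: unital_ring_hom_def subst_affine_one subst_affine_add subst_affine_mult)

lemma affine_kernel_power_diag: "fps_nth (affine_kernel a b ^ n) n = inverse a ^ n"
  by (simp add: affine_kernel_def power_mult_distrib fps_X_power_mult_nth fps_power_zeroth)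

lemma subst_affine_nth_uminus: "fps_nth (subst_affine (- 1) 0 F) n = (- 1) ^ n *\<^sub>C fps_nth F n"
proof -
  have "affine_kernel (- 1) 0 ^ r = fps_const ((- 1) ^ r) * fps_X ^ r" for r
    by (simp add: affine_kernel_def fps_const_inverse power_mult_distrib mult.commute fps_const_power)
  then have "fps_nth (subst_affine (- 1) 0 F) n = (\<Sum>r\<le>n. if r = n then (- 1) ^ n *\<^sub>C fps_nth F n else 0)"
    unfolding subst_affine_nth[OF order_refl]
    by (intro sum.cong) (auto simp: fps_X_power_iff complex_vector.scale_zero_left)
  then show ?thesis by simp
qed

lemma map_entries_compose: "map_entries f (map_entries g M) = map_entries (\<lambda>x. f (g x)) M"
  by (simp add: vec_eq_iff)

lemma map_entries_adjugate: "unital_ring_hom h \<Longrightarrow> map_entries h (adjugate M) = adjugate (map_entries h M)"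
  by (simp add: vec_eq_iff adjugate_def unital_ring_homD)

lemma matrix_K_nth: "matrix_K $ i $ j = (if i = j then if i = I_p1 then 1 else - 1 else 0)"
  by (cases i; cases j; simp add: matrix_K_def matrix_unit_def)

lemma map_entries_K: "unital_ring_hom h \<Longrightarrow> map_entries h matrix_K = matrix_K"
  by (simp add: vec_eq_iff matrix_K_nth unital_ring_homD)

lemma matrix_K_mult_K: "matrix_K ** matrix_K = mat 1"
  by (simp add: vec_eq_iff all_ix2 matrix_matrix_mult_def sum_ix2 matrix_K_nth mat_def)

text \<open>Conjugation by K flips the signs off the diagonal, which is the only difference between
  adjugate and transpose. Thus \<open>shifted_adjugate\<close> applies to
  \<open>twisted_matrix\<close>.\<close>

lemma transpose_neg_adjugate: "transpose_neg M = matrix_K ** adjugate M ** matrix_K"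
  by (simp add: vec_eq_iff all_ix2 matrix_matrix_mult_def sum_ix2 matrix_K_nth adjugate_def transpose_neg_def)

context yangian_matrix
begin

text \<open>After K^2 = 1 the product is T(u) K adj T(-u) T(-u - 1) K adj T(u + 1), where the inner
  and then the outer pair cancel by \<open>shifted_adjugate\<close> at -u and at u + 1.\<close>

lemma twisted_unitarity:
  assumes "qdet T = 1"
  shows "twisted_matrix T ** matrix_K ** map_entries (subst_affine (-1) (-1)) (twisted_matrix T) ** matrix_K = mat 1"
proof -
  let ?E = "\<lambda>a b. map_entries (subst_affine a b)"
  let ?N = "?E (-1) 0 T"
  note h = unital_ring_hom_subst_affine
  note hm = map_entries_hom(1,4)[OF h] map_entries_K[OF h] map_entries_adjugate[OF h]
  have comp: "?E a b (?E c d T) = ?E (c * a) (c * b + d) T" if "a \<noteq> 0" "c \<noteq> 0" for a b c d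
    using that by (simp add: map_entries_compose subst_affine_compose)
  have S: "twisted_matrix T = T ** matrix_K ** adjugate ?N ** matrix_K"
    by (simp add: twisted_matrix_def transpose_neg_adjugate matrix_mul_assoc)
  have S': "?E (-1) (-1) (twisted_matrix T) = ?E (-1) (-1) T ** matrix_K ** adjugate (?E 1 1 T) ** matrix_K"
    unfolding S by (simp add: hm comp)
  have 1: "adjugate ?N ** ?E (-1) (-1) T = mat 1"
    using arg_cong[OF shifted_adjugate(2), of "?E (-1) 0"] by (simp add: hm comp assms subst_affine_one)
  have 2: "T ** adjugate (?E 1 1 T) = mat 1"
    using arg_cong[OF shifted_adjugate(1), of "?E 1 1"]
    by (simp add: hm comp assms subst_affine_one) (simp add: map_entries_def subst_affine_id)
  have "twisted_matrix T ** matrix_K ** ?E (-1) (-1) (twisted_matrix T) ** matrix_K =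
    T ** (matrix_K ** ((adjugate ?N ** ((matrix_K ** matrix_K) ** ?E (-1) (-1) T)) **
      (matrix_K ** (adjugate (?E 1 1 T) ** (matrix_K ** matrix_K)))))"
    unfolding S' unfolding S by (simp only: matrix_mul_assoc)
  also have "\<dots> = T ** ((matrix_K ** matrix_K) ** adjugate (?E 1 1 T))"
    by (simp only: matrix_K_mult_K matrix_mul_lid matrix_mul_rid 1 matrix_mul_assoc)
  also have "\<dots> = mat 1"
    by (simp only: matrix_K_mult_K matrix_mul_lid 2)
  finally show ?thesis .
qed

text \<open>The RTT relation on the line v = -u, where u - v = 2 u, summed over the inner matrix
  index.\<close>

lemma twisted_symmetry:
  "fps_const (2 *\<^sub>C 1) * (twisted_matrix T $ i $ j - subst_affine (-1) 0 (twisted_matrix T $ (- j) $ (- i))) =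
    fps_X * (twisted_matrix T $ (- j) $ (- i) - subst_affine (-1) 0 (twisted_matrix T $ (- j) $ (- i)))"
proof -
  let ?N = "map_entries (subst_affine (-1) 0) T"
  let ?V = "\<Sum>a\<in>UNIV. ?N $ (- j) $ a * T $ i $ (- a)"
  \<comment> \<open>\<open>?V\<close> enters the summed relation in two forms, which differ by the
    sign of the summation index.\<close>
  have reindex: "(\<Sum>a\<in>UNIV. f (- a)) = (\<Sum>a\<in>UNIV. f a)" for f :: "ix2 \<Rightarrow> 'a fps"
    by (simp add: sum_ix2 add.commute)
  have S: "twisted_matrix T $ i $ j = (\<Sum>a\<in>UNIV. T $ i $ a * ?N $ (- j) $ (- a))" for i j
    by (simp add: twisted_matrix_def matrix_matrix_mult_def transpose_neg_def)
  have "subst_affine (-1) 0 (twisted_matrix T $ (- j) $ (- i)) = ?V"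
    unfolding S by (simp add: subst_affine_sum subst_affine_mult subst_affine_compose subst_affine_id minus_ix2_simps)
  moreover have "?V = (\<Sum>a\<in>UNIV. ?N $ (- j) $ (- a) * T $ i $ a)"
    using reindex[of "\<lambda>a. ?N $ (- j) $ a * T $ i $ (- a)"] by (simp only: minus_ix2_simps)
  ultimately have V: "subst_affine (-1) 0 (twisted_matrix T $ (- j) $ (- i)) = ?V" "?V = (\<Sum>a\<in>UNIV. ?N $ (- j) $ (- a) * T $ i $ a)"
    by simp_all
  have "fps_const (2 *\<^sub>C 1) * commutator (T $ i $ a) (?N $ (- j) $ (- a)) =
      fps_X * (T $ (- j) $ a * ?N $ i $ (- a) - ?N $ (- j) $ a * T $ i $ (- a))" for a
    using rtt_on_line[of 1 "-1" 0 0 i a "- j" "- a"] by (simp add: subst_affine_id scalar_series_simps)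
  then have "(\<Sum>a\<in>UNIV. fps_const (2 *\<^sub>C 1) * commutator (T $ i $ a) (?N $ (- j) $ (- a))) =
    (\<Sum>a\<in>UNIV. fps_X * (T $ (- j) $ a * ?N $ i $ (- a) - ?N $ (- j) $ a * T $ i $ (- a)))"
    by (simp only:)
  then have "fps_const (2 *\<^sub>C 1) * (twisted_matrix T $ i $ j - ?V) = fps_X * (twisted_matrix T $ (- j) $ (- i) - ?V)"
    by (simp only: commutator_def V(2)[symmetric] S minus_ix2_simps sum_subtractf flip: sum_distrib_left)
  then show ?thesis by (simp only: V(1))
qed

text \<open>In odd degree the left side of \<open>twisted_symmetry\<close> adds the two
  coefficients, while the right side sits in even degree, where u and -u give the same.\<close>

lemma twisted_symmetry_odd:
  assumes "odd r"
  shows "fps_nth (twisted_matrix T $ i $ j) r + fps_nth (twisted_matrix T $ (- j) $ (- i)) r = 0"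
proof -
  obtain s where r: "r = Suc s" "even s" using assms by (cases r) auto
  have "2 *\<^sub>C (fps_nth (twisted_matrix T $ i $ j) r + fps_nth (twisted_matrix T $ (- j) $ (- i)) r) = 0"
    using arg_cong[OF twisted_symmetry[of i j], of "\<lambda>F. fps_nth F r"] r
    by (simp add: subst_affine_nth_uminus mult_scaleC_left complex_vector.scale_minus_left)
  then show ?thesis by (simp add: complex_vector.scale_eq_0_iff)
qed

end

section \<open>Rescaling by central series\<close>

lemma coeffs_commute_subst_affine:
  fixes F G :: "'a::complex_algebra_1 fps"
  assumes "coeffs_commute F G"
  shows "coeffs_commute F (subst_affine a b G)"
  using assms by (simp add: coeffs_commute_def subst_affine_nth[OF order_refl] sum_distrib_left sum_distrib_right
      mult_scaleC_left mult_scaleC_right)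

lemma mult_swap_middle:
  fixes a b x z :: "'a::ring_1"
  assumes "a * b = b * a"
  shows "x * a * (b * z) = x * b * (a * z)"
proof -
  have "x * a * (b * z) = x * (a * b) * z" by (simp only: mult.assoc)
  also have "\<dots> = x * b * (a * z)" by (simp only: assms mult.assoc)
  finally show ?thesis .
qed

lemma at_u_mult: "at_u (F * G) = at_u F * at_u (G :: 'a::ring_1 fps)"
proof -
  have "unital_ring_hom (fls_const :: 'a \<Rightarrow> _)"
    by (simp add: unital_ring_hom_def fls_plus_const)
  from unital_ring_homD(3)[OF unital_ring_hom_map_coeffs[OF this]] show ?thesis
    by (simp add: at_u_def)
qed

lemma at_v_mult: "at_v (F * G) = at_v F * at_v (G :: 'a::ring_1 fps)"
  by (simp add: at_v_def fls_times_fps_to_fls)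

lemma coeffs_commute_at:
  fixes F G :: "'a::ring_1 fps"
  assumes "coeffs_commute F G"
  shows "at_u F * at_v G = at_v G * at_u F" "at_u F * at_u G = at_u G * at_u F" "at_v F * at_v G = at_v G * at_v F"
proof -
  show "at_u F * at_v G = at_v G * at_u F"
    using assms by (simp add: fps_eq_iff fls_eq_iff at_u_def at_v_def coeffs_commute_def)
  show "at_u F * at_u G = at_u G * at_u F" "at_v F * at_v G = at_v G * at_v F"
    by (simp_all add: coeffs_commute_mult[OF assms] flip: at_u_mult at_v_mult)
qed

lemma coeffs_commute_sym: "coeffs_commute F G \<longleftrightarrow> coeffs_commute G F"
  by (auto simp: coeffs_commute_def)

text \<open>Every product in the relation has one factor in u and one in v, so y(u) y(v) can be
  taken out of all terms.\<close>

lemma rtt_scale: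
  fixes T :: "'a::ring_1 fps^ix2^ix2"
  assumes T: "rtt_relators R_Y2 T \<subseteq> {0}"
    and y: "coeffs_commute y y" and yT: "\<And>i j. coeffs_commute y (T $ i $ j)"
  shows "rtt_relators R_Y2 (map_entries ((*) y) T) \<subseteq> {0}"
  unfolding rtt_iff
proof (intro allI)
  fix i j k l
  let ?c = "at_u y * at_v y"
  note yv = coeffs_commute_at(1)[OF yT] and uT = coeffs_commute_at(1)[OF yT[unfolded coeffs_commute_sym[of y]]]
  have uv: "at_u (y * T $ i $ j) * at_v (y * T $ k $ l) = ?c * (at_u (T $ i $ j) * at_v (T $ k $ l))" for i j k l
    unfolding at_u_mult at_v_mult by (rule mult_swap_middle[OF uT])
  have vu: "at_v (y * T $ k $ l) * at_u (y * T $ i $ j) = ?c * (at_v (T $ k $ l) * at_u (T $ i $ j))" for i j k l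
    unfolding at_u_mult at_v_mult mult_swap_middle[OF yv[symmetric]] by (simp only: coeffs_commute_at(1)[OF y])
  have "commutator (at_u (T $ i $ j)) (at_v (T $ k $ l)) = inverse_u_minus fls_X_inv *
    (at_u (T $ k $ j) * at_v (T $ i $ l) - at_v (T $ k $ j) * at_u (T $ i $ l))"
    using T unfolding rtt_iff by blast
  moreover have "?c * (inverse_u_minus fls_X_inv * M) = inverse_u_minus fls_X_inv * (?c * M)" for M
  proof -
    have "?c * (inverse_u_minus fls_X_inv * M) = (?c * inverse_u_minus fls_X_inv) * M" by (rule mult.assoc[symmetric])
    also have "\<dots> = (inverse_u_minus fls_X_inv * ?c) * M" by (simp only: inverse_u_minus_commute)
    also have "\<dots> = inverse_u_minus fls_X_inv * (?c * M)" by (rule mult.assoc)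
    finally show ?thesis .
  qed
  ultimately have "?c * commutator (at_u (T $ i $ j)) (at_v (T $ k $ l)) = inverse_u_minus fls_X_inv *
    (?c * (at_u (T $ k $ j) * at_v (T $ i $ l) - at_v (T $ k $ j) * at_u (T $ i $ l)))"
    by (simp only:)
  then show "commutator (at_u (map_entries ((*) y) T $ i $ j)) (at_v (map_entries ((*) y) T $ k $ l)) =
    inverse_u_minus fls_X_inv * (at_u (map_entries ((*) y) T $ k $ j) * at_v (map_entries ((*) y) T $ i $ l)
      - at_v (map_entries ((*) y) T $ k $ j) * at_u (map_entries ((*) y) T $ i $ l))"
    by (simp add: commutator_def uv vu right_diff_distrib)
qed

lemma qdet_scale:
  fixes T :: "'a::complex_algebra_1 fps^ix2^ix2"
  assumes "\<And>i j. coeffs_commute y (T $ i $ j)"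
  shows "qdet (map_entries ((*) y) T) = subst_affine 1 (-1) y * y * qdet T"
proof -
  have "y * subst_affine 1 (-1) (T $ i $ j) = subst_affine 1 (-1) (T $ i $ j) * y" for i j
    by (rule coeffs_commute_mult[OF coeffs_commute_subst_affine[OF assms]])
  then have "subst_affine 1 (-1) y * subst_affine 1 (-1) (T $ i $ j) * (y * T $ k $ l) =
    subst_affine 1 (-1) y * y * (subst_affine 1 (-1) (T $ i $ j) * T $ k $ l)" for i j k l
    by (intro mult_swap_middle) simp
  then show ?thesis by (simp add: qdet_def subst_affine_mult right_diff_distrib)
qed

text \<open>The scalars from T(u) and T(-u) collect in front; y(u) y(-u) is later compensated by its
  inverse from the other tensor factor.\<close>

lemma twisted_scale:
  fixes T :: "'a::complex_algebra_1 fps^ix2^ix2"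
  assumes "\<And>i j. coeffs_commute y (T $ i $ j)"
  shows "twisted_matrix (map_entries ((*) y) T) = map_entries ((*) (y * subst_affine (-1) 0 y)) (twisted_matrix T)"
proof -
  have "subst_affine (-1) 0 y * T $ i $ j = T $ i $ j * subst_affine (-1) 0 y" for i j
  proof -
    have "coeffs_commute (T $ i $ j) y" using assms coeffs_commute_sym by blast
    from coeffs_commute_mult[OF coeffs_commute_subst_affine[OF this]] show ?thesis by metis
  qed
  then have "y * T $ i $ j * (subst_affine (-1) 0 y * F) = y * subst_affine (-1) 0 y * (T $ i $ j * F)" for i j F
    by (intro mult_swap_middle) simp
  then show ?thesis
    by (simp add: vec_eq_iff twisted_matrix_def matrix_matrix_mult_def transpose_neg_def subst_affine_mult sum_distrib_left)
qed

section \<open>Solving equations for series degree by degree\<close>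

lemma fps_mult_nth_lowest:
  fixes W G :: "'a::ring_1 fps"
  assumes "\<And>m. m < n \<Longrightarrow> fps_nth W m = 0"
  shows "fps_nth (W * G) n = fps_nth W n * fps_nth G 0" "fps_nth (G * W) n = fps_nth G 0 * fps_nth W n"
proof -
  have "fps_nth (W * G) n = (\<Sum>i=0..n. if i = n then fps_nth W n * fps_nth G 0 else 0)"
    unfolding fps_mult_nth by (rule sum.cong) (auto simp: assms)
  then show "fps_nth (W * G) n = fps_nth W n * fps_nth G 0" by simp
  have "fps_nth (G * W) n = (\<Sum>i=0..n. if i = 0 then fps_nth G 0 * fps_nth W n else 0)"
    unfolding fps_mult_nth by (rule sum.cong) (auto simp: assms)
  then show "fps_nth (G * W) n = fps_nth G 0 * fps_nth W n" by simp
qed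

lemma subst_affine_nth_lowest:
  assumes "\<And>m. m < n \<Longrightarrow> fps_nth W m = 0"
  shows "fps_nth (subst_affine a b W) n = inverse a ^ n *\<^sub>C fps_nth W n"
proof -
  have "fps_nth (subst_affine a b W) n = (\<Sum>r\<le>n. if r = n then inverse a ^ n *\<^sub>C fps_nth W n else 0)"
    unfolding subst_affine_nth[OF order_refl]
    by (rule sum.cong) (auto simp: assms affine_kernel_power_diag complex_vector.scale_zero_right)
  then show ?thesis by simp
qed

lemma subst_affine_nth_in:
  "subalgebra Z \<Longrightarrow> (\<And>m. m \<le> n \<Longrightarrow> fps_nth F m \<in> Z) \<Longrightarrow> fps_nth (subst_affine a b F) n \<in> Z"
  unfolding subst_affine_nth[OF order_refl] by (intro subalgebra_sum subalgebraD(5)) auto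

lemma fps_mult_nth_in:
  "subalgebra Z \<Longrightarrow> (\<And>m. m \<le> n \<Longrightarrow> fps_nth F m \<in> Z) \<Longrightarrow> (\<And>m. m \<le> n \<Longrightarrow> fps_nth G m \<in> Z) \<Longrightarrow>
    fps_nth (F * G) n \<in> Z"
  unfolding fps_mult_nth by (intro subalgebra_sum subalgebraD(4)) auto

text \<open>The coefficients of degree n meet only constant terms of the other factor, and
  substitution scales them by \<open>inverse a ^ n\<close>. This drives both the recursion for the
  shifted square root and the inductions for surjectivity.\<close>

lemma mult_subst_affine_nth:
  fixes F G :: "'a::complex_algebra_1 fps"
  assumes "0 < n"
  shows "fps_nth (F * subst_affine a b G) n = fps_nth (fps_cutoff n F * subst_affine a b (fps_cutoff n G)) n
    + fps_nth F n * fps_nth G 0 + inverse a ^ n *\<^sub>C (fps_nth F 0 * fps_nth G n)"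
proof -
  let ?E = "subst_affine a b :: 'a fps \<Rightarrow> 'a fps"
  let ?F = "F - fps_cutoff n F" and ?G = "G - fps_cutoff n G"
  have W: "\<And>m. m < n \<Longrightarrow> fps_nth ?F m = 0" "\<And>m. m < n \<Longrightarrow> fps_nth ?G m = 0"
    "fps_nth ?F n = fps_nth F n" "fps_nth ?G n = fps_nth G n" by simp_all
  have "F * ?E G = fps_cutoff n F * ?E (fps_cutoff n G) + (?F * ?E G + fps_cutoff n F * ?E ?G)"
    by (simp add: subst_affine_diff algebra_simps)
  then have "fps_nth (F * ?E G) n = fps_nth (fps_cutoff n F * ?E (fps_cutoff n G)) n
      + (fps_nth (?F * ?E G) n + fps_nth (fps_cutoff n F * ?E ?G) n)"
    by simp
  also have "fps_nth (?F * ?E G) n = fps_nth F n * fps_nth G 0"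
    using fps_mult_nth_lowest(1)[OF W(1), where G = "?E G"] W(3) by (simp add: subst_affine_nth_0)
  also have "fps_nth (fps_cutoff n F * ?E ?G) n = inverse a ^ n *\<^sub>C (fps_nth F 0 * fps_nth G n)"
  proof -
    have "fps_nth (?E ?G) m = 0" if "m < n" for m
      using subst_affine_nth_lowest[of m ?G a b] W(2) that by (simp add: complex_vector.scale_zero_right)
    from fps_mult_nth_lowest(2)[OF this, where G = "fps_cutoff n F"] show ?thesis
      using assms subst_affine_nth_lowest[OF W(2), where a = a and b = b] W(4) by (simp add: mult_scaleC_right)
  qed
  finally show ?thesis by (simp only: add.assoc)
qed

text \<open>Degree n of y(u) y(u - 1) is twice the coefficient of degree n plus an expression in
  lower ones. The recursion uses only algebra operations and so stays inside
  \<open>Z\<close>.\<close>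

lemma ex_shifted_square_root:
  fixes d :: "'a::complex_algebra_1 fps"
  assumes Z: "subalgebra Z" and d: "\<And>n. fps_nth d n \<in> Z" "fps_nth d 0 = 1"
  obtains y where "\<And>n. fps_nth y n \<in> Z" "fps_nth y 0 = 1" "y * subst_affine 1 (-1) y = d"
proof -
  let ?E = "subst_affine 1 (-1) :: 'a fps \<Rightarrow> 'a fps"
  let ?c = "\<lambda>f n. fps_cutoff n (Abs_fps f :: 'a fps)"
  \<comment> \<open>\<open>fps_cutoff n\<close> hides all values from degree n on, which makes the
    recursion well founded.\<close>
  define \<Phi> where "\<Phi> f n = (if n = 0 then 1 else (1/2) *\<^sub>C (fps_nth d n - fps_nth (?c f n * ?E (?c f n)) n))"
    for f :: "nat \<Rightarrow> 'a" and n :: nat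
  have "?c f n = ?c g n" if "\<forall>z. (z, n) \<in> less_than \<longrightarrow> f z = g z" for f g n
    using that by (auto simp: fps_eq_iff)
  then have "adm_wf less_than \<Phi>" unfolding adm_wf_def \<Phi>_def by metis
  from wfrec_fixpoint[OF wf_less_than this] obtain f where f: "f = \<Phi> f" by metis
  define y where "y = Abs_fps f"
  have y0: "fps_nth y 0 = 1" using fun_cong[OF f, of 0] by (simp add: y_def \<Phi>_def)
  have yn: "fps_nth y n = (1/2) *\<^sub>C (fps_nth d n - fps_nth (fps_cutoff n y * ?E (fps_cutoff n y)) n)" if "0 < n" for n
    using fun_cong[OF f, of n] that by (simp add: y_def \<Phi>_def)
  have "fps_nth y n \<in> Z" for n
  proof (induction n rule: less_induct)
    case (less n)
    have c: "fps_nth (fps_cutoff n y) m \<in> Z" for m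
      using less[of m] subalgebraD(2)[OF Z] by simp
    show ?case
    proof (cases "n = 0")
      case True
      then show ?thesis by (simp add: y0 subalgebraD[OF Z])
    next
      case False
      then have "0 < n" by simp
      show ?thesis
        unfolding yn[OF \<open>0 < n\<close>] using c d(1)
        by (intro subalgebraD(5,7)[OF Z] fps_mult_nth_in[OF Z] subst_affine_nth_in[OF Z]) auto
    qed
  qed
  moreover have "fps_nth (y * ?E y) n = fps_nth d n" for n
  proof (cases "n = 0")
    case True
    then show ?thesis by (simp add: y0 d(2) subst_affine_nth_0)
  next
    case False
    then have n: "0 < n" by simp
    have "fps_nth y n + fps_nth y n = fps_nth d n - fps_nth (fps_cutoff n y * ?E (fps_cutoff n y)) n"
      unfolding yn[OF n] by (simp flip: scaleC_add_left)
    then show ?thesis by (subst mult_subst_affine_nth[OF n]) (simp add: y0 add.assoc)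
  qed
  then have "y * ?E y = d" by (rule fps_ext)
  ultimately show ?thesis using that y0 by blast
qed

text \<open>With constant term 1, the coefficients of the inverse are sums of products of earlier
  ones, so they remain in \<open>Z\<close>.\<close>

lemma ex_fps_inverse_in:
  fixes y :: "'a::complex_algebra_1 fps"
  assumes Z: "subalgebra Z" and y: "\<And>n. fps_nth y n \<in> Z" "fps_nth y 0 = 1"
  obtains z where "\<And>n. fps_nth z n \<in> Z" "fps_nth z 0 = 1" "y * z = 1"
proof -
  define z where "z = fps_right_inverse y 1"
  have yz: "y * z = 1" unfolding z_def by (rule fps_right_inverse) (simp add: y)
  have z0: "fps_nth z 0 = 1" by (simp add: z_def)
  have "fps_nth z n \<in> Z" for n
  proof (induction n rule: less_induct)
    case (less n)
    show ?case
    proof (cases "n = 0")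
      case False
      have "0 = fps_nth (y * z) n" using False by (simp add: yz)
      also have "\<dots> = fps_nth z n + (\<Sum>i=1..n. fps_nth y i * fps_nth z (n - i))"
        unfolding fps_mult_nth by (subst sum.atLeast_Suc_atMost) (simp_all add: y)
      finally have "fps_nth z n = - (\<Sum>i=1..n. fps_nth y i * fps_nth z (n - i))"
        by (simp add: eq_neg_iff_add_eq_0)
      also have "\<dots> \<in> Z"
        using False by (intro subalgebraD(6)[OF Z] subalgebra_sum[OF Z] subalgebraD(4)[OF Z] y less) auto
      finally show ?thesis .
    qed (simp add: z0 subalgebraD[OF Z])
  qed
  then show ?thesis using that yz z0 by blast
qed

section \<open>Central rescaling in tensor products\<close>

lemma tensor_left_hom: "algebra_hom (\<lambda>a. a \<otimes>\<^sub>C 1)"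
  and tensor_right_hom: "algebra_hom (\<lambda>a. 1 \<otimes>\<^sub>C a)"
  by (auto simp: algebra_hom_def tensor_one tensor_mult tensor_bilinear tensor_clinear)

abbreviation left_series :: "'a::complex_algebra_1 fps \<Rightarrow> ('a, 'b::complex_algebra_1) tensor fps" where
  "left_series \<equiv> map_coeffs (\<lambda>a. a \<otimes>\<^sub>C 1)"

abbreviation right_series :: "'b::complex_algebra_1 fps \<Rightarrow> ('a::complex_algebra_1, 'b) tensor fps" where
  "right_series \<equiv> map_coeffs (\<lambda>a. 1 \<otimes>\<^sub>C a)"

lemma map_coeffs_hom:
  assumes "algebra_hom f"
  shows "map_coeffs f (F * G) = map_coeffs f F * map_coeffs f G" "map_coeffs f 1 = 1"
    "map_coeffs f (F + G) = map_coeffs f F + map_coeffs f G" "map_coeffs f (F - G) = map_coeffs f F - map_coeffs f G"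
    "map_coeffs f 0 = 0" "map_coeffs f (- F) = - map_coeffs f F" "map_coeffs f (sum h A) = (\<Sum>i\<in>A. map_coeffs f (h i))"
  using unital_ring_homD[OF unital_ring_hom_map_coeffs[OF algebra_hom_unital_ring_hom[OF assms]]] by auto

lemma map_coeffs_compose: "map_coeffs f (map_coeffs g F) = map_coeffs (\<lambda>x. f (g x)) F"
  by (simp add: fps_eq_iff)

lemma T_Y2_yangian_matrix: "yangian_matrix T_Y2"
proof
  show "fps_nth (T_Y2 $ i $ j) 0 = (if i = j then 1 else 0)" for i j
    by (simp add: T_Y2_def generator_matrix_def algebra_homD[OF abs_y2_hom])
qed (rule rtt_T_Y2)

lemma T_SY2_yangian_matrix: "yangian_matrix T_SY2"
proof
  show "fps_nth (T_SY2 $ i $ j) 0 = (if i = j then 1 else 0)" for i j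
    using yangian_matrix.nth_0[OF T_Y2_yangian_matrix, of i j] by (simp add: T_SY2_def algebra_homD[OF abs_sy2_hom])
qed (rule rtt_T_SY2)

definition center :: "'a::complex_algebra_1 set" where
  "center = {x. \<forall>w. x * w = w * x}"

lemma centerD: "x \<in> center \<Longrightarrow> x * w = w * x"
  by (simp add: center_def)

lemma subalgebra_vimage:
  assumes "algebra_hom f" "subalgebra A"
  shows "subalgebra (f -` A)"
  unfolding subalgebra_def by (auto simp: algebra_homD[OF assms(1)] intro: subalgebraD[OF assms(2)])

lemma subalgebra_centralizer: "subalgebra {w. \<forall>x\<in>A. x * w = w * x}"
proof -
  have "x * (y * z) = y * z * x" if "x * y = y * x" "x * z = z * x" for x y z :: 'a
  proof -
    have "x * (y * z) = y * x * z" by (simp only: that(1) flip: mult.assoc)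
    also have "\<dots> = y * z * x" by (simp only: that(2) mult.assoc)
    finally show ?thesis .
  qed
  moreover have "x * (y + z) = (y + z) * x" if "x * y = y * x" "x * z = z * x" for x y z :: 'a
    by (simp only: distrib_left distrib_right that)
  moreover have "x * (c *\<^sub>C y) = (c *\<^sub>C y) * x" if "x * y = y * x" for x y :: 'a and c
    by (simp only: mult_scaleC_left mult_scaleC_right that)
  ultimately show ?thesis unfolding subalgebra_def mem_Collect_eq
    by (intro conjI ballI allI) (simp, blast+)
qed

lemma subalgebra_center: "subalgebra (center :: 'a::complex_algebra_1 set)"
proof -
  have eq: "center = {w. \<forall>x\<in>UNIV. x * w = w * (x :: 'a)}" unfolding center_def by (auto intro: sym)
  show ?thesis unfolding eq by (rule subalgebra_centralizer)
qed

text \<open>The centralizer of such a coefficient is a subalgebra that contains the generators,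
  hence all of Y(2).\<close>

lemma qdet_T_Y2_center: "fps_nth (qdet T_Y2) n \<in> center"
proof -
  have "UNIV \<subseteq> {w. \<forall>x\<in>{fps_nth (qdet T_Y2) n}. x * w = w * x}"
    unfolding hull_T_Y2[symmetric]
  proof (rule hull_minimal[where S = subalgebra, OF _ subalgebra_centralizer])
    show "coefficients T_Y2 \<subseteq> {w. \<forall>x\<in>{fps_nth (qdet T_Y2) n}. x * w = w * x}"
    proof
      fix w assume "w \<in> coefficients T_Y2"
      then obtain i j r where "w = fps_nth (T_Y2 $ i $ j) r" by (auto simp: coefficients_def)
      then show "w \<in> {w. \<forall>x\<in>{fps_nth (qdet T_Y2) n}. x * w = w * x}"
        using arg_cong[OF yangian_matrix.qdet_commutes[OF T_Y2_yangian_matrix, of i j r], of "\<lambda>F. fps_nth F n"] by simp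
    qed
  qed
  then show ?thesis by (auto simp: center_def)
qed

lemma coeffs_commute_center: "(\<And>n. fps_nth y n \<in> center) \<Longrightarrow> coeffs_commute y F"
  by (simp add: coeffs_commute_def centerD)

text \<open>Built on the ambient Yangians, where the rescalings are defined through generators and
  relations.\<close>

lemma ex_hom_sy2_y2_tensor:
  obtains f :: "(sy2, y2) tensor \<Rightarrow> (y2, y2) tensor" where "algebra_hom f"
    "\<And>i j k l. map_coeffs f (left_series (twisted_matrix T_SY2 $ i $ j) * right_series (twisted_matrix T_Y2 $ k $ l))
      = left_series (twisted_matrix T_Y2 $ i $ j) * right_series (twisted_matrix T_Y2 $ k $ l)"
proof -
  note T0 = yangian_matrix.nth_0[OF T_Y2_yangian_matrix]
  have d0: "fps_nth (qdet T_Y2) 0 = 1"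
    by (simp add: qdet_def subst_affine_nth_0 T0)
  \<comment> \<open>Both \<open>y\<close> and its inverse \<open>z\<close> have central
    coefficients, as they are constructed inside the subalgebra \<open>center\<close>.\<close>
  obtain y where y: "\<And>n. fps_nth y n \<in> center" "fps_nth y 0 = 1" "y * subst_affine 1 (-1) y = qdet T_Y2"
    by (rule ex_shifted_square_root[OF subalgebra_center qdet_T_Y2_center d0]) blast
  obtain z where z: "\<And>n. fps_nth z n \<in> center" "fps_nth z 0 = 1" "y * z = 1"
    by (rule ex_fps_inverse_in[OF subalgebra_center y(1,2)]) blast
  note yc = coeffs_commute_center[OF y(1)] and zc = coeffs_commute_center[OF z(1)]
  note yc' = coeffs_commute_mult[OF yc] and zc' = coeffs_commute_mult[OF zc]
  have zy: "z * y = 1" using zc'[of y] z(3) by simp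
  have ezy: "subst_affine a b z * subst_affine a b y = 1" for a b
    by (simp add: zy subst_affine_one flip: subst_affine_mult)

  \<comment> \<open>The map \<open>s\<close> on SY(2): rescaling by \<open>z\<close> changes the
    quantum determinant to z(u - 1) z(u) y(u) y(u - 1) = 1.\<close>
  let ?zT = "map_entries ((*) z) T_Y2"
  have "rtt_relators R_Y2 ?zT \<subseteq> {0}" by (rule rtt_scale[OF rtt_T_Y2 zc zc])
  moreover have "fps_nth (?zT $ i $ j) 0 = (if i = j then 1 else 0)" for i j by (simp add: z(2) T0)
  ultimately obtain s0 where s0: "algebra_hom s0" "map_entries (map_coeffs s0) T_Y2 = ?zT"
    using y2_lift[of ?zT] by blast
  have "qdet ?zT = subst_affine 1 (-1) z * z * (y * subst_affine 1 (-1) y)"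
    by (simp add: qdet_scale[OF zc] y(3))
  also have "\<dots> = subst_affine 1 (-1) z * ((z * y) * subst_affine 1 (-1) y)" by (simp only: mult.assoc)
  also have "\<dots> = 1" by (simp add: zy ezy)
  finally have "qdet (map_entries (map_coeffs s0) T_Y2) = 1" by (simp add: s0(2))
  from sy2_lift[OF s0(1) this] obtain s where s: "algebra_hom s" "\<And>x. s (abs_sy2 x) = s0 x" by blast
  have sT: "map_entries (map_coeffs s) T_SY2 = ?zT"
    by (simp add: T_SY2_def map_entries_compose map_coeffs_compose s(2) s0(2))

  \<comment> \<open>The map \<open>m\<close> on Y(2): the central series is placed in the first
    tensor factor, the matrix in the second.\<close>
  let ?y = "left_series y :: (y2, y2) tensor fps"
  let ?T = "map_entries right_series T_Y2 :: (y2, y2) tensor fps^ix2^ix2"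
  let ?yT = "map_entries ((*) ?y) ?T"
  have "rtt_relators R_Y2 ?T \<subseteq> {0}"
    using rtt_T_Y2 algebra_homD(5)[OF tensor_right_hom]
    by (auto simp: rtt_relators_map[OF algebra_hom_unital_ring_hom[OF tensor_right_hom] map_R_Y2]
        algebra_hom_unital_ring_hom[OF tensor_right_hom])
  moreover have yy: "coeffs_commute ?y ?y" using y(1) by (simp add: coeffs_commute_def tensor_mult centerD)
  moreover have yT: "coeffs_commute ?y (?T $ i $ j)" for i j by (simp add: coeffs_commute_def tensor_mult)
  ultimately have "rtt_relators R_Y2 ?yT \<subseteq> {0}" by (rule rtt_scale)
  moreover have "fps_nth (?yT $ i $ j) 0 = (if i = j then 1 else 0)" for i j
    by (simp add: y(2) T0 tensor_one algebra_homD[OF tensor_right_hom])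
  ultimately obtain m where m: "algebra_hom m" "map_entries (map_coeffs m) T_Y2 = ?yT"
    using y2_lift[of ?yT] by blast

  \<comment> \<open>The first components of \<open>m b\<close> are central, so it commutes with
    elements of the first factor; generators suffice for the check.\<close>
  have comm: "(s a \<otimes>\<^sub>C 1) * m b = m b * (s a \<otimes>\<^sub>C 1)" for a b
  proof -
    have "UNIV \<subseteq> m -` {w. \<forall>x\<in>{s a \<otimes>\<^sub>C 1}. x * w = w * x}"
      unfolding hull_T_Y2[symmetric]
    proof (rule hull_minimal[where S = subalgebra])
      show "subalgebra (m -` {w. \<forall>x\<in>{s a \<otimes>\<^sub>C 1}. x * w = w * x})"
        by (rule subalgebra_vimage[OF m(1) subalgebra_centralizer])
      show "coefficients T_Y2 \<subseteq> m -` {w. \<forall>x\<in>{s a \<otimes>\<^sub>C 1}. x * w = w * x}"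
      proof
        fix w assume "w \<in> coefficients T_Y2"
        then obtain i j r where w: "w = fps_nth (T_Y2 $ i $ j) r" by (auto simp: coefficients_def)
        have "m w = fps_nth (map_entries (map_coeffs m) T_Y2 $ i $ j) r" by (simp add: w)
        also have "\<dots> = (\<Sum>k=0..r. fps_nth y k \<otimes>\<^sub>C fps_nth (T_Y2 $ i $ j) (r - k))"
          by (simp add: m(2) fps_mult_nth tensor_mult)
        finally show "w \<in> m -` {w. \<forall>x\<in>{s a \<otimes>\<^sub>C 1}. x * w = w * x}"
          by (simp add: sum_distrib_left sum_distrib_right tensor_mult centerD[OF y(1)])
      qed
    qed
    then show ?thesis by blast
  qed
  obtain f where f: "algebra_hom f" "\<And>a b. f (a \<otimes>\<^sub>C b) = (s a \<otimes>\<^sub>C 1) * m b"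
    using tensor_lift[OF algebra_hom_compose[OF s(1) tensor_left_hom] m(1) comm] by blast
  have "map_coeffs f (left_series (twisted_matrix T_SY2 $ i $ j) * right_series (twisted_matrix T_Y2 $ k $ l))
      = left_series (twisted_matrix T_Y2 $ i $ j) * right_series (twisted_matrix T_Y2 $ k $ l)" for i j k l
  proof -
    \<comment> \<open>The first argument acquires z(u) z(-u) and the second y(u) y(-u), both in the
      first tensor factor, where they are inverse to each other.\<close>
    let ?z = "z * subst_affine (-1) 0 z" and ?yy = "y * subst_affine (-1) 0 y"
    have "map_coeffs f (left_series (twisted_matrix T_SY2 $ i $ j)) = left_series (map_entries (map_coeffs s) (twisted_matrix T_SY2) $ i $ j)"
      by (simp add: fps_eq_iff f(2) algebra_homD[OF m(1)])
    also have "\<dots> = left_series (?z * twisted_matrix T_Y2 $ i $ j)"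
      by (simp add: twisted_matrix_map[OF s(1)] sT twisted_scale[OF zc])
    finally have 1: "map_coeffs f (left_series (twisted_matrix T_SY2 $ i $ j)) = left_series (?z * twisted_matrix T_Y2 $ i $ j)" .
    have "map_coeffs f (right_series (twisted_matrix T_Y2 $ k $ l)) = map_entries (map_coeffs m) (twisted_matrix T_Y2) $ k $ l"
      by (simp add: fps_eq_iff f(2) algebra_homD[OF s(1)] tensor_one)
    also have "\<dots> = ?y * subst_affine (-1) 0 ?y * map_entries right_series (twisted_matrix T_Y2) $ k $ l"
      by (simp add: twisted_matrix_map[OF m(1)] m(2) twisted_scale[OF yT] twisted_matrix_map[OF tensor_right_hom])
    also have "\<dots> = left_series ?yy * right_series (twisted_matrix T_Y2 $ k $ l)"
      by (simp add: map_coeffs_hom[OF tensor_left_hom] subst_affine_map[OF algebra_homD(1)[OF tensor_left_hom]])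
    finally have 2: "map_coeffs f (right_series (twisted_matrix T_Y2 $ k $ l)) = left_series ?yy * right_series (twisted_matrix T_Y2 $ k $ l)" .
    have zs: "subst_affine (-1) 0 z * F = F * subst_affine (-1) 0 z" for F :: "y2 fps"
    proof (rule coeffs_commute_mult)
      show "coeffs_commute (subst_affine (-1) 0 z) F"
        by (rule coeffs_commute_subst_affine[OF zc[THEN coeffs_commute_sym[THEN iffD1]], THEN coeffs_commute_sym[THEN iffD1]])
    qed
    have zF: "?z * F = F * ?z" for F
    proof -
      have "?z * F = z * (subst_affine (-1) 0 z * F)" by (rule mult.assoc)
      also have "\<dots> = z * F * subst_affine (-1) 0 z" by (simp only: zs mult.assoc)
      also have "\<dots> = F * z * subst_affine (-1) 0 z" by (simp only: zc'[of F])
      also have "\<dots> = F * ?z" by (rule mult.assoc)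
      finally show ?thesis .
    qed
    have "?z * F * ?yy = F" for F
    proof -
      have "?z * F * ?yy = F * (z * subst_affine (-1) 0 z * (y * subst_affine (-1) 0 y))"
        using arg_cong[OF zF[of F], of "\<lambda>G. G * ?yy"] by (simp only: mult.assoc)
      also have "z * subst_affine (-1) 0 z * (y * subst_affine (-1) 0 y) = z * y * (subst_affine (-1) 0 z * subst_affine (-1) 0 y)"
        by (rule mult_swap_middle[OF zs])
      finally show ?thesis by (simp add: zy ezy)
    qed
    then have "left_series (?z * twisted_matrix T_Y2 $ i $ j) * left_series ?yy =
      (left_series (twisted_matrix T_Y2 $ i $ j) :: (y2, y2) tensor fps)"
      by (simp flip: map_coeffs_hom(1)[OF tensor_left_hom])
    then show ?thesis unfolding map_coeffs_hom(1)[OF f(1)] 1 2 by (simp flip: mult.assoc)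
  qed
  with f(1) show ?thesis using that by blast
qed

text \<open>Injective linear maps have linear left inverses, and the tensor product of these is
  again a left inverse. This embeds tensor products of twisted subalgebras into the ambient
  ones.\<close>

lemma tensor_map_inj:
  fixes f :: "'a::complex_algebra_1 \<Rightarrow> 'c::complex_algebra_1" and g :: "'b::complex_algebra_1 \<Rightarrow> 'd::complex_algebra_1"
  assumes f: "clinear f" "inj f" and g: "clinear g" "inj g"
  shows "inj (tensor_map f g)"
proof -
  interpret F: vector_space_pair "scaleC :: complex \<Rightarrow> 'a \<Rightarrow> 'a" "scaleC :: complex \<Rightarrow> 'c \<Rightarrow> 'c"
    by unfold_locales
  interpret G: vector_space_pair "scaleC :: complex \<Rightarrow> 'b \<Rightarrow> 'b" "scaleC :: complex \<Rightarrow> 'd \<Rightarrow> 'd"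
    by unfold_locales
  obtain f' where f': "clinear f'" "f' \<circ> f = id" using F.linear_injective_left_inverse[OF f] by blast
  obtain g' where g': "clinear g'" "g' \<circ> g = id" using G.linear_injective_left_inverse[OF g] by blast
  have "tensor_map f' g' (tensor_map f g x) = x" for x
  proof (induction x rule: tensor_induct)
    case (1 a b)
    show ?case using fun_cong[OF f'(2), of a] fun_cong[OF g'(2), of b]
      by (simp add: tensor_map(2)[OF f(1) g(1)] tensor_map(2)[OF f'(1) g'(1)])
  next
    case (2 x y)
    then show ?case
      by (simp add: clinear_add[OF tensor_map(1)[OF f(1) g(1)]] clinear_add[OF tensor_map(1)[OF f'(1) g'(1)]])
  qed
  then show ?thesis by (rule inj_on_inverseI)
qed

section \<open>Injectivity of \<open>Pr1\<close> on the subalgebra \<open>D\<close>\<close>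

definition diagonal_subalgebra :: "(y2tw, y2tw) tensor set" where
  "diagonal_subalgebra = subalgebra hull
    {fps_nth (left_series (S_Y2 $ i $ j) * right_series (S_Y2 $ k $ l)) n | i j k l n. True}"

lemma map_Rep_S_Y2: "map_coeffs Rep_y2tw (S_Y2 $ i $ j) = twisted_matrix T_Y2 $ i $ j"
  using arg_cong[OF Rep_S_Y2, of "\<lambda>M. M $ i $ j"] by simp

lemma map_Rep_Pr_S_Y2: "map_coeffs (\<lambda>x. Rep_sy2tw (Pr x)) (S_Y2 $ i $ j) = twisted_matrix T_SY2 $ i $ j"
proof -
  have "map_coeffs (\<lambda>x. Rep_sy2tw (Pr x)) (S_Y2 $ i $ j) = map_coeffs abs_sy2 (map_coeffs Rep_y2tw (S_Y2 $ i $ j))"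
    by (simp add: map_coeffs_compose Pr.rep_eq)
  also have "\<dots> = map_entries (map_coeffs abs_sy2) (twisted_matrix T_Y2) $ i $ j" by (simp add: map_Rep_S_Y2)
  finally show ?thesis by (simp only: twisted_matrix_map[OF abs_sy2_hom] T_SY2_def)
qed

text \<open>On the generators, \<open>f\<close> after the inclusion \<open>?R'\<close> after
  \<open>Pr1\<close> agrees with the inclusion \<open>?R\<close>, and \<open>?R\<close> is
  injective.\<close>

lemma inj_on_Pr1: "inj_on Pr1 diagonal_subalgebra"
proof (rule inj_onI)
  obtain f :: "(sy2, y2) tensor \<Rightarrow> (y2, y2) tensor" where f: "algebra_hom f"
    "\<And>i j k l. map_coeffs f (left_series (twisted_matrix T_SY2 $ i $ j) * right_series (twisted_matrix T_Y2 $ k $ l))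
      = left_series (twisted_matrix T_Y2 $ i $ j) * right_series (twisted_matrix T_Y2 $ k $ l)"
    using ex_hom_sy2_y2_tensor by blast
  let ?R = "tensor_map Rep_y2tw Rep_y2tw" and ?R' = "tensor_map Rep_sy2tw Rep_y2tw"
  have R: "algebra_hom ?R" "algebra_hom ?R'" by (intro tensor_map_hom Rep_y2tw_hom Rep_sy2tw_hom)+
  note S = map_Rep_S_Y2 and PrS = map_Rep_Pr_S_Y2
  have eq: "f (?R' (Pr1 x)) = ?R x" if "x \<in> diagonal_subalgebra" for x
  proof (rule algebra_hom_eq_on_hull[OF _ R(1) _ that[unfolded diagonal_subalgebra_def]])
    show hom: "algebra_hom (\<lambda>x. f (?R' (Pr1 x)))"
      by (intro algebra_hom_compose[OF algebra_hom_compose[OF Pr1_Pr2_hom(1) R(2)] f(1)])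
    fix w assume "w \<in> {fps_nth (left_series (S_Y2 $ i $ j) * right_series (S_Y2 $ k $ l)) n | i j k l n. True}"
    then obtain i j k l n where w: "w = fps_nth (left_series (S_Y2 $ i $ j) * right_series (S_Y2 $ k $ l)) n" by blast
    let ?F = "left_series (S_Y2 $ i $ j) * right_series (S_Y2 $ k $ l)"
    have "map_coeffs ?R ?F = left_series (map_coeffs Rep_y2tw (S_Y2 $ i $ j)) * right_series (map_coeffs Rep_y2tw (S_Y2 $ k $ l))"
      by (simp add: map_coeffs_hom[OF R(1)] map_coeffs_compose tensor_map(2)[OF algebra_homD(1,1)[OF Rep_y2tw_hom]]
          algebra_homD[OF Rep_y2tw_hom])
    then have 1: "map_coeffs ?R ?F = left_series (twisted_matrix T_Y2 $ i $ j) * right_series (twisted_matrix T_Y2 $ k $ l)"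
      by (simp only: S)
    have "map_coeffs (\<lambda>x. ?R' (Pr1 x)) ?F =
        left_series (map_coeffs (\<lambda>x. Rep_sy2tw (Pr x)) (S_Y2 $ i $ j)) * right_series (map_coeffs Rep_y2tw (S_Y2 $ k $ l))"
      unfolding map_coeffs_hom(1)[OF algebra_hom_compose[OF Pr1_Pr2_hom(1) R(2)]]
      by (simp add: map_coeffs_compose Pr1_def
          tensor_map(2)[OF algebra_homD(1)[OF Pr_hom] algebra_homD(1)[OF algebra_hom_id]]
          tensor_map(2)[OF algebra_homD(1)[OF Rep_sy2tw_hom] algebra_homD(1)[OF Rep_y2tw_hom]]
          algebra_homD[OF Rep_y2tw_hom] algebra_homD[OF Rep_sy2tw_hom] algebra_homD[OF Pr_hom])
    then have "map_coeffs f (map_coeffs (\<lambda>x. ?R' (Pr1 x)) ?F) = map_coeffs ?R ?F"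
      unfolding 1 by (simp only: PrS S f(2))
    then have "fps_nth (map_coeffs f (map_coeffs (\<lambda>x. ?R' (Pr1 x)) ?F)) n = fps_nth (map_coeffs ?R ?F) n"
      by (rule arg_cong)
    then show "f (?R' (Pr1 w)) = ?R w"
      unfolding w nth_map_coeffs .
  qed
  have "inj Rep_y2tw" by (rule injI) (simp only: Rep_y2tw_inject)
  then have inj: "inj ?R" by (intro tensor_map_inj algebra_homD(1)[OF Rep_y2tw_hom])
  fix x y assume xy: "x \<in> diagonal_subalgebra" "y \<in> diagonal_subalgebra" "Pr1 x = Pr1 y"
  have "?R x = f (?R' (Pr1 x))" by (rule eq[OF xy(1), symmetric])
  also have "\<dots> = f (?R' (Pr1 y))" by (simp only: xy(3))
  also have "\<dots> = ?R y" by (rule eq[OF xy(2)])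
  finally show "x = y" by (rule injD[OF inj])
qed

section \<open>Generators of the target algebras\<close>

text \<open>Pulls a statement on generators in the ambient algebra back to the type of the
  subalgebra.\<close>

lemma hull_eq_UNIV_if_inj:
  assumes f: "algebra_hom f" "inj f" and range: "range f \<subseteq> subalgebra hull (f ` G)"
  shows "subalgebra hull G = UNIV"
proof -
  have "x \<in> subalgebra hull G" for x
  proof -
    have "f x \<in> f ` (subalgebra hull G)" using range unfolding image_hull[OF f(1)] by blast
    then show ?thesis by (simp add: inj_image_mem_iff[OF f(2)])
  qed
  then show ?thesis by blast
qed

definition S_SY2 :: "sy2tw fps^ix2^ix2" where
  "S_SY2 = map_entries (map_coeffs Pr) S_Y2"

lemma inj_Reps: "inj Rep_y2tw" "inj Rep_sy2tw" "inj Rep_x4tw"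
  by (rule injI, simp only: Rep_y2tw_inject Rep_sy2tw_inject Rep_x4tw_inject)+

lemma Rep_S_SY2: "map_entries (map_coeffs Rep_sy2tw) S_SY2 = twisted_matrix T_SY2"
  by (simp add: S_SY2_def map_entries_compose map_coeffs_compose vec_eq_iff map_Rep_Pr_S_Y2)

lemma hull_coefficients_S_Y2: "subalgebra hull coefficients S_Y2 = UNIV"
  by (rule hull_eq_UNIV_if_inj[OF Rep_y2tw_hom inj_Reps(1)])
     (use Rep_y2tw in \<open>auto simp flip: coefficients_map simp: Rep_S_Y2\<close>)

lemma hull_coefficients_S_SY2: "subalgebra hull coefficients S_SY2 = UNIV"
  by (rule hull_eq_UNIV_if_inj[OF Rep_sy2tw_hom inj_Reps(2)])
     (use Rep_sy2tw in \<open>auto simp flip: coefficients_map simp: Rep_S_SY2\<close>)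

lemma hull_coefficients_S_X4: "subalgebra hull coefficients S_X4 = UNIV"
  by (rule hull_eq_UNIV_if_inj[OF Rep_x4tw_hom inj_Reps(3)])
     (use Rep_x4tw in \<open>auto simp flip: coefficients_map simp: Rep_S_X4\<close>)

lemma S_Y2_nth_0: "fps_nth (S_Y2 $ i $ j) 0 = (if i = j then 1 else 0)"
proof -
  have "Rep_y2tw (fps_nth (S_Y2 $ i $ j) 0) = fps_nth (twisted_matrix T_Y2 $ i $ j) 0"
    unfolding map_Rep_S_Y2[symmetric] by simp
  also have "\<dots> = (if i = j then 1 else 0)"
    by (cases i; cases j; simp add: twisted_matrix_def matrix_matrix_mult_def sum_ix2 transpose_neg_def
        subst_affine_nth_0 yangian_matrix.nth_0[OF T_Y2_yangian_matrix])
  also have "\<dots> = Rep_y2tw (if i = j then 1 else 0)" by (simp add: algebra_homD[OF Rep_y2tw_hom])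
  finally show ?thesis by (simp only: Rep_y2tw_inject)
qed

lemma S_SY2_nth_0: "fps_nth (S_SY2 $ i $ j) 0 = (if i = j then 1 else 0)"
  by (simp add: S_SY2_def S_Y2_nth_0 algebra_homD[OF Pr_hom])

lemma S_Y2_symmetry_odd:
  assumes "odd r"
  shows "fps_nth (S_Y2 $ i $ j) r + fps_nth (S_Y2 $ (- j) $ (- i)) r = 0"
proof -
  have "Rep_y2tw (fps_nth (S_Y2 $ i $ j) r + fps_nth (S_Y2 $ (- j) $ (- i)) r) =
    fps_nth (map_coeffs Rep_y2tw (S_Y2 $ i $ j)) r + fps_nth (map_coeffs Rep_y2tw (S_Y2 $ (- j) $ (- i))) r"
    by (simp add: algebra_homD[OF Rep_y2tw_hom])
  also have "\<dots> = Rep_y2tw 0"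
    unfolding map_Rep_S_Y2 yangian_matrix.twisted_symmetry_odd[OF T_Y2_yangian_matrix assms]
    by (simp add: algebra_homD[OF Rep_y2tw_hom])
  finally show ?thesis by (simp only: Rep_y2tw_inject)
qed

text \<open>The (1, 1) entry of \<open>twisted_unitarity\<close>, pulled back along
  \<open>Rep_sy2tw\<close>; the minus sign comes from K.\<close>

lemma S_SY2_unitarity:
  "S_SY2 $ I_p1 $ I_p1 * subst_affine (-1) (-1) (S_SY2 $ I_p1 $ I_p1)
    - S_SY2 $ I_p1 $ I_m1 * subst_affine (-1) (-1) (S_SY2 $ I_m1 $ I_p1) = 1" (is "?L = 1")
proof -
  let ?S = "twisted_matrix T_SY2"
  have "(?S ** matrix_K ** map_entries (subst_affine (-1) (-1)) ?S ** matrix_K) $ I_p1 $ I_p1 = 1"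
    unfolding yangian_matrix.twisted_unitarity[OF T_SY2_yangian_matrix qdet_T_SY2] by (simp add: mat_def)
  then have "?S $ I_p1 $ I_p1 * subst_affine (-1) (-1) (?S $ I_p1 $ I_p1)
    - ?S $ I_p1 $ I_m1 * subst_affine (-1) (-1) (?S $ I_m1 $ I_p1) = 1"
    by (simp add: matrix_matrix_mult_def sum_ix2 matrix_K_nth algebra_simps)
  then have "map_coeffs Rep_sy2tw ?L = 1"
    by (simp add: map_coeffs_hom[OF Rep_sy2tw_hom] subst_affine_map[OF algebra_homD(1)[OF Rep_sy2tw_hom]]
        flip: Rep_S_SY2)
  also have "\<dots> = map_coeffs Rep_sy2tw 1" by (simp add: map_coeffs_hom[OF Rep_sy2tw_hom])
  finally show ?thesis by (auto simp: fps_eq_iff Rep_sy2tw_inject)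
qed

section \<open>Surjectivity\<close>

text \<open>The contribution of the lower coefficients lies in \<open>B\<close>; subtracting it from
  the product leaves the part linear in the two coefficients of degree n.\<close>

lemma mult_subst_affine_nth_in:
  fixes F G :: "'a::complex_algebra_1 fps"
  assumes B: "subalgebra B" and n: "0 < n" and FG: "\<And>m. m < n \<Longrightarrow> fps_nth F m \<in> B" "\<And>m. m < n \<Longrightarrow> fps_nth G m \<in> B"
    and prod: "fps_nth (F * subst_affine a b G) n \<in> B"
  shows "fps_nth F n * fps_nth G 0 + inverse a ^ n *\<^sub>C (fps_nth F 0 * fps_nth G n) \<in> B"
proof -
  have "fps_nth F n * fps_nth G 0 + inverse a ^ n *\<^sub>C (fps_nth F 0 * fps_nth G n) =
    fps_nth (F * subst_affine a b G) n - fps_nth (fps_cutoff n F * subst_affine a b (fps_cutoff n G)) n"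
    by (subst mult_subst_affine_nth[OF n]) simp
  also have "\<dots> \<in> B"
    using FG subalgebraD(2)[OF B]
    by (intro subalgebraD(7)[OF B prod] fps_mult_nth_in[OF B] subst_affine_nth_in[OF B]) auto
  finally show ?thesis .
qed

lemma half_in: "subalgebra B \<Longrightarrow> x + x \<in> B \<Longrightarrow> x \<in> B"
  using subalgebraD(5)[of B "x + x" "1/2"] by (simp add: scaleC_add_right flip: scaleC_add_left)

lemma surj_on_diagonal:
  fixes B :: "(sy2tw, y2tw) tensor set"
  assumes B: "subalgebra B"
    and gen: "\<And>i j k l n. fps_nth (left_series (S_SY2 $ i $ j) * right_series (S_Y2 $ k $ l)) n \<in> B"
  shows "B = UNIV"
proof -
  let ?E = "subst_affine (-1) (-1) :: (sy2tw, y2tw) tensor fps \<Rightarrow> _"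
  let ?L = "\<lambda>i j. left_series (S_SY2 $ i $ j) :: (sy2tw, y2tw) tensor fps"
  let ?R = "\<lambda>k l. right_series (S_Y2 $ k $ l) :: (sy2tw, y2tw) tensor fps"
  have LR: "left_series F * right_series G = right_series G * (left_series F :: (sy2tw, y2tw) tensor fps)" for F G
    by (rule coeffs_commute_mult) (simp add: coeffs_commute_def tensor_mult)
  have unit: "?L I_p1 I_p1 * ?E (?L I_p1 I_p1) - ?L I_p1 I_m1 * ?E (?L I_m1 I_p1) = 1"
    using arg_cong[OF S_SY2_unitarity, of "left_series :: sy2tw fps \<Rightarrow> (sy2tw, y2tw) tensor fps"]
    by (simp add: map_coeffs_hom[OF tensor_left_hom] subst_affine_map[OF algebra_homD(1)[OF tensor_left_hom]])
  \<comment> \<open>The two tensor factors commute, so the product regroups factor by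
    factor.\<close>
  have prod: "(?L i j * ?R k l) * ?E (?L i' j' * ?R p q) = (?L i j * ?E (?L i' j')) * (?R k l * ?E (?R p q))"
    for i j k l i' j' p q
  proof -
    have "?R k l * ?E (?L i' j') = ?E (?L i' j') * ?R k l"
      using LR[of "subst_affine (-1) (-1) (S_SY2 $ i' $ j')"]
      by (simp add: subst_affine_map[OF algebra_homD(1)[OF tensor_left_hom]])
    then show ?thesis unfolding subst_affine_mult by (rule mult_swap_middle)
  qed
  \<comment> \<open>Taking the left factors in the combination \<open>unit\<close> replaces them by
    1 and leaves a product in the second tensor factor alone.\<close>
  have RR: "fps_nth (?R k l * ?E (?R p q)) n \<in> B" for k l p q n
  proof -
    have "?R k l * ?E (?R p q) = (?L I_p1 I_p1 * ?R k l) * ?E (?L I_p1 I_p1 * ?R p q)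
      - (?L I_p1 I_m1 * ?R k l) * ?E (?L I_m1 I_p1 * ?R p q)"
      unfolding prod left_diff_distrib[symmetric] unit by simp
    moreover have "fps_nth ((?L i j * ?R k l) * ?E (?L i' j' * ?R p q)) n \<in> B" for i j i' j'
      by (intro fps_mult_nth_in[OF B] subst_affine_nth_in[OF B] gen)
    ultimately show ?thesis by (simp add: subalgebraD(7)[OF B])
  qed
  have R0: "fps_nth (?R k l) 0 = (if k = l then 1 else 0)" for k l
    by (simp add: S_Y2_nth_0 tensor_one algebra_homD[OF tensor_right_hom])
  have L0: "fps_nth (?L k l) 0 = (if k = l then 1 else 0)" for k l
    by (simp add: S_SY2_nth_0 tensor_one algebra_homD[OF tensor_left_hom])
  have R: "\<forall>k l. fps_nth (?R k l) n \<in> B" for n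
  proof (induction n rule: less_induct)
    case (less n)
    show ?case
    proof (cases "n = 0")
      case True
      then show ?thesis using R0 subalgebraD(1,2)[OF B] by simp
    next
      case False
      then have n: "0 < n" by simp
      \<comment> \<open>Since the constant terms are Kronecker deltas, suitable choices of indices
        isolate single coefficients of degree n.\<close>
      have step: "fps_nth (?R k l) n * fps_nth (?R p q) 0 + inverse (-1) ^ n *\<^sub>C (fps_nth (?R k l) 0 * fps_nth (?R p q) n) \<in> B" for k l p q
        by (rule mult_subst_affine_nth_in[OF B n _ _ RR]) (use less in blast)+
      have off: "fps_nth (?R k l) n \<in> B" if "k \<noteq> l" for k l
        using step[of k l I_p1 I_p1] that unfolding R0 by (simp add: complex_vector.scale_zero_right)
      have diag: "fps_nth (?R k k) n + (-1) ^ n *\<^sub>C fps_nth (?R p p) n \<in> B" for k p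
        using step[of k k p p] unfolding R0 by simp
      \<comment> \<open>For even n, p = k gives twice the entry. For odd n, p = -k gives a
        difference, which the symmetry relation turns into twice the entry.\<close>
      have "fps_nth (?R k k) n \<in> B" for k
      proof (cases "even n")
        case True
        then have "fps_nth (?R k k) n + fps_nth (?R k k) n \<in> B" using diag[of k k] by simp
        then show ?thesis by (rule half_in[OF B])
      next
        case False
        have "fps_nth (?R k k) n + fps_nth (?R (- k) (- k)) n = 1 \<otimes>\<^sub>C (fps_nth (S_Y2 $ k $ k) n + fps_nth (S_Y2 $ (- k) $ (- k)) n)"
          by (simp only: nth_map_coeffs tensor_bilinear)
        also have "\<dots> = 0"
          unfolding S_Y2_symmetry_odd[OF False] by (simp add: algebra_homD[OF tensor_right_hom])
        finally have "fps_nth (?R (- k) (- k)) n = - fps_nth (?R k k) n"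
          by (simp only: eq_neg_iff_add_eq_0 add.commute)
        then have "fps_nth (?R k k) n + fps_nth (?R k k) n \<in> B"
          using diag[of k "- k"] False by (simp add: complex_vector.scale_minus_left complex_vector.scale_minus_right)
        then show ?thesis by (rule half_in[OF B])
      qed
      with off show ?thesis by metis
    qed
  qed
  have L: "\<forall>i j. fps_nth (?L i j) n \<in> B" for n
  proof (induction n rule: less_induct)
    case (less n)
    show ?case
    proof (cases "n = 0")
      case True
      then show ?thesis using L0 subalgebraD(1,2)[OF B] by simp
    next
      case False
      then have n: "0 < n" by simp
      have "fps_nth (?L i j) n \<in> B" for i j
      proof -
        \<comment> \<open>Substitution with a = 1 and b = 0 is the identity, so \<open>gen\<close>
          itself supplies the product, and the second-factor coefficients are already in
          \<open>B\<close>.\<close>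
        have "fps_nth (?L i j) n * fps_nth (?R I_p1 I_p1) 0 + inverse 1 ^ n *\<^sub>C (fps_nth (?L i j) 0 * fps_nth (?R I_p1 I_p1) n) \<in> B"
          by (rule mult_subst_affine_nth_in[OF B n, where b = 0]) (use less R gen in \<open>auto simp: subst_affine_id simp del: nth_map_coeffs\<close>)
        then have "fps_nth (?L i j) n + fps_nth (?L i j) 0 * fps_nth (?R I_p1 I_p1) n \<in> B"
          unfolding R0 by simp
        moreover have "fps_nth (?L i j) 0 * fps_nth (?R I_p1 I_p1) n \<in> B"
          unfolding L0 using R subalgebraD(2)[OF B] by simp
        ultimately show ?thesis using subalgebraD(7)[OF B] by fastforce
      qed
      then show ?thesis by blast
    qed
  qed
  have "UNIV \<subseteq> (\<lambda>a. a \<otimes>\<^sub>C 1) -` B"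
    unfolding hull_coefficients_S_SY2[symmetric]
    by (rule hull_minimal[where S = subalgebra, OF _ subalgebra_vimage[OF tensor_left_hom B]])
       (use L in \<open>auto simp: coefficients_def\<close>)
  then have left: "a \<otimes>\<^sub>C 1 \<in> B" for a by blast
  have "UNIV \<subseteq> (\<lambda>a. 1 \<otimes>\<^sub>C a) -` B"
    unfolding hull_coefficients_S_Y2[symmetric]
    by (rule hull_minimal[where S = subalgebra, OF _ subalgebra_vimage[OF tensor_right_hom B]])
       (use R in \<open>auto simp: coefficients_def\<close>)
  then have right: "1 \<otimes>\<^sub>C b \<in> B" for b by blast
  have "x \<in> B" for x
  proof (induction x rule: tensor_induct)
    case (1 a b)
    show ?case using subalgebraD(4)[OF B left[of a] right[of b]] by (simp add: tensor_mult)
  qed (rule subalgebraD(3)[OF B])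
  then show ?thesis by blast
qed

lemma bij_betw_Pr1: "bij_betw Pr1 diagonal_subalgebra UNIV"
proof (rule bij_betw_imageI[OF inj_on_Pr1], rule surj_on_diagonal)
  show "subalgebra (Pr1 ` diagonal_subalgebra)"
    unfolding diagonal_subalgebra_def by (rule subalgebra_image[OF Pr1_Pr2_hom(1) subalgebra_hull])
  fix i j k l n
  let ?F = "left_series (S_Y2 $ i $ j) * right_series (S_Y2 $ k $ l) :: (y2tw, y2tw) tensor fps"
  have "map_coeffs Pr1 ?F = left_series (S_SY2 $ i $ j) * right_series (S_Y2 $ k $ l)"
    unfolding map_coeffs_hom(1)[OF Pr1_Pr2_hom(1)]
    by (simp add: map_coeffs_compose S_SY2_def Pr1_def tensor_map(2)[OF algebra_homD(1)[OF Pr_hom] algebra_homD(1)[OF algebra_hom_id]]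
        algebra_homD[OF Pr_hom])
  then have "fps_nth (left_series (S_SY2 $ i $ j) * right_series (S_Y2 $ k $ l)) n = Pr1 (fps_nth ?F n)"
    by (metis nth_map_coeffs)
  moreover have "fps_nth ?F n \<in> diagonal_subalgebra"
    unfolding diagonal_subalgebra_def by (rule hull_inc) blast
  ultimately show "fps_nth (left_series (S_SY2 $ i $ j) * right_series (S_Y2 $ k $ l)) n \<in> Pr1 ` diagonal_subalgebra"
    by simp
qed

section \<open>Transfer to \<open>Pr2\<close> by the flip\<close>

lemma tensor_swap:
  obtains f :: "('a::complex_algebra_1, 'b::complex_algebra_1) tensor \<Rightarrow> ('b, 'a) tensor"
  where "algebra_hom f" "\<And>a b. f (a \<otimes>\<^sub>C b) = b \<otimes>\<^sub>C a"
proof -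
  have "(1 \<otimes>\<^sub>C a) * (b \<otimes>\<^sub>C 1) = (b \<otimes>\<^sub>C 1) * (1 \<otimes>\<^sub>C a :: ('b, 'a) tensor)" for a b
    by (simp add: tensor_mult)
  from tensor_lift[OF tensor_right_hom tensor_left_hom this]
  obtain f :: "('a, 'b) tensor \<Rightarrow> ('b, 'a) tensor"
    where "algebra_hom f" "\<And>a b. f (a \<otimes>\<^sub>C b) = (1 \<otimes>\<^sub>C a) * (b \<otimes>\<^sub>C 1)" by blast
  then show ?thesis using that by (simp add: tensor_mult)
qed

text \<open>\<open>Pr2\<close> is \<open>Pr1\<close> conjugated by flips, and the flip permutes the
  generators of the diagonal subalgebra.\<close>

lemma bij_betw_Pr2: "bij_betw Pr2 diagonal_subalgebra UNIV"
proof -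
  obtain s :: "(y2tw, y2tw) tensor \<Rightarrow> (y2tw, y2tw) tensor" where s: "algebra_hom s" "\<And>a b. s (a \<otimes>\<^sub>C b) = b \<otimes>\<^sub>C a"
    using tensor_swap by blast
  obtain t :: "(sy2tw, y2tw) tensor \<Rightarrow> (y2tw, sy2tw) tensor" where t: "algebra_hom t" "\<And>a b. t (a \<otimes>\<^sub>C b) = b \<otimes>\<^sub>C a"
    using tensor_swap by blast
  obtain t' :: "(y2tw, sy2tw) tensor \<Rightarrow> (sy2tw, y2tw) tensor" where t': "algebra_hom t'" "\<And>a b. t' (a \<otimes>\<^sub>C b) = b \<otimes>\<^sub>C a"
    using tensor_swap by blast
  have ss: "s (s x) = x" for x
    by (induction x rule: tensor_induct) (simp_all add: s algebra_homD[OF s(1)])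
  have tt: "t (t' x) = x" for x
    by (induction x rule: tensor_induct) (simp_all add: t t' algebra_homD[OF t(1)] algebra_homD[OF t'(1)])
  have tt': "t' (t x) = x" for x
    by (induction x rule: tensor_induct) (simp_all add: t t' algebra_homD[OF t(1)] algebra_homD[OF t'(1)])
  have Pr2: "Pr2 x = t (Pr1 (s x))" for x
  proof (induction x rule: tensor_induct)
    case (1 a b)
    show ?case by (simp add: s t Pr1_def Pr2_def tensor_map(2)[OF algebra_homD(1)[OF Pr_hom] algebra_homD(1)[OF algebra_hom_id]]
        tensor_map(2)[OF algebra_homD(1)[OF algebra_hom_id] algebra_homD(1)[OF Pr_hom]])
  qed (simp add: algebra_homD[OF s(1)] algebra_homD[OF t(1)] algebra_homD[OF Pr1_Pr2_hom(1)] algebra_homD[OF Pr1_Pr2_hom(2)])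
  have "s w \<in> diagonal_subalgebra" if w: "w \<in> diagonal_subalgebra" for w
  proof -
    have "diagonal_subalgebra \<subseteq> s -` diagonal_subalgebra"
      unfolding diagonal_subalgebra_def
    proof (rule hull_minimal[where S = subalgebra, OF _ subalgebra_vimage[OF s(1) subalgebra_hull]], rule subsetI)
      let ?F = "\<lambda>i j k l. left_series (S_Y2 $ i $ j) * right_series (S_Y2 $ k $ l) :: (y2tw, y2tw) tensor fps"
      fix w assume "w \<in> {fps_nth (?F i j k l) n | i j k l n. True}"
      then obtain i j k l n where w: "w = fps_nth (?F i j k l) n" by blast
      have "map_coeffs s (?F i j k l) = right_series (S_Y2 $ i $ j) * left_series (S_Y2 $ k $ l)"
        by (simp add: map_coeffs_hom[OF s(1)] map_coeffs_compose s(2))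
      also have "\<dots> = ?F k l i j"
        by (rule coeffs_commute_mult) (simp add: coeffs_commute_def tensor_mult)
      finally have eq: "s (fps_nth (?F i j k l) n) = fps_nth (?F k l i j) n"
        by (metis nth_map_coeffs)
      show "w \<in> s -` (subalgebra hull {fps_nth (?F i j k l) n | i j k l n. True})"
        unfolding w vimage_eq eq by (rule hull_inc) blast
    qed
    with w show ?thesis by blast
  qed
  then have "bij_betw s diagonal_subalgebra diagonal_subalgebra"
    by (intro bij_betw_byWitness[where f' = s]) (auto simp: ss)
  moreover have "bij t" by (rule o_bij[of t']) (auto simp: fun_eq_iff tt tt')
  ultimately have "bij_betw (t \<circ> (Pr1 \<circ> s)) diagonal_subalgebra UNIV"
    using bij_betw_Pr1 by (blast intro: bij_betw_trans)
  moreover have "t \<circ> (Pr1 \<circ> s) = Pr2" by (simp add: fun_eq_iff Pr2)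
  ultimately show ?thesis by simp
qed

section \<open>The image of the embedding\<close>

lemma kron_mult_kron:
  fixes A B :: "'a::ring_1^'n::finite^'n"
  shows "kron A (mat 1) ** kron B (mat 1 :: 'a^'m::finite^'m) = kron (A ** B) (mat 1)"
    "kron (mat 1 :: 'a^'m::finite^'m) A ** kron (mat 1) B = kron (mat 1) (A ** B)"
proof -
  have sum_pair: "(\<Sum>r\<in>UNIV. f r) = (\<Sum>a\<in>UNIV. \<Sum>b\<in>UNIV. f (a, b))" for f :: "'p::finite \<times> 'q::finite \<Rightarrow> 'a"
    unfolding sum.cartesian_product UNIV_Times_UNIV by simp
  have "(kron A (mat 1) ** kron B (mat 1 :: 'a^'m^'m)) $ (i, k) $ (j, l) = kron (A ** B) (mat 1) $ (i, k) $ (j, l)" for i j k l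
  proof -
    have "(kron A (mat 1) ** kron B (mat 1 :: 'a^'m^'m)) $ (i, k) $ (j, l) =
      (\<Sum>a\<in>UNIV. \<Sum>b\<in>UNIV. if k = b then A $ i $ a * B $ a $ j * (if b = l then 1 else 0) else 0)"
      unfolding matrix_matrix_mult_def vec_lambda_beta sum_pair by (intro sum.cong refl) (simp add: kron_def mat_def)
    also have "\<dots> = kron (A ** B) (mat 1) $ (i, k) $ (j, l)"
      by (simp add: kron_def mat_def matrix_matrix_mult_def sum_distrib_right)
    finally show ?thesis .
  qed
  then show "kron A (mat 1) ** kron B (mat 1 :: 'a^'m^'m) = kron (A ** B) (mat 1)"
    by (simp add: vec_eq_iff)
  have "(kron (mat 1 :: 'a^'m^'m) A ** kron (mat 1) B) $ (i, k) $ (j, l) = kron (mat 1) (A ** B) $ (i, k) $ (j, l)" for i j k l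
  proof -
    have "(kron (mat 1 :: 'a^'m^'m) A ** kron (mat 1) B) $ (i, k) $ (j, l) =
      (\<Sum>a\<in>UNIV. if i = a then \<Sum>b\<in>UNIV. (if a = j then 1 else 0) * (A $ k $ b * B $ b $ l) else 0)"
      unfolding matrix_matrix_mult_def vec_lambda_beta sum_pair
      by (intro sum.cong refl) (auto simp: kron_def mat_def)
    also have "\<dots> = kron (mat 1) (A ** B) $ (i, k) $ (j, l)"
      by (simp add: kron_def mat_def matrix_matrix_mult_def sum_distrib_left)
    finally show ?thesis .
  qed
  then show "kron (mat 1 :: 'a^'m^'m) A ** kron (mat 1) B = kron (mat 1) (A ** B)"
    by (simp add: vec_eq_iff)
qed

text \<open>The signs of the basis vectors and the entries of K combine into one sign
  \<open>e\<close>; \<open>e * e = 1\<close> allows it to be undone.\<close>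

lemma phi2_matrix_nth:
  "\<exists>e. e * e = 1 \<and> (\<forall>n. fps_nth (in_basis_v phi2_matrix $ p $ q) n = e *\<^sub>C fps_nth (subst_affine 1 (-1/2)
      (left_series (S_Y2 $ fst (v_index p) $ fst (v_index q)) * right_series (S_Y2 $ snd (v_index p) $ snd (v_index q)))) n)"
proof -
  let ?E = "subst_affine 1 (-1/2) :: (y2tw, y2tw) tensor fps \<Rightarrow> _"
  obtain a b c d where v: "v_index p = (a, b)" "v_index q = (c, d)" by (metis surj_pair)
  \<comment> \<open>The diagonal of K; as K multiplies from the right, it is evaluated at the column
    indices.\<close>
  define \<kappa> :: "ix2 \<Rightarrow> complex" where "\<kappa> i = (if i = I_p1 then 1 else - 1)" for i
  define e where "e = v_sign p * v_sign q * (\<kappa> c * \<kappa> d)"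
  have sgn: "(v_sign p :: complex) = 1 \<or> (v_sign p :: complex) = - 1" for p by (cases p) auto
  have "\<kappa> i = 1 \<or> \<kappa> i = - 1" for i by (simp add: \<kappa>_def)
  then have e: "e * e = 1" using sgn[of p] sgn[of q] unfolding e_def by (metis (no_types) minus_mult_minus mult.left_neutral mult_minus1 mult_minus1_right)
  have K: "(M ** matrix_K) $ i $ j = (if j = I_p1 then M $ i $ j else - M $ i $ j)" for M :: "(y2tw, y2tw) tensor fps^ix2^ix2" and i j
    by (cases j; simp add: matrix_matrix_mult_def sum_ix2 matrix_K_nth)
  let ?A = "map_entries left_series (map_entries (subst_affine 1 (-1/2)) S_Y2) :: (y2tw, y2tw) tensor fps^ix2^ix2"
  let ?B = "map_entries right_series (map_entries (subst_affine 1 (-1/2)) S_Y2) :: (y2tw, y2tw) tensor fps^ix2^ix2"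
  have phi2: "phi2_matrix = kron (?A ** matrix_K) (mat 1) ** kron (mat 1) (?B ** matrix_K)"
    unfolding phi2_matrix_def Let_def kron_mult_kron[symmetric] by (simp only: matrix_mul_assoc)
  have "phi2_matrix $ (a, b) $ (c, d) = (?A ** matrix_K) $ a $ c * (?B ** matrix_K) $ b $ d"
    unfolding phi2 by (rule kron_mat_1_mult)
  moreover have "?A $ a $ c * ?B $ b $ d = ?E (left_series (S_Y2 $ a $ c) * right_series (S_Y2 $ b $ d))"
    by (simp add: subst_affine_mult subst_affine_map[OF algebra_homD(1)[OF tensor_left_hom]]
        subst_affine_map[OF algebra_homD(1)[OF tensor_right_hom]])
  ultimately have "fps_nth (in_basis_v phi2_matrix $ p $ q) n =
      e *\<^sub>C fps_nth (?E (left_series (S_Y2 $ a $ c) * right_series (S_Y2 $ b $ d))) n" for n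
    unfolding in_basis_v_def vec_lambda_beta v K e_def \<kappa>_def
    by (cases p; cases q) (auto simp: complex_vector.scale_minus_left)
  with e show ?thesis by (auto simp: v)
qed

text \<open>Signs and affine shifts act on coefficients by invertible scalar combinations, so both
  families generate the same subalgebra.\<close>

lemma hull_in_basis_v_phi2_matrix:
  "subalgebra hull coefficients (in_basis_v phi2_matrix) = diagonal_subalgebra"
proof -
  let ?F = "\<lambda>i j k l. left_series (S_Y2 $ i $ j) * right_series (S_Y2 $ k $ l) :: (y2tw, y2tw) tensor fps"
  let ?H = "subalgebra hull coefficients (in_basis_v phi2_matrix)"
  note D = subalgebra_hull[of "{fps_nth (?F i j k l) n | i j k l n. True}", folded diagonal_subalgebra_def]
  have gen: "fps_nth (?F i j k l) n \<in> diagonal_subalgebra" for i j k l n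
    unfolding diagonal_subalgebra_def by (rule hull_inc) blast
  have "?H \<subseteq> diagonal_subalgebra"
  proof (rule hull_minimal[where S = subalgebra, OF _ D], rule subsetI)
    fix x assume "x \<in> coefficients (in_basis_v phi2_matrix)"
    then obtain p q n where x: "x = fps_nth (in_basis_v phi2_matrix $ p $ q) n" by (auto simp: coefficients_def)
    obtain e where "\<And>n. fps_nth (in_basis_v phi2_matrix $ p $ q) n = e *\<^sub>C fps_nth (subst_affine 1 (-1/2)
        (?F (fst (v_index p)) (fst (v_index q)) (snd (v_index p)) (snd (v_index q)))) n"
      using phi2_matrix_nth[of p q] by blast
    then show "x \<in> diagonal_subalgebra"
      unfolding x by (auto intro!: subalgebraD(5)[OF D] subst_affine_nth_in[OF D] gen)
  qed
  moreover have "diagonal_subalgebra \<subseteq> ?H"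
    unfolding diagonal_subalgebra_def
  proof (rule hull_minimal[where S = subalgebra, OF _ subalgebra_hull], safe)
    fix i j k l n
    have surj: "\<exists>p. v_index p = (a, b)" for a b
      by (cases a; cases b) (metis v_index.simps)+
    obtain p q where pq: "v_index p = (i, k)" "v_index q = (j, l)" using surj by metis
    obtain e where e: "e * e = 1" and eq: "\<And>n. fps_nth (in_basis_v phi2_matrix $ p $ q) n =
        e *\<^sub>C fps_nth (subst_affine 1 (-1/2) (?F i j k l)) n"
      using phi2_matrix_nth[of p q] unfolding pq fst_conv snd_conv by blast
    have "fps_nth (subst_affine 1 (-1/2) (?F i j k l)) n \<in> ?H" for n
    proof -
      have "fps_nth (subst_affine 1 (-1/2) (?F i j k l)) n = e *\<^sub>C fps_nth (in_basis_v phi2_matrix $ p $ q) n"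
        by (simp add: eq e)
      also have "\<dots> \<in> ?H"
        by (rule subalgebraD(5)[OF subalgebra_hull], rule hull_inc) (auto simp: coefficients_def)
      finally show ?thesis .
    qed
    \<comment> \<open>The opposite shift recovers the original series, and each of its coefficients
      is a scalar combination of coefficients already in \<open>?H\<close>.\<close>
    then have "fps_nth (subst_affine 1 (1/2) (subst_affine 1 (-1/2) (?F i j k l))) n \<in> ?H"
      by (rule subst_affine_nth_in[OF subalgebra_hull])
    then show "fps_nth (?F i j k l) n \<in> ?H"
      by (simp add: subst_affine_compose subst_affine_id)
  qed
  ultimately show ?thesis by blast
qed

theorem corollary4p17:
  fixes \<phi>\<^sub>2 :: "x4tw \<Rightarrow> (y2tw, y2tw) tensor"
  assumes "algebra_embedding \<phi>\<^sub>2"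
    and "map_entries (map_coeffs \<phi>\<^sub>2) S_X4 = in_basis_v phi2_matrix"
  shows "algebra_iso (Pr1 \<circ> \<phi>\<^sub>2) \<and> algebra_iso (Pr2 \<circ> \<phi>\<^sub>2)"
proof -
  have \<phi>: "algebra_hom \<phi>\<^sub>2" "inj \<phi>\<^sub>2" using assms(1) by (auto simp: algebra_embedding_def)
  have "range \<phi>\<^sub>2 = subalgebra hull (\<phi>\<^sub>2 ` coefficients S_X4)"
    unfolding image_hull[OF \<phi>(1), symmetric] hull_coefficients_S_X4 ..
  also have "\<dots> = diagonal_subalgebra"
    unfolding coefficients_map[symmetric] assms(2) by (rule hull_in_basis_v_phi2_matrix)
  finally have "bij_betw \<phi>\<^sub>2 UNIV diagonal_subalgebra" using \<phi>(2) by (simp add: bij_betw_def)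
  then have "bij (Pr1 \<circ> \<phi>\<^sub>2)" "bij (Pr2 \<circ> \<phi>\<^sub>2)"
    using bij_betw_Pr1 bij_betw_Pr2 by (blast intro: bij_betw_trans)+
  moreover have "algebra_hom (Pr1 \<circ> \<phi>\<^sub>2)" "algebra_hom (Pr2 \<circ> \<phi>\<^sub>2)"
    using algebra_hom_compose[OF \<phi>(1)] Pr1_Pr2_hom by (simp_all add: comp_def)
  ultimately show ?thesis by (simp add: algebra_iso_def)
qed

end
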